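(* There is an absolute constant $C$ such that the following holds. Let $n\ge 5$ and let $P$ be a $4$-polytope with $n$ facets which is combinatorially equivalent to the dual (polar) of the cyclic $4$-polytope $C(n)=\operatorname{conv}\{(i,i^2,i^3,i^4)^T : i=0,1,\dots,n-1\}\subset\mathbb{R}^4$. Let $D$ be any acyclic unique sink orientation (AUSO) of the graph of $P$, and let $v_{\mathrm{st}}$ be any vertex of $P$. Then the random edge simplex algorithm started at $v_{\mathrm{st}}$ on $D$ reaches the global sink of $D$ after an expected number of at most $Cn$ pivot steps.
   Context: The graph of a polytope is its vertex–edge graph (1-skeleton). An orientation $D$ of the graph of a polytope $P$ is an acyclic unique sink orientation (AUSO) if $D$ has no directed cycle and, for every nonempty face $F$ of $P$, the subgraph of $D$ induced by the vertices of $F$ has exactly one sink (vertex without outgoing arcs). Every orientation induced by a generic linear objective function on a realization of $P$ is an AUSO. The global sink of $D$ is the unique sink of $D$ (the face $P$ itself). The random edge simplex algorithm: at the current vertex $v$, if $v$ is not the global sink, move along an outgoing arc of $v$ chosen uniformly at random among all outgoing arcs of $v$; repeat until the global sink is reached. A pivot step is one such move. *)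

theory Defs
  imports "HOL-Analysis.Analysis" "HOL-Probability.Probability"
begin

definition moment_point :: "real \<Rightarrow> real ^ 4" where
  "moment_point t = vector [t, t ^ 2, t ^ 3, t ^ 4]"

definition cyclic_polytope4 :: "nat \<Rightarrow> (real ^ 4) set" where
  "cyclic_polytope4 n = convex hull (moment_point ` real ` {0..<n})"

text \<open>The polar of \<open>Q\<close> taken with respect to the point \<open>c\<close>, i.e. the usual polar of the
  translate of \<open>Q\<close> by \<open>- c\<close>. It is a polytope dual to \<open>Q\<close> when \<open>Q\<close> is a full-dimensional
  polytope and \<open>c\<close> an interior point; the origin itself is not an interior point of
  \<open>cyclic_polytope4 n\<close>.\<close>

definition polar_at :: "'a::real_inner \<Rightarrow> 'a set \<Rightarrow> 'a set" where
  "polar_at c Q = {y. \<forall>x\<in>Q. (x - c) \<bullet> y \<le> 1}"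

text \<open>Isomorphism of face lattices; both the empty face and the improper face are included.\<close>

definition combinatorially_equivalent ::
    "'a::real_vector set \<Rightarrow> 'b::real_vector set \<Rightarrow> bool" where
  "combinatorially_equivalent P Q \<longleftrightarrow>
     (\<exists>\<phi>. bij_betw \<phi> {F. F face_of P} {G. G face_of Q} \<and>
          (\<forall>F G. F face_of P \<longrightarrow> G face_of P \<longrightarrow> (F \<subseteq> G \<longleftrightarrow> \<phi> F \<subseteq> \<phi> G)))"

definition adjacent_vertices :: "'a::euclidean_space set \<Rightarrow> 'a \<Rightarrow> 'a \<Rightarrow> bool" where
  "adjacent_vertices P u v \<longleftrightarrow>
     u extreme_point_of P \<and> v extreme_point_of P \<and> u \<noteq> v \<and> closed_segment u v edge_of P"

definition graph_orientation :: "'a::euclidean_space set \<Rightarrow> ('a \<times> 'a) set \<Rightarrow> bool" where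
  "graph_orientation P D \<longleftrightarrow>
     (\<forall>u v. (u, v) \<in> D \<longrightarrow> adjacent_vertices P u v) \<and>
     (\<forall>u v. adjacent_vertices P u v \<longrightarrow> ((u, v) \<in> D) \<noteq> ((v, u) \<in> D))"

text \<open>\<open>v\<close> is a sink of the subgraph of \<open>D\<close> induced by the vertices of the face \<open>F\<close>.\<close>

definition sink_of_face :: "('a::real_vector \<times> 'a) set \<Rightarrow> 'a set \<Rightarrow> 'a \<Rightarrow> bool" where
  "sink_of_face D F v \<longleftrightarrow>
     v extreme_point_of F \<and> (\<forall>w. w extreme_point_of F \<longrightarrow> (v, w) \<notin> D)"

definition AUSO :: "'a::euclidean_space set \<Rightarrow> ('a \<times> 'a) set \<Rightarrow> bool" where
  "AUSO P D \<longleftrightarrow>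
     graph_orientation P D \<and> acyclic D \<and>
     (\<forall>F. F face_of P \<longrightarrow> F \<noteq> {} \<longrightarrow> (\<exists>!v. sink_of_face D F v))"

definition global_sink :: "'a::real_vector set \<Rightarrow> ('a \<times> 'a) set \<Rightarrow> 'a" where
  "global_sink P D = (THE v. sink_of_face D P v)"

text \<open>\<open>random_edge_steps t D v\<close> is the distribution of the number of pivot steps made by the
  algorithm from the vertex \<open>v\<close> until the target \<open>t\<close> is reached. The missing mass of this
  subprobability distribution is the probability that \<open>t\<close> is never reached.\<close>

partial_function (spmf) random_edge_steps :: "'a \<Rightarrow> ('a \<times> 'a) set \<Rightarrow> 'a \<Rightarrow> nat spmf" where
  "random_edge_steps t D v =
     (if v = t then return_spmf 0
      else bind_spmf (spmf_of_set {w. (v, w) \<in> D})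
             (\<lambda>w. map_spmf Suc (random_edge_steps t D w)))"

text \<open>The outcome \<open>None\<close> (the target is never reached) counts as infinitely many steps.\<close>

definition expected_pivot_steps :: "'a::real_vector set \<Rightarrow> ('a \<times> 'a) set \<Rightarrow> 'a \<Rightarrow> ennreal" where
  "expected_pivot_steps P D v =
     (\<integral>\<^sup>+ r. (case r of None \<Rightarrow> \<infinity> | Some k \<Rightarrow> of_nat k)
        \<partial>measure_pmf (random_edge_steps (global_sink P D) D v))"

end

theory Submission
  imports Defs
begin

text \<open>
  By Gale's evenness condition a vertex of the dual cyclic polytope is tight exactly at the facets
  \<open>x, x + 1, y, y + 1\<close> modulo \<open>n\<close>. Unrolling both coordinates over \<open>\<int>\<close> lifts the graph to a strip
  of the plane grid in which the large polygons become monotone chains, and an acyclic unique sink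
  orientation lifts to an orientation with one sink and one source per period on every chain.

  Call a vertex bad if it lies on the boundary of the strip or is the sink or the source of one
  of its two chains; there are at most \<open>3 n\<close> bad vertices, and none is visited twice. At every
  other vertex exactly one of the two directions on each chain is outgoing, so a random step moves
  either coordinate with probability 1/2. For a lifted vertex either one lift of the global sink
  is reachable, or it is reachable from one lift of the global source only, or neither, and the
  last case ends after one step. In the first case a planarity argument shows that moving past
  the coordinate of the sink excludes a row or column from all later vertices; hence the distance
  to the sink, plus the number of rows and columns still reachable, decreases on average. The
  second case is the mirror image. Adding multiples of the number of reachable bad vertices
  gives a potential of size \<open>O(n)\<close> which drops by at least 1 in expectation in every step.
\<close>

section \<open>The unrolled graph\<close>

text \<open>In the quotient a path may wind around, so "towards the sink" has no meaning there. In
  the strip it can be measured against one fixed lift of the sink, provided that no other lift is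
  reachable; this is why the phases are separated by reachability. The phase in between is short
  because a chain sink minimises and a chain source maximises the height on its chain and any two
  chains meet: a path from a chain sink to a chain source would have constant height. When one move
  approaches the sink and the other recedes, the distance alone is a fair walk; the row or column
  lost for good pays for exactly this case. In the mirrored phase the extra row belongs to the
  successor instead of the current vertex, and only if that successor is again of the undecided
  kind. This is the origin of the bonus term in \<open>source_potential\<close>. Near bad vertices
  the distance can change by 2 in one step; multiples of the number of bad vertices still ahead
  absorb this.\<close>

definition strip_points :: "int \<Rightarrow> (int \<times> int) set" where
  "strip_points n = {(x, y). x + 2 \<le> y \<and> y \<le> x + n - 2}"

text \<open>Generator of the deck group: the two pairs of tight facets are unordered, so exchanging
  them and going once around gives the same vertex. Its square is the translation by
  \<open>(n, n)\<close>.\<close>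

definition deck :: "int \<Rightarrow> int \<times> int \<Rightarrow> int \<times> int" where
  "deck n u = (snd u, fst u + n)"

text \<open>\<open>mv1 n s\<close> follows the edge on which the facet \<open>x\<close> (for \<open>s = 1\<close>) or \<open>x + 1\<close> (otherwise) stops being
  tight, \<open>mv2\<close> does the same for \<open>y\<close>; at the boundary of the strip the other pair is pushed along.\<close>

definition mv1 :: "int \<Rightarrow> int \<Rightarrow> int \<times> int \<Rightarrow> int \<times> int" where
  "mv1 n s u = (if s = 1 then (if snd u \<ge> fst u + 3 then (fst u + 1, snd u) else (fst u + 1, snd u + 1))
     else (if snd u \<le> fst u + n - 3 then (fst u - 1, snd u) else (fst u - 1, snd u - 1)))"

definition mv2 :: "int \<Rightarrow> int \<Rightarrow> int \<times> int \<Rightarrow> int \<times> int" where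
  "mv2 n s u = (if s = 1 then (if snd u \<le> fst u + n - 3 then (fst u, snd u + 1) else (fst u + 1, snd u + 1))
     else (if snd u \<ge> fst u + 3 then (fst u, snd u - 1) else (fst u - 1, snd u - 1)))"

text \<open>The polygon of the vertices tight at \<open>i\<close> and \<open>i + 1\<close> has \<open>n - 2\<close> vertices; \<open>chain n i\<close> is its
  universal cover, on which \<open>deck\<close> acts as the shift by \<open>n - 2\<close>.\<close>

definition chain :: "int \<Rightarrow> int \<Rightarrow> int \<Rightarrow> int \<times> int" where
  "chain n i k = (let N = n - 2; h = k div (2 * N); r = k mod (2 * N) in
     if r = 0 then (i - 1 + h * n, i + 1 + h * n)
     else if r < N then (i + h * n, i + 1 + r + h * n)
     else if r = N then (i + 1 + h * n, i + n - 1 + h * n)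
     else (i + 1 + r - N + h * n, i + n + h * n))"

section \<open>Coordinates along a chain\<close>

lemma chain_split:
  fixes n k :: int
  assumes "n \<ge> 5"
  obtains h r where "k = 2 * (n - 2) * h + r" "0 \<le> r" "r < 2 * (n - 2)"
proof -
  have "k = 2 * (n - 2) * (k div (2 * (n - 2))) + k mod (2 * (n - 2))" by simp
  moreover have "0 \<le> k mod (2 * (n - 2))" "k mod (2 * (n - 2)) < 2 * (n - 2)"
    using assms by auto
  ultimately show thesis using that by blast
qed

lemma chain_eq:
  assumes "n \<ge> 5" "0 \<le> r" "r < 2 * (n - 2)"
  shows "chain n i (2 * (n - 2) * h + r) = (if r = 0 then (i - 1 + h * n, i + 1 + h * n)
     else if r < n - 2 then (i + h * n, i + 1 + r + h * n)
     else if r = n - 2 then (i + 1 + h * n, i + n - 1 + h * n)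
     else (i + 3 + r - n + h * n, i + n + h * n))"
proof -
  have "(2 * (n - 2) * h + r) div (2 * (n - 2)) = h" 
    using assms by (simp add: div_mult_self4 div_pos_pos_trivial)
  moreover have "(2 * (n - 2) * h + r) mod (2 * (n - 2)) = r"
    using assms by (simp add: mod_pos_pos_trivial)
  ultimately show ?thesis using assms unfolding chain_def Let_def by simp
qed

lemma chain_in_strip: assumes "n \<ge> 5" shows "chain n i k \<in> strip_points n"
proof -
  obtain h r where k: "k = 2 * (n - 2) * h + r" "0 \<le> r" "r < 2 * (n - 2)"
    using chain_split[OF assms] .
  show ?thesis unfolding k(1) chain_eq[OF assms k(2,3)] using k assms by (auto simp: strip_points_def)
qed

lemma chain_deck: assumes "n \<ge> 5" shows "chain n i (k + (n - 2)) = deck n (chain n i k)"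
proof -
  obtain h r where k: "k = 2 * (n - 2) * h + r" "0 \<le> r" "r < 2 * (n - 2)"
    using chain_split[OF assms] .
  show ?thesis
  proof (cases "r < n - 2")
    case True
    have e: "k + (n - 2) = 2 * (n - 2) * h + (r + (n - 2))" using k by simp
    have r: "0 \<le> r + (n - 2)" "r + (n - 2) < 2 * (n - 2)" using True k assms by auto
    show ?thesis
      unfolding e chain_eq[OF assms r] unfolding k(1) chain_eq[OF assms k(2,3)]
      using k(2,3) True by (auto simp: deck_def)
  next
    case False
    have e: "k + (n - 2) = 2 * (n - 2) * (h + 1) + (r - (n - 2))" using k by (simp add: algebra_simps)
    have r: "0 \<le> r - (n - 2)" "r - (n - 2) < 2 * (n - 2)" using False k assms by auto
    show ?thesis
      unfolding e chain_eq[OF assms r] unfolding k(1) chain_eq[OF assms k(2,3)]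
      using k(2,3) False by (auto simp: deck_def algebra_simps)
  qed
qed

text \<open>Replacing \<open>i\<close> by \<open>i + n\<close> names the same polygon. Its cover is
  only reindexed, by two periods, because applying \<open>deck\<close> twice translates by
  \<open>(n, n)\<close>.\<close>

lemma chain_shift: assumes "n \<ge> 5"
  shows "chain n (i + m * n) k = chain n i (k + m * (2 * (n - 2)))"
proof -
  obtain h r where k: "k = 2 * (n - 2) * h + r" "0 \<le> r" "r < 2 * (n - 2)"
    using chain_split[OF assms] .
  have e: "k + m * (2 * (n - 2)) = 2 * (n - 2) * (h + m) + r" using k by (simp add: algebra_simps)
  show ?thesis
    unfolding e chain_eq[OF assms k(2,3)] unfolding k(1) chain_eq[OF assms k(2,3)]
    by (auto simp: algebra_simps)
qed

text \<open>One period on either side of 0: first the row with second coordinate \<open>i\<close>,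
  then a boundary point at index 0, then the column with first coordinate \<open>i\<close>. Every
  point of the strip occurs once in the row half of such a window and once in the column half of
  another.\<close>

lemma chain_neg: assumes "n \<ge> 5" "- (n - 2) \<le> k" "k \<le> n - 2"
  shows "chain n i k = (if k = - (n - 2) then (i + 1 - n, i - 1) else if k < 0 then (i + k - 1, i)
     else if k = 0 then (i - 1, i + 1) else if k < n - 2 then (i, i + 1 + k) else (i + 1, i + n - 1))"
proof (cases "k < 0")
  case True
  have "k = 2 * (n - 2) * (-1) + (k + 2 * (n - 2))" by simp
  then have "chain n i k = chain n i (2 * (n - 2) * (-1) + (k + 2 * (n - 2)))" by (rule arg_cong)
  also have "\<dots> = (if k = - (n - 2) then (i + 1 - n, i - 1) else (i + k - 1, i))"
    using chain_eq[OF assms(1), of "k + 2 * (n - 2)" i "-1"] assms True by (auto simp: algebra_simps)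
  finally show ?thesis using True assms by auto
next
  case False
  then show ?thesis using chain_eq[OF assms(1), of k i 0] assms by (auto simp: algebra_simps)
qed

text \<open>A move of the first coordinate is a step on the chain named by the second one, diagonal
  boundary moves included, so the sign \<open>s\<close> becomes a shift of the position.\<close>

lemma chain_row:
  assumes "n \<ge> 5" "(x, y) \<in> strip_points n" "s = 1 \<or> s = -1"
  shows "chain n y (x - y + 1) = (x, y)" "chain n y (x - y + 1 + s) = mv1 n s (x, y)"
  using assms by (auto simp: chain_neg strip_points_def mv1_def)

lemma chain_col:
  assumes "n \<ge> 5" "(x, y) \<in> strip_points n" "s = 1 \<or> s = -1"
  shows "chain n x (y - x - 1) = (x, y)" "chain n x (y - x - 1 + s) = mv2 n s (x, y)"
  using assms by (auto simp: chain_neg strip_points_def mv2_def)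

lemma chain_succ:
  assumes "n \<ge> 5"
  shows "chain n i (k + 1) \<in> {mv1 n 1 (chain n i k), mv2 n 1 (chain n i k)}"
    "fst (chain n i k) \<le> fst (chain n i (k + 1))" "snd (chain n i k) \<le> snd (chain n i (k + 1))"
    "fst (chain n i k) + snd (chain n i k) < fst (chain n i (k + 1)) + snd (chain n i (k + 1))"
proof -
  obtain h r where k: "k = 2 * (n - 2) * h + r" "0 \<le> r" "r < 2 * (n - 2)"
    using chain_split[OF assms] .
  define H where "H = h * n"
  note c = chain_eq[OF assms k(2,3), of i h, folded k(1) H_def]
  have c1: "chain n i (k + 1) = (if r + 1 = 0 then (i - 1 + H, i + 1 + H)
     else if r + 1 < n - 2 then (i + H, i + 1 + (r + 1) + H)
     else if r + 1 = n - 2 then (i + 1 + H, i + n - 1 + H)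
     else (i + 3 + (r + 1) - n + H, i + n + H))" if "r + 1 < 2 * (n - 2)"
  proof -
    have e: "k + 1 = 2 * (n - 2) * h + (r + 1)" using k by simp
    show ?thesis unfolding e H_def by (rule chain_eq[OF assms _ that]) (use k in simp)
  qed
  have c2: "chain n i (k + 1) = (i - 1 + n + H, i + 1 + n + H)" if "r + 1 = 2 * (n - 2)"
  proof -
    have e: "k + 1 = 2 * (n - 2) * (h + 1) + 0" using k that by (simp add: algebra_simps)
    have "chain n i (k + 1) = (i - 1 + (h + 1) * n, i + 1 + (h + 1) * n)"
      unfolding e using chain_eq[OF assms, of 0 i "h + 1"] assms by simp
    then show ?thesis unfolding H_def by (simp add: algebra_simps)
  qed
  consider "r = 0" | "0 < r" "r < n - 3" | "r = n - 3" | "r = n - 2" | "n - 2 < r" "r + 1 < 2 * (n - 2)"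
    | "r + 1 = 2 * (n - 2)"
    using k by linarith
  then have "chain n i (k + 1) \<in> {mv1 n 1 (chain n i k), mv2 n 1 (chain n i k)} \<and> fst (chain n i k) \<le> fst (chain n i (k + 1)) \<and> snd (chain n i k) \<le> snd (chain n i (k + 1)) \<and> fst (chain n i k) + snd (chain n i k) < fst (chain n i (k + 1)) + snd (chain n i (k + 1))"
    by cases (use assms c c1 c2 in \<open>simp_all add: mv1_def mv2_def\<close>)
  then show "chain n i (k + 1) \<in> {mv1 n 1 (chain n i k), mv2 n 1 (chain n i k)}"
    "fst (chain n i k) \<le> fst (chain n i (k + 1))" "snd (chain n i k) \<le> snd (chain n i (k + 1))"
    "fst (chain n i k) + snd (chain n i k) < fst (chain n i (k + 1)) + snd (chain n i (k + 1))"
    by auto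
qed

lemma chain_mono:
  assumes "n \<ge> 5" "k \<le> l"
  shows "fst (chain n i k) \<le> fst (chain n i l)" "snd (chain n i k) \<le> snd (chain n i l)"
    "k < l \<Longrightarrow> fst (chain n i k) + snd (chain n i k) < fst (chain n i l) + snd (chain n i l)"
proof -
  have "fst (chain n i k) \<le> fst (chain n i l) \<and> snd (chain n i k) \<le> snd (chain n i l) \<and>
    (k < l \<longrightarrow> fst (chain n i k) + snd (chain n i k) < fst (chain n i l) + snd (chain n i l))"
    using assms(2)
  proof (induction l rule: int_ge_induct)
    case base then show ?case by simp
  next
    case (step l)
    then show ?case using chain_succ(2,3,4)[OF assms(1), of i l]
      by (cases "k = l") (simp, (intro conjI impI; linarith))
  qed
  then show "fst (chain n i k) \<le> fst (chain n i l)" "snd (chain n i k) \<le> snd (chain n i l)"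
    "k < l \<Longrightarrow> fst (chain n i k) + snd (chain n i k) < fst (chain n i l) + snd (chain n i l)" by auto
qed

lemma chain_mono_sign:
  assumes "n \<ge> 5" "s = 1 \<or> s = (-1::int)" "s * k \<le> s * l"
  shows "s * fst (chain n i k) \<le> s * fst (chain n i l)" "s * snd (chain n i k) \<le> s * snd (chain n i l)"
  using assms chain_mono[OF assms(1), of k l i] chain_mono[OF assms(1), of l k i] by auto

lemma chain_inj: assumes "n \<ge> 5" "chain n i k = chain n i l" shows "k = l"
  using chain_mono(3)[OF assms(1), of k l i] chain_mono(3)[OF assms(1), of l k i] assms(2)
  by (cases k l rule: linorder_cases) auto

lemma deck_strip: "deck n u \<in> strip_points n \<longleftrightarrow> u \<in> strip_points n"
  by (cases u) (auto simp: deck_def strip_points_def)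

lemma mv_strip: assumes "n \<ge> 5" "u \<in> strip_points n" "s = 1 \<or> s = -1"
  shows "mv1 n s u \<in> strip_points n" "mv2 n s u \<in> strip_points n"
  using assms by (cases u; auto simp: strip_points_def mv1_def mv2_def)+

lemma mv_deck: assumes "s = 1 \<or> s = -1"
  shows "mv1 n s (deck n u) = deck n (mv2 n s u)" "mv2 n s (deck n u) = deck n (mv1 n s u)"
  using assms by (cases u; auto simp: mv1_def mv2_def deck_def)+

text \<open>A diagonal boundary step is \<open>mv1\<close> seen from one end and \<open>mv2\<close>
  seen from the other, so the inverse may belong to the other family.\<close>

lemma mv_inverse_ex: assumes "n \<ge> 5" "u \<in> strip_points n" "s = 1 \<or> s = -1" 
  "w = mv1 n s u \<or> w = mv2 n s u"
  shows "u = mv1 n (-s) w \<or> u = mv2 n (-s) w"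
proof -
  obtain x y where u: "u = (x, y)" "x + 2 \<le> y" "y \<le> x + n - 2"
    using assms(2) by (auto simp: strip_points_def)
  consider "y = x + 2" | "y = x + n - 2" | "x + 3 \<le> y" "y \<le> x + n - 3" using u by linarith
  then show ?thesis
  proof cases
    case 1
    then have "\<not> y \<ge> x + 3" "y \<le> x + n - 3" using assms(1) by auto
    then show ?thesis using assms 1 u(1) by (elim disjE) (simp_all add: mv1_def mv2_def)
  next
    case 2
    then have "\<not> y \<le> x + n - 3" "y \<ge> x + 3" using assms(1) by auto
    then show ?thesis using assms 2 u(1) by (elim disjE) (simp_all add: mv1_def mv2_def)
  next
    case 3
    then show ?thesis using assms u(1) by (elim disjE) (simp_all add: mv1_def mv2_def)
  qed
qed

section \<open>Periodic orientations of the strip\<close>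

locale strip =
  fixes n :: int and E :: "int \<times> int \<Rightarrow> int \<times> int \<Rightarrow> bool" and f :: "int \<times> int \<Rightarrow> int" and M :: int
  assumes n5: "n \<ge> 5"
    and E_move: "E u w \<Longrightarrow> u \<in> strip_points n \<and> (\<exists>s\<in>{1, -1}. w = mv1 n s u \<or> w = mv2 n s u)"
    and E_orient: "u \<in> strip_points n \<Longrightarrow> s \<in> {1, -1} \<Longrightarrow> w = mv1 n s u \<or> w = mv2 n s u \<Longrightarrow> E u w \<noteq> E w u"
    and E_deck: "E (deck n u) (deck n w) \<longleftrightarrow> E u w"
    and f_deck: "u \<in> strip_points n \<Longrightarrow> f (deck n u) = f u"
    and f_less: "E u w \<Longrightarrow> f w < f u"
    and f_bound: "u \<in> strip_points n \<Longrightarrow> 0 \<le> f u \<and> f u \<le> M"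
    and chain_sink: "\<exists>K. \<forall>k. E (chain n i (k - 1)) (chain n i k) \<and> E (chain n i (k + 1)) (chain n i k)
        \<longleftrightarrow> (n - 2) dvd (k - K)"
    and chain_source: "\<exists>K. \<forall>k. E (chain n i k) (chain n i (k - 1)) \<and> E (chain n i k) (chain n i (k + 1))
        \<longleftrightarrow> (n - 2) dvd (k - K)"
    and fork: "E u v \<Longrightarrow> E u w \<Longrightarrow> (\<exists>c. E\<^sup>*\<^sup>* v c \<and> E\<^sup>*\<^sup>* w c) \<or>
        (\<exists>i k. u = chain n i k \<and> E (chain n i k) (chain n i (k - 1)) \<and> E (chain n i k) (chain n i (k + 1)))"
    and cofork: "E v u \<Longrightarrow> E w u \<Longrightarrow> (\<exists>c. E\<^sup>*\<^sup>* c v \<and> E\<^sup>*\<^sup>* c w) \<or>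
        (\<exists>i k. u = chain n i k \<and> E (chain n i (k - 1)) (chain n i k) \<and> E (chain n i (k + 1)) (chain n i k))"

lemma rtranclp_swap: "(\<lambda>u w. E w u)\<^sup>*\<^sup>* a b = E\<^sup>*\<^sup>* b a"
proof -
  have "(\<lambda>u w. E w u) = E\<inverse>\<inverse>" by (intro ext) simp
  then show ?thesis by (metis rtranclp_converseD rtranclp_converseI)
qed

text \<open>The assumptions of the locale come in dual pairs, with \<open>M - f\<close> as the new
  height. Every lemma about sinks reached from a point thus yields one about sources leading to
  it.\<close>

lemma (in strip) reverse: "strip n (\<lambda>u w. E w u) (\<lambda>u. M - f u) M"
proof (rule strip.intro)
  show "n \<ge> 5" by (rule n5)
next
  fix u w assume E: "E w u"
  obtain s where s': "s \<in> {1, -1}" and s2: "u = mv1 n s w \<or> u = mv2 n s w" and w: "w \<in> strip_points n"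
    using E_move[OF E] by (elim conjE bexE)
  have s1: "s = 1 \<or> s = -1" using s' by simp
  note s = s1 s2
  have "u \<in> strip_points n" using s2 mv_strip[OF n5 w s1] by (elim disjE) simp_all
  moreover have "- s \<in> {1, - 1}" using s by auto
  ultimately show "u \<in> strip_points n \<and> (\<exists>s\<in>{1, - 1}. w = mv1 n s u \<or> w = mv2 n s u)"
    using mv_inverse_ex[OF n5 w s] by (intro conjI bexI[of _ "- s"])
next
  fix u s w assume "u \<in> strip_points n" "s \<in> {1, -1}" "w = mv1 n s u \<or> w = mv2 n s u"
  from E_orient[OF this] show "E w u \<noteq> E u w" by (rule not_sym)
next
  fix u w show "E (deck n w) (deck n u) = E w u" by (rule E_deck)
next
  fix u assume "u \<in> strip_points n" then show "M - f (deck n u) = M - f u" by (simp add: f_deck)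
next
  fix u w assume "E w u" then show "M - f w < M - f u" using f_less by simp
next
  fix u assume "u \<in> strip_points n" then show "0 \<le> M - f u \<and> M - f u \<le> M" using f_bound by simp
next
  fix i show "\<exists>K. \<forall>k. (E (chain n i k) (chain n i (k - 1)) \<and> E (chain n i k) (chain n i (k + 1))) = (n - 2 dvd k - K)"
    by (rule chain_source)
next
  fix i show "\<exists>K. \<forall>k. (E (chain n i (k - 1)) (chain n i k) \<and> E (chain n i (k + 1)) (chain n i k)) = (n - 2 dvd k - K)"
    by (rule chain_sink)
next
  fix u v w assume "E v u" "E w u"
  from cofork[OF this] show "(\<exists>c. (\<lambda>u w. E w u)\<^sup>*\<^sup>* v c \<and> (\<lambda>u w. E w u)\<^sup>*\<^sup>* w c) \<or>
     (\<exists>i k. u = chain n i k \<and> E (chain n i (k - 1)) (chain n i k) \<and> E (chain n i (k + 1)) (chain n i k))"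
    unfolding rtranclp_swap[of E] .
next
  fix v u w assume "E u v" "E u w"
  from fork[OF this] show "(\<exists>c. (\<lambda>u w. E w u)\<^sup>*\<^sup>* c v \<and> (\<lambda>u w. E w u)\<^sup>*\<^sup>* c w) \<or>
     (\<exists>i k. u = chain n i k \<and> E (chain n i k) (chain n i (k - 1)) \<and> E (chain n i k) (chain n i (k + 1)))"
    unfolding rtranclp_swap[of E] .
qed

section \<open>Lifts with a unique reachable sink\<close>

text \<open>Sinks are points of the strip here, so two lifts of the same vertex count as different
  sinks. For the reversed orientation this says that \<open>t\<close> is the only source from which
  \<open>u\<close> can be reached.\<close>

definition unique_sink :: "(int \<times> int \<Rightarrow> int \<times> int \<Rightarrow> bool) \<Rightarrow> int \<times> int \<Rightarrow> int \<times> int \<Rightarrow> bool" where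
  "unique_sink E u t \<longleftrightarrow> E\<^sup>*\<^sup>* u t \<and> (\<forall>w. \<not> E t w) \<and> (\<forall>s. E\<^sup>*\<^sup>* u s \<longrightarrow> (\<forall>w. \<not> E s w) \<longrightarrow> s = t)"

context strip
begin

abbreviation ch :: "int \<Rightarrow> int \<Rightarrow> int \<times> int" where "ch \<equiv> chain n"

definition csink :: "int \<Rightarrow> int \<Rightarrow> bool" where
  "csink i k \<longleftrightarrow> E (ch i (k - 1)) (ch i k) \<and> E (ch i (k + 1)) (ch i k)"

lemma E_strip: "E u w \<Longrightarrow> u \<in> strip_points n" "E u w \<Longrightarrow> w \<in> strip_points n"
proof -
  assume E: "E u w"
  then show u: "u \<in> strip_points n" using E_move by blast
  obtain s where "s = 1 \<or> s = -1" "w = mv1 n s u \<or> w = mv2 n s u"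
    using E_move[OF E] by auto
  then show "w \<in> strip_points n" using mv_strip[OF n5 u] by auto
qed

lemma E_step: assumes "E u w"
  shows "\<bar>fst w - fst u\<bar> \<le> 1" "\<bar>snd w - snd u\<bar> \<le> 1"
proof -
  obtain s where "s = 1 \<or> s = -1" "w = mv1 n s u \<or> w = mv2 n s u"
    using E_move[OF assms] by auto
  then show "\<bar>fst w - fst u\<bar> \<le> 1" "\<bar>snd w - snd u\<bar> \<le> 1"
    by (auto simp: mv1_def mv2_def)
qed

lemma reach_strip: "E\<^sup>*\<^sup>* u w \<Longrightarrow> u \<in> strip_points n \<Longrightarrow> w \<in> strip_points n"
  by (induction rule: rtranclp_induct) (auto dest: E_strip)

lemma f_reach: "E\<^sup>*\<^sup>* u w \<Longrightarrow> f w \<le> f u"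
  by (induction rule: rtranclp_induct) (auto dest: f_less)

lemma f_reach_less: "E\<^sup>*\<^sup>* u w \<Longrightarrow> u \<noteq> w \<Longrightarrow> f w < f u"
  by (metis converse_rtranclpE f_less f_reach order_le_less_trans)

lemma reach_deck: "E\<^sup>*\<^sup>* u w \<Longrightarrow> E\<^sup>*\<^sup>* (deck n u) (deck n w)"
  by (induction rule: rtranclp_induct) (auto intro: rtranclp.rtrancl_into_rtrancl simp: E_deck)

lemma deck_surj: "\<exists>v. w = deck n v"
  by (rule exI[of _ "(snd w - n, fst w)"]) (simp add: deck_def)

lemma deck_inj: "deck n u = deck n v \<longleftrightarrow> u = v"
  by (cases u; cases v) (auto simp: deck_def)

lemma reach_deck_iff: "E\<^sup>*\<^sup>* (deck n u) (deck n w) \<longleftrightarrow> E\<^sup>*\<^sup>* u w"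
proof
  have "E\<^sup>*\<^sup>* a b \<Longrightarrow> a = deck n u \<Longrightarrow> \<exists>w. b = deck n w \<and> E\<^sup>*\<^sup>* u w" for a b
  proof (induction rule: rtranclp_induct)
    case base then show ?case by blast
  next
    case (step b c)
    then obtain w where w: "b = deck n w" "E\<^sup>*\<^sup>* u w" by blast
    obtain z where "c = deck n z" using deck_surj by blast
    with w step(2) have "E w z" using E_deck by simp
    with w \<open>c = deck n z\<close> show ?case by (blast intro: rtranclp.rtrancl_into_rtrancl)
  qed
  note * = this
  assume "E\<^sup>*\<^sup>* (deck n u) (deck n w)"
  then obtain z where "deck n w = deck n z" "E\<^sup>*\<^sup>* u z" using *[OF _ refl] by blast
  then show "E\<^sup>*\<^sup>* u w" by (simp add: deck_inj)
qed (rule reach_deck)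

lemma ex_sink: assumes "u \<in> strip_points n" shows "\<exists>t. E\<^sup>*\<^sup>* u t \<and> (\<forall>w. \<not> E t w)"
  using assms
proof (induction "nat (f u)" arbitrary: u rule: less_induct)
  case less
  show ?case
  proof (cases "\<exists>w. E u w")
    case True
    then obtain w where w: "E u w" by blast
    have "nat (f w) < nat (f u)"
      using f_less[OF w] f_bound[OF E_strip(2)[OF w]] by simp
    then obtain t where "E\<^sup>*\<^sup>* w t" "\<forall>v. \<not> E t v" using less.hyps[OF _ E_strip(2)[OF w]] by blast
    then show ?thesis using w converse_rtranclp_into_rtranclp by metis
  next
    case False then show ?thesis by blast
  qed
qed

lemma unique_sink_mono:
  assumes "unique_sink E u t" "E\<^sup>*\<^sup>* u w" "u \<in> strip_points n" shows "unique_sink E w t"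
  using assms ex_sink[OF reach_strip[OF assms(2,3)]] unfolding unique_sink_def
  by (metis rtranclp_trans)

lemma unique_sink_deck: "unique_sink E (deck n u) (deck n t) \<longleftrightarrow> unique_sink E u t"
proof -
  have "(\<forall>w. \<not> E (deck n s) w) \<longleftrightarrow> (\<forall>w. \<not> E s w)" for s
    by (metis deck_surj E_deck)
  note sink = this
  have all: "(\<forall>s. P s) \<longleftrightarrow> (\<forall>s. P (deck n s))" for P by (metis deck_surj)
  show ?thesis unfolding unique_sink_def 
      all[of "\<lambda>s. E\<^sup>*\<^sup>* (deck n u) s \<longrightarrow> (\<forall>w. \<not> E s w) \<longrightarrow> s = deck n t"]
    by (simp only: reach_deck_iff deck_inj sink)
qed

section \<open>Motion along a single chain\<close>

lemma chain_orient: assumes "s = 1 \<or> s = -1" shows "E (ch i k) (ch i (k + s)) \<noteq> E (ch i (k + s)) (ch i k)"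
proof -
  have *: "E (ch i k) (ch i (k + 1)) \<noteq> E (ch i (k + 1)) (ch i k)" for k
    using E_orient[OF chain_in_strip[OF n5], of 1 "ch i (k + 1)" i k] chain_succ(1)[OF n5, of i k] by auto
  show ?thesis using assms *[of k] *[of "k - 1"] by auto
qed

lemma csink_sign: assumes "s = 1 \<or> s = -1"
  shows "csink i k \<longleftrightarrow> E (ch i (k + s)) (ch i k) \<and> E (ch i (k - s)) (ch i k)"
  using assms unfolding csink_def by auto

lemma csink_mod: obtains K where "\<And>k. csink i k \<longleftrightarrow> (n - 2) dvd (k - K)"
  using chain_sink[of i] unfolding csink_def by blast

text \<open>A reversal of direction on the way would itself be a sink, so the arcs keep pointing
  forward until the next sink; sinks recur with period \<open>n - 2\<close>.\<close>

lemma flow: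
  assumes s: "s = 1 \<or> s = -1" and out: "E (ch i k) (ch i (k + s))"
  obtains d :: nat where "1 \<le> d" "int d < n - 2" "csink i (k + s * int d)"
    "\<forall>t<d. E (ch i (k + s * int t)) (ch i (k + s * int t + s))"
proof -
  obtain K where K: "\<And>k. csink i k \<longleftrightarrow> (n - 2) dvd (k - K)" using csink_mod by blast
  \<comment> \<open>The residue yields some sink ahead within one period. Passing to the least such
    distance \<open>d\<close> below ensures that no sink is skipped.\<close>
  define d0 where "d0 = nat ((s * (K - k)) mod (n - 2))"
  have N: "n - 2 > 0" using n5 by simp
  have d0: "int d0 = (s * (K - k)) mod (n - 2)" unfolding d0_def using N by simp
  have "(n - 2) dvd (s * (K - k) - int d0)" unfolding d0 by (simp add: minus_mod_eq_div_mult)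
  then have "(n - 2) dvd - s * (s * (K - k) - int d0)" by (rule dvd_mult)
  moreover have "- s * (s * (K - k) - int d0) = k + s * int d0 - K" using s by (elim disjE) simp_all
  ultimately have "(n - 2) dvd (k + s * int d0 - K)" by (simp only:)
  then have sink: "csink i (k + s * int d0)" using K by blast
  have nk: "\<not> csink i k" using out chain_orient[OF s, of i k] csink_sign[OF s, of i k] by blast
  have "d0 \<noteq> 0" using sink nk by (cases d0) auto
  define d where "d = (LEAST d. 1 \<le> d \<and> csink i (k + s * int d))"
  have ex: "1 \<le> d0 \<and> csink i (k + s * int d0)" using sink \<open>d0 \<noteq> 0\<close> by simp
  have d: "1 \<le> d \<and> csink i (k + s * int d)" unfolding d_def by (rule LeastI[of _ d0], rule ex)
  have "d \<le> d0" unfolding d_def by (rule Least_le, rule ex)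
  then have "int d < n - 2" using d0 N by (smt (verit) pos_mod_bound zle_int)
  have min: "\<not> csink i (k + s * int t)" if "1 \<le> t" "t < d" for t
    using not_less_Least[of t "\<lambda>d. 1 \<le> d \<and> csink i (k + s * int d)"] that d_def by auto
  have "E (ch i (k + s * int t)) (ch i (k + s * int t + s))" if "t < d" for t
    using that
  proof (induction t)
    case 0 then show ?case using out by simp
  next
    case (Suc t)
    then have IH: "E (ch i (k + s * int t)) (ch i (k + s * int t + s))" by simp
    have e: "k + s * int (Suc t) = k + s * int t + s" by (simp add: algebra_simps)
    have "\<not> csink i (k + s * int (Suc t))" using min[of "Suc t"] Suc.prems by simp
    then have "\<not> csink i (k + s * int t + s)" unfolding e .
    then show ?case using IH unfolding e csink_sign[OF s]
      using chain_orient[OF s, of i "k + s * int t + s"] by auto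
  qed
  then show thesis using d \<open>int d < n - 2\<close> that by blast
qed

lemma flow_reach:
  assumes "\<forall>t<d. E (ch i (k + s * int t)) (ch i (k + s * int t + s))" "a \<le> b" "b \<le> (d::nat)"
  shows "E\<^sup>*\<^sup>* (ch i (k + s * int a)) (ch i (k + s * int b))"
  using assms(2,3)
proof (induction b rule: dec_induct)
  case base then show ?case by simp
next
  case (step b)
  then have "E\<^sup>*\<^sup>* (ch i (k + s * int a)) (ch i (k + s * int b))" by simp
  moreover have "E (ch i (k + s * int b)) (ch i (k + s * int b + s))" using assms(1) step by simp
  ultimately show ?case by (simp add: algebra_simps)
qed

lemma to_csink: obtains K where "csink i K" "E\<^sup>*\<^sup>* (ch i k) (ch i K)" "\<bar>K - k\<bar> < n - 2"
proof (cases "csink i k")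
  case True then show ?thesis using that[of k] n5 by simp
next
  case False
  then obtain s where s: "s = 1 \<or> s = (-1::int)" "E (ch i k) (ch i (k + s))"
    unfolding csink_def using chain_orient[of 1 i k] chain_orient[of "-1" i k] by force
  obtain d :: nat where d: "1 \<le> d" "int d < n - 2" "csink i (k + s * int d)"
    "\<forall>t<d. E (ch i (k + s * int t)) (ch i (k + s * int t + s))" by (rule flow[OF s])
  show ?thesis using that[OF d(3)] flow_reach[OF d(4), of 0 d] d s(1) by auto
qed

lemma chain_deck_pow: "ch i (k + int m * (n - 2)) = (deck n ^^ m) (ch i k)"
proof (induction m)
  case (Suc m)
  have e: "k + int (Suc m) * (n - 2) = (k + int m * (n - 2)) + (n - 2)" by (simp add: algebra_simps)
  show ?case unfolding e chain_deck[OF n5, of i "k + int m * (n - 2)"] using Suc by simp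
qed simp

lemma csink_f: assumes "csink i k" "csink i l" shows "f (ch i k) = f (ch i l)"
proof -
  have *: "f (ch i (k + int m * (n - 2))) = f (ch i k)" for k m
  proof (induction m)
    case (Suc m)
    have e: "k + int (Suc m) * (n - 2) = (k + int m * (n - 2)) + (n - 2)" by (simp add: algebra_simps)
    show ?case unfolding e chain_deck[OF n5, of i "k + int m * (n - 2)"] using Suc f_deck[OF chain_in_strip[OF n5]] by simp
  qed simp
  obtain K where K: "\<And>k. csink i k \<longleftrightarrow> (n - 2) dvd (k - K)" using csink_mod by blast
  have "(n - 2) dvd ((l - K) - (k - K))" using assms K dvd_diff by blast
  then have "(n - 2) dvd (l - k)" by simp
  then obtain c where "l - k = (n - 2) * c" by (elim dvdE)
  then have c: "l = k + c * (n - 2)" by (simp add: algebra_simps)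
  show ?thesis
  proof (cases "c \<ge> 0")
    case True then show ?thesis using *[of k "nat c"] c by simp
  next
    case False then show ?thesis using *[of l "nat (- c)"] c by simp
  qed
qed

text \<open>Two sinks of one chain differ by a power of \<open>deck\<close>. If both are reachable,
  \<open>t\<close> is the only sink reachable from either, so that power fixes \<open>t\<close>;
  since each \<open>deck\<close> raises the coordinate sum by \<open>n\<close>, the power is
  0.\<close>

lemma sink_pos_unique:
  assumes v: "v \<in> strip_points n" and U: "unique_sink E v t" and r: "E\<^sup>*\<^sup>* v (ch i k)" "E\<^sup>*\<^sup>* v (ch i l)"
    and c: "csink i k" "csink i l"
  shows "k = l"
proof -
  have *: "k = l" if le: "k \<le> l" and r: "E\<^sup>*\<^sup>* v (ch i k)" "E\<^sup>*\<^sup>* v (ch i l)"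
    and c: "csink i k" "csink i l" for k l
  proof -
    obtain K where K: "\<And>k. csink i k \<longleftrightarrow> (n - 2) dvd (k - K)" using csink_mod by blast
    have "(n - 2) dvd ((l - K) - (k - K))" using c K dvd_diff by blast
    then have "(n - 2) dvd (l - k)" by simp
    then obtain c where "l - k = (n - 2) * c" by (elim dvdE)
    moreover then have "c \<ge> 0" using le n5 by (smt (verit) mult_pos_neg)
    ultimately have l: "l = k + int (nat c) * (n - 2)" by (simp add: algebra_simps)
    define m where "m = nat c"
    have lm: "ch i l = (deck n ^^ m) (ch i k)" unfolding l m_def by (rule chain_deck_pow)
    have U1: "unique_sink E (ch i k) t" using unique_sink_mono[OF U r(1) v] .
    have "unique_sink E ((deck n ^^ m) (ch i k)) ((deck n ^^ m) t)"
      by (induction m) (simp_all add: U1 unique_sink_deck)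
    moreover have "unique_sink E (ch i l) t" using unique_sink_mono[OF U r(2) v] .
    ultimately have t: "(deck n ^^ m) t = t" unfolding lm unique_sink_def by blast
    have "fst ((deck n ^^ m) t) + snd ((deck n ^^ m) t) = fst t + snd t + int m * n"
      by (induction m) (auto simp: deck_def algebra_simps)
    then have "m = 0" using t n5 by auto
    then show ?thesis using l m_def by simp
  qed
  show ?thesis using *[of k l] *[of l k] r c by linarith
qed

section \<open>Paths that cross rows and columns\<close>

lemma ivt_snd:
  assumes "E\<^sup>*\<^sup>* u w" "s = 1 \<or> s = (-1::int)" "s * snd w \<le> s * j" "s * j \<le> s * snd u"
  obtains m where "E\<^sup>*\<^sup>* u m" "E\<^sup>*\<^sup>* m w" "snd m = j"
proof -
  have "\<exists>m. E\<^sup>*\<^sup>* u m \<and> E\<^sup>*\<^sup>* m w \<and> snd m = j" using assms(1,4)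
  proof (induction rule: converse_rtranclp_induct)
    case base then have "snd w = j" using assms(2,3) by auto
    then show ?case by blast
  next
    case (step u z)
    show ?case
    proof (cases "s * j \<le> s * snd z")
      case True
      then show ?thesis using step by (meson converse_rtranclp_into_rtranclp)
    next
      case False
      then have "snd u = j" using E_step(2)[OF step(1)] step(4) assms(2) by auto
      moreover have "E\<^sup>*\<^sup>* u w" using step(1,2) by (rule converse_rtranclp_into_rtranclp)
      ultimately show ?thesis by blast
    qed
  qed
  then show thesis using that by blast
qed

lemma ivt_fst:
  assumes "E\<^sup>*\<^sup>* u w" "s = 1 \<or> s = (-1::int)" "s * fst w \<le> s * j" "s * j \<le> s * fst u"
  obtains m where "E\<^sup>*\<^sup>* u m" "E\<^sup>*\<^sup>* m w" "fst m = j"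
proof -
  have "E\<^sup>*\<^sup>* (deck n u) (deck n w)" using assms(1) by (rule reach_deck)
  moreover have "s * snd (deck n w) \<le> s * (j + n)" "s * (j + n) \<le> s * snd (deck n u)"
    using assms by (auto simp: deck_def)
  ultimately obtain m where m: "E\<^sup>*\<^sup>* (deck n u) m" "E\<^sup>*\<^sup>* m (deck n w)" "snd m = j + n"
    using ivt_snd assms(2) by metis
  obtain v where "m = deck n v" using deck_surj by blast
  have "E\<^sup>*\<^sup>* u v" "E\<^sup>*\<^sup>* v w" using m \<open>m = deck n v\<close> by (simp_all add: reach_deck_iff)
  moreover have "fst v = j" using m(3) \<open>m = deck n v\<close> by (simp add: deck_def)
  ultimately show thesis by (rule that)
qed

lemma row_pos: "(x, y) \<in> strip_points n \<Longrightarrow> ch y (x - y + 1) = (x, y)"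
  using chain_row(1)[OF n5, of x y 1] by simp

lemma col_pos: "(x, y) \<in> strip_points n \<Longrightarrow> ch x (y - x - 1) = (x, y)"
  using chain_col(1)[OF n5, of x y 1] by simp

text \<open>The way from \<open>b\<close> to \<open>t\<close> meets row \<open>y\<close>, and from
  there the chain leads down to one of its sinks, all of which have the same height.\<close>

lemma pass_snd:
  assumes "unique_sink E v t" "v \<in> strip_points n" "E\<^sup>*\<^sup>* v b" "s = 1 \<or> s = (-1::int)"
    "s * snd b > s * y" "s * y \<ge> s * snd t" "csink y K"
  shows "f (ch y K) < f b"
proof -
  have "E\<^sup>*\<^sup>* b t" using unique_sink_mono[OF assms(1,3,2)] unfolding unique_sink_def by blast
  then obtain m where m: "E\<^sup>*\<^sup>* b m" "snd m = y" using ivt_snd[of b t s y] assms(4-6) by (metis less_le)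
  have "b \<noteq> m" using m assms(5) by auto
  then have fm: "f m < f b" using f_reach_less m by blast
  have "m \<in> strip_points n" using reach_strip[OF m(1) reach_strip[OF assms(3,2)]] .
  then have "ch y (fst m - y + 1) = m" using row_pos[of "fst m" y] m(2) by (cases m) auto
  moreover obtain L where L: "csink y L" "E\<^sup>*\<^sup>* (ch y (fst m - y + 1)) (ch y L)" using to_csink by blast
  ultimately have "f (ch y L) \<le> f m" using f_reach by metis
  then show ?thesis using csink_f[OF L(1) assms(7)] fm by simp
qed

lemma pass_fst:
  assumes "unique_sink E v t" "v \<in> strip_points n" "E\<^sup>*\<^sup>* v b" "s = 1 \<or> s = (-1::int)"
    "s * fst b > s * x" "s * x \<ge> s * fst t" "csink x K"
  shows "f (ch x K) < f b"
proof -
  have "E\<^sup>*\<^sup>* b t" using unique_sink_mono[OF assms(1,3,2)] unfolding unique_sink_def by blast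
  then obtain m where m: "E\<^sup>*\<^sup>* b m" "fst m = x" using ivt_fst[of b t s x] assms(4-6) by (metis less_le)
  have "b \<noteq> m" using m assms(5) by auto
  then have fm: "f m < f b" using f_reach_less m by blast
  have "m \<in> strip_points n" using reach_strip[OF m(1) reach_strip[OF assms(3,2)]] .
  then have "ch x (snd m - x - 1) = m" using col_pos[of x "snd m"] m(2) by (cases m) auto
  moreover obtain L where L: "csink x L" "E\<^sup>*\<^sup>* (ch x (snd m - x - 1)) (ch x L)" using to_csink by blast
  ultimately have "f (ch x L) \<le> f m" using f_reach by metis
  then show ?thesis using csink_f[OF L(1) assms(7)] fm by simp
qed

text \<open>Both chains through \<open>u\<close> would flow to sinks lying further from
  \<open>t\<close>. To get from the sink of the row to \<open>t\<close> one has to cross the column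
  of \<open>u\<close>, so the column chain has the lower sink; exchanging the roles, the row chain
  has the lower sink as well.\<close>

lemma not_both_away:
  assumes U: "unique_sink E u t" and u: "u \<in> strip_points n"
    and s: "s1 = 1 \<or> s1 = (-1::int)" "s2 = 1 \<or> s2 = (-1::int)"
    and away: "s1 * fst u \<ge> s1 * fst t" "s2 * snd u \<ge> s2 * snd t"
    and E: "E u (mv1 n s1 u)" "E u (mv2 n s2 u)"
  shows False
proof -
  obtain x y where xy: "u = (x, y)" by (cases u)
  have r: "ch y (x - y + 1) = u" "ch y (x - y + 1 + s1) = mv1 n s1 u"
    using chain_row[OF n5 _ s(1), of x y] u xy by auto
  have c: "ch x (y - x - 1) = u" "ch x (y - x - 1 + s2) = mv2 n s2 u"
    using chain_col[OF n5 _ s(2), of x y] u xy by auto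
  obtain d :: nat where d: "1 \<le> d" "csink y (x - y + 1 + s1 * int d)"
    "\<forall>t<d. E (ch y (x - y + 1 + s1 * int t)) (ch y (x - y + 1 + s1 * int t + s1))"
    using flow[OF s(1), of y "x - y + 1"] E(1) unfolding r by metis
  obtain e :: nat where e: "1 \<le> e" "csink x (y - x - 1 + s2 * int e)"
    "\<forall>t<e. E (ch x (y - x - 1 + s2 * int t)) (ch x (y - x - 1 + s2 * int t + s2))"
    using flow[OF s(2), of x "y - x - 1"] E(2) unfolding c by metis
  have rd: "E\<^sup>*\<^sup>* u (ch y (x - y + 1 + s1 * int d))" using flow_reach[OF d(3), of 0 d] r(1) by simp
  have re: "E\<^sup>*\<^sup>* u (ch x (y - x - 1 + s2 * int e))" using flow_reach[OF e(3), of 0 e] c(1) by simp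
  have "s1 * fst (mv1 n s1 u) \<le> s1 * fst (ch y (x - y + 1 + s1 * int d))"
    unfolding r(2)[symmetric] using s(1) d(1) by (intro chain_mono_sign[OF n5]) auto
  moreover have "s1 * fst (mv1 n s1 u) = s1 * x + 1" using s(1) xy by (auto simp: mv1_def)
  ultimately have "f (ch x (y - x - 1 + s2 * int e)) < f (ch y (x - y + 1 + s1 * int d))"
    using pass_fst[OF U u rd s(1) _ _ e(2)] away xy by auto
  moreover have "s2 * snd (mv2 n s2 u) \<le> s2 * snd (ch x (y - x - 1 + s2 * int e))"
    unfolding c(2)[symmetric] using s(2) e(1) by (intro chain_mono_sign[OF n5]) auto
  moreover have "s2 * snd (mv2 n s2 u) = s2 * y + 1" using s(2) xy by (auto simp: mv2_def)
  ultimately show False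
    using pass_snd[OF U u re s(2) _ _ d(2)] away xy by auto
qed

end

context strip
begin

text \<open>Whichever way the chain flows from \<open>k\<close>, it ends in a reachable sink, and
  \<open>K\<close> is the only one on this chain.\<close>

lemma flow_toward:
  assumes v: "v \<in> strip_points n" and U: "unique_sink E v t" and r: "E\<^sup>*\<^sup>* v (ch i k)" "E\<^sup>*\<^sup>* v (ch i K)"
    and c: "csink i K" and s: "s = 1 \<or> s = (-1::int)" and le: "s * k < s * K"
  shows "E (ch i k) (ch i (k + s))" "\<not> E (ch i k) (ch i (k - s))"
    "s * k \<le> s * l \<Longrightarrow> s * l \<le> s * K \<Longrightarrow> E\<^sup>*\<^sup>* (ch i k) (ch i l)"
proof -
  have *: "\<exists>d::nat. 1 \<le> d \<and> K = k + s' * int d \<and> (\<forall>t<d. E (ch i (k + s' * int t)) (ch i (k + s' * int t + s')))"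
    if s': "s' = 1 \<or> s' = -1" "E (ch i k) (ch i (k + s'))" for s'
  proof -
    obtain d :: nat where d: "1 \<le> d" "csink i (k + s' * int d)"
      "\<forall>t<d. E (ch i (k + s' * int t)) (ch i (k + s' * int t + s'))" by (rule flow[OF s'])
    have "E\<^sup>*\<^sup>* v (ch i (k + s' * int d))" using flow_reach[OF d(3), of 0 d] r(1) by simp
    then have "K = k + s' * int d" using sink_pos_unique[OF v U r(2) _ c d(2)] by blast
    then show ?thesis using d by blast
  qed
  have ns: "- s = 1 \<or> - s = -1" using s by auto
  show no: "\<not> E (ch i k) (ch i (k - s))"
  proof
    assume "E (ch i k) (ch i (k - s))"
    then obtain d :: nat where "1 \<le> d" "K = k + - s * int d" using *[OF ns] by auto
    then show False using le s by auto
  qed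
  have "\<not> csink i k" using sink_pos_unique[OF v U r _ c] le by auto
  then show out: "E (ch i k) (ch i (k + s))"
    using no csink_sign[OF s, of i k] chain_orient[OF s, of i k] chain_orient[OF ns, of i k] by auto
  obtain d :: nat where d: "1 \<le> d" "K = k + s * int d" 
     "\<forall>t<d. E (ch i (k + s * int t)) (ch i (k + s * int t + s))" using *[OF s out] by blast
  assume l: "s * k \<le> s * l" "s * l \<le> s * K"
  define a where "a = nat (s * (l - k))"
  have "l = k + s * int a" using l s unfolding a_def by auto
  moreover have "a \<le> d" using l s d(2) unfolding a_def by auto
  ultimately show "E\<^sup>*\<^sup>* (ch i k) (ch i l)" using flow_reach[OF d(3), of 0 a] by simp
qed

lemma dir_of:
  assumes v: "v \<in> strip_points n" and U: "unique_sink E v t" and r: "E\<^sup>*\<^sup>* v (ch i k)" "E\<^sup>*\<^sup>* v (ch i K)"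
    and c: "csink i K" and s: "s = 1 \<or> s = (-1::int)" and e: "E (ch i k) (ch i (k + s))"
  shows "s * k < s * K"
proof (rule ccontr)
  assume "\<not> s * k < s * K"
  then consider "K = k" | "- s * k < - s * K" using s by fastforce
  then show False
  proof cases
    case 1
    then show ?thesis using c csink_sign[OF s, of i k] chain_orient[OF s, of i k] e by auto
  next
    case 2
    have ns: "- s = 1 \<or> - s = -1" using s by auto
    show ?thesis using flow_toward(2)[OF v U r c ns 2] e by simp
  qed
qed

lemma reachable_csink:
  assumes "E\<^sup>*\<^sup>* v (ch i k)"
  obtains K where "csink i K" "E\<^sup>*\<^sup>* v (ch i K)" "\<bar>K - k\<bar> < n - 2"
  using to_csink[of i k] assms by (metis rtranclp_trans)

lemma crossing:
  assumes "E\<^sup>*\<^sup>* w m" "s = 1 \<or> s = (-1::int)" "s * snd w < s * j" "s * j \<le> s * snd m"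
  obtains a b where "E\<^sup>*\<^sup>* w a" "E a b" "snd a = j - s" "snd b = j"
proof -
  have "\<exists>a b. E\<^sup>*\<^sup>* w a \<and> E a b \<and> snd a = j - s \<and> snd b = j" using assms(1,4)
  proof (induction rule: rtranclp_induct)
    case base then show ?case using assms(3) by simp
  next
    case (step m z)
    show ?case
    proof (cases "s * j \<le> s * snd m")
      case True then show ?thesis using step by blast
    next
      case False
      then have "snd m = j - s" "snd z = j" using E_step(2)[OF step(2)] step(4) assms(2) by auto
      then show ?thesis using step by blast
    qed
  qed
  then show thesis using that by blast
qed

lemma row_pos': "z \<in> strip_points n \<Longrightarrow> ch (snd z) (fst z - snd z + 1) = z"
  using row_pos[of "fst z" "snd z"] by simp

lemma row_mv: "z \<in> strip_points n \<Longrightarrow> s = 1 \<or> s = -1 \<Longrightarrow> ch (snd z) (fst z - snd z + 1 + s) = mv1 n s z"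
  using chain_row(2)[OF n5, of "fst z" "snd z" s] by simp

text \<open>A sink of chain \<open>y\<close> beyond row \<open>y\<close> would be lower than itself
  by \<open>pass_snd\<close>.\<close>

lemma row_sink_level:
  assumes "unique_sink E v t" "v \<in> strip_points n" "E\<^sup>*\<^sup>* v (ch y K)" "csink y K" "s = 1 \<or> s = (-1::int)"
    "s * snd t \<le> s * y"
  shows "s * snd (ch y K) \<le> s * y"
  using pass_snd[OF assms(1-3,5) _ assms(6,4)] by fastforce

text \<open>Planarity. A path coming back to row \<open>snd v\<close> contains an arc
  \<open>e\<close> to \<open>e'\<close> between the two adjacent rows, further in direction
  \<open>s1\<close> than \<open>v\<close>. Then the sink \<open>K2\<close> of the lower row lies
  strictly between \<open>w\<close> and \<open>e\<close>, and the stretch from \<open>w\<close> to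
  \<open>K2\<close> is a barrier: it can be left only towards the row of \<open>t\<close>, and the
  induction on the distance to that row forbids coming back from there.\<close>

lemma no_return:
  assumes s: "s1 = 1 \<or> s1 = (-1::int)" "s2 = 1 \<or> s2 = (-1::int)"
  shows "unique_sink E v t \<Longrightarrow> v \<in> strip_points n \<Longrightarrow> s1 * fst v \<ge> s1 * fst t \<Longrightarrow> s2 * snd v > s2 * snd t \<Longrightarrow>
    E v (mv1 n s1 v) \<Longrightarrow> E v (mv2 n (- s2) v) \<Longrightarrow> E\<^sup>*\<^sup>* (mv2 n (- s2) v) m \<Longrightarrow> snd m \<noteq> snd v"
proof (induction "nat (s2 * (snd v - snd t))" arbitrary: v m rule: less_induct)
  case less
  note U = less.prems(1) and v = less.prems(2) and away1 = less.prems(3) and away2 = less.prems(4)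
    and E1 = less.prems(5) and E2 = less.prems(6) and rm = less.prems(7)
  define w where "w = mv2 n (- s2) v"
  define i where "i = fst v"
  define j where "j = snd v"
  define y where "y = j - s2"
  define pos where "pos z = fst z - snd z + 1" for z :: "int \<times> int"
  have ns1: "- s1 = 1 \<or> - s1 = -1" and ns2: "- s2 = 1 \<or> - s2 = -1" using s by auto
  have vw: "E v w" using E2 w_def by simp
  have w: "w \<in> strip_points n" using E_strip(2)[OF vw] .
  have sw: "snd w = y" using s(2) unfolding w_def y_def j_def by (auto simp: mv2_def)
  have rw: "E\<^sup>*\<^sup>* v w" using vw by blast
  have vij: "v = (i, j)" by (simp add: i_def j_def)
  have ij: "i + 2 \<le> j" "j \<le> i + n - 2" using v vij by (auto simp: strip_points_def)
  have qy: "s2 * snd t \<le> s2 * y" using away2 s(2) unfolding y_def j_def by auto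
  obtain K1 where K1: "csink j K1" "E\<^sup>*\<^sup>* v (ch j K1)"
    using reachable_csink[of v j "pos v"] row_pos'[OF v] by (metis j_def pos_def rtranclp.rtrancl_refl)
  have cv: "ch j (pos v) = v" using row_pos'[OF v] by (simp add: j_def pos_def)
  have cv1: "ch j (pos v + s1) = mv1 n s1 v" using row_mv[OF v s(1)] by (simp add: j_def pos_def)
  have dv: "s1 * pos v < s1 * K1"
    using dir_of[OF v U _ K1(2) K1(1) s(1), of "pos v"] cv cv1 E1 by simp
  \<comment> \<open>At the boundary of the strip the column move is diagonal. Then \<open>w\<close>
    is one column further, but column \<open>i\<close> has no point in row \<open>y\<close>, so
    nothing lies in between.\<close>
  have diag: "fst w = i \<and> mv2 n s2 w = v \<or>
      fst w = i + s1 \<and> (i, y) \<notin> strip_points n \<and> mv1 n (- s1) w = v"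
  proof (cases "fst w = i")
    case True
    then have "mv2 n s2 w = v" using s(2) ij vij sw n5 
      by (cases w) (auto simp: mv2_def y_def w_def split: if_splits)
    then show ?thesis using True by blast
  next
    case False
    then have wi: "fst w = i - s2" and bd: "s2 = 1 \<and> j = i + 2 \<or> s2 = -1 \<and> j = i + n - 2"
      using s(2) ij vij unfolding w_def by (auto simp: mv2_def split: if_splits)
    \<comment> \<open>With equal signs the move \<open>mv1\<close> of \<open>v\<close> would be
      diagonal too and carry the sink of chain \<open>j\<close> beyond row \<open>j\<close>.\<close>
    have "s1 = - s2"
    proof (rule ccontr)
      assume "s1 \<noteq> - s2"
      then have ss: "s1 = s2" using s by auto
      have "s2 * snd (mv1 n s1 v) = s2 * j + 1" using bd ss vij n5 by (auto simp: mv1_def)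
      moreover have "s2 * snd (ch j (pos v + s1)) \<le> s2 * snd (ch j K1)"
        using chain_mono_sign(2)[OF n5 s(2), of "pos v + s1" K1 j] dv s(1) ss by auto
      moreover have "s2 * snd (ch j K1) \<le> s2 * j"
        using row_sink_level[OF U v K1(2,1) s(2)] away2 unfolding j_def by simp
      ultimately show False unfolding cv1 by linarith
    qed
    moreover have "(i, y) \<notin> strip_points n" using bd by (auto simp: strip_points_def y_def)
    moreover have "mv1 n (- s1) w = v" using bd wi sw vij n5 \<open>s1 = - s2\<close>
      by (cases w) (auto simp: mv1_def y_def)
    ultimately show ?thesis using wi by auto
  qed
  have wi: "s1 * fst w \<ge> s1 * i" using diag s(1) by auto
  show ?case
  proof
    assume "snd m = snd v"
    then have "s2 * j \<le> s2 * snd m" by (simp add: j_def)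
    moreover have "s2 * snd w < s2 * j" using sw s(2) unfolding y_def by auto
    ultimately obtain e e' where e: "E\<^sup>*\<^sup>* w e" "E e e'" "snd e = y" "snd e' = j"
      using crossing[OF _ s(2), of w m j] rm unfolding w_def y_def by metis
    have re: "E\<^sup>*\<^sup>* v e" using rw e(1) by simp
    have re': "E\<^sup>*\<^sup>* v e'" using re e(2) by simp
    have eL: "e \<in> strip_points n" and eL': "e' \<in> strip_points n" using E_strip[OF e(2)] by auto
    have fe: "f e' < f v" "f e' < f e" "f e \<le> f w" "f w < f v" 
      using f_less[OF e(2)] f_reach[OF e(1)] f_less[OF vw] by auto
    have ce': "ch j (pos e') = e'" using row_pos'[OF eL'] e(4) by (simp add: pos_def)
    have ce: "ch y (pos e) = e" using row_pos'[OF eL] e(3) by (simp add: pos_def)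
    have cw: "ch y (pos w) = w" using row_pos'[OF w] sw by (simp add: pos_def)
    \<comment> \<open>Otherwise the chain flows from \<open>e'\<close> to \<open>v\<close>, although
      \<open>v\<close> is higher.\<close>
    have right: "s1 * pos v < s1 * pos e'"
    proof (rule ccontr)
      assume "\<not> ?thesis"
      then have "E\<^sup>*\<^sup>* (ch j (pos e')) (ch j (pos v))"
        using flow_toward(3)[OF v U _ K1(2) K1(1) s(1), of "pos e'" "pos v"] re' ce' dv by simp
      then show False using f_reach fe(1) unfolding ce' cv by fastforce
    qed
    then have fe': "s1 * fst e' \<ge> s1 * i + 1" using e(4) vij s(1) by (auto simp: pos_def)
    then have fe1: "s1 * fst e \<ge> s1 * i" using E_step(1)[OF e(2)] s(1) by auto
    obtain K2 where K2: "csink y K2" "E\<^sup>*\<^sup>* v (ch y K2)"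
      using reachable_csink[of v y "pos w"] cw rw by metis
    have lev: "s2 * snd (ch y K2) \<le> s2 * y" using row_sink_level[OF U v K2(2,1) s(2) qy] .
    \<comment> \<open>\<open>mv1\<close> changes the row only at the boundary, and there it would
      carry the sink of chain \<open>y\<close> beyond row \<open>y\<close>.\<close>
    have not1: "e' \<noteq> mv1 n \<sigma> e" if \<sigma>: "\<sigma> = 1 \<or> \<sigma> = -1" for \<sigma>
    proof
      assume a: "e' = mv1 n \<sigma> e"
      have "\<sigma> = s2" using a e(3,4) \<sigma> s(2) unfolding y_def by (auto simp: mv1_def split: if_splits)
      have c: "ch y (pos e + \<sigma>) = e'" using row_mv[OF eL \<sigma>] e(3) a by (simp add: pos_def)
      have "\<sigma> * pos e < \<sigma> * K2"
        using dir_of[OF v U _ K2(2) K2(1) \<sigma>, of "pos e"] ce c e(2) re by simp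
      then have "\<sigma> * snd (ch y (pos e + \<sigma>)) \<le> \<sigma> * snd (ch y K2)"
        using \<sigma> by (intro chain_mono_sign[OF n5 \<sigma>]) auto
      then have "s2 * j \<le> s2 * snd (ch y K2)" unfolding c e(4) unfolding \<open>\<sigma> = s2\<close> .
      moreover have "s2 * y < s2 * j" using s(2) unfolding y_def by auto
      ultimately show False using lev by linarith
    qed
    obtain \<sigma> where "\<sigma> = 1 \<or> \<sigma> = -1" "e' = mv1 n \<sigma> e \<or> e' = mv2 n \<sigma> e" using E_move[OF e(2)] by auto
    then have "e' = mv2 n \<sigma> e" and \<sigma>: "\<sigma> = 1 \<or> \<sigma> = -1" using not1 by auto
    moreover then have "\<sigma> = s2" using e(3,4) s(2) unfolding y_def by (auto simp: mv2_def split: if_splits)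
    ultimately have e'2: "e' = mv2 n s2 e" by simp
    have nE: "\<not> E e (mv1 n s1 e)"
      using not_both_away[OF unique_sink_mono[OF U re v] eL s _ _ _ ] e(2) e'2 fe1 away1 e(3) qy
      by (auto simp: i_def)
    have "K2 \<noteq> pos e"
    proof
      assume "K2 = pos e"
      then have "f e < f e'"
        using pass_snd[OF U v re' s(2) _ qy K2(1)] ce e(4) s(2) unfolding y_def by auto
      then show False using fe by simp
    qed
    moreover have "\<not> s1 * pos e < s1 * K2"
      using flow_toward(1)[OF v U _ K2(2) K2(1) s(1), of "pos e"] re nE row_mv[OF eL s(1)] e(3) ce
      by (auto simp: pos_def)
    ultimately have K2e: "s1 * K2 < s1 * pos e" using s(1) by auto
    have down: "E\<^sup>*\<^sup>* (ch y (pos e)) (ch y l)" if "s1 * K2 \<le> s1 * l" "s1 * l \<le> s1 * pos e" for l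
      using flow_toward(3)[OF v U _ K2(2) K2(1) ns1, of "pos e" l] re ce K2e that by simp
    have ew: "e \<noteq> w"
    proof
      assume ew: "e = w"
      from diag show False
      proof
        assume "fst w = i \<and> mv2 n s2 w = v"
        then show False using e'2 ew fe' vij by simp
      next
        assume a: "fst w = i + s1 \<and> (i, y) \<notin> strip_points n \<and> mv1 n (- s1) w = v"
        have "E w (mv1 n (- s1) w)"
          using flow_toward(1)[OF v U _ K2(2) K2(1) ns1, of "pos w"] rw cw K2e ew row_mv[OF w ns1] sw
          by (simp add: pos_def)
        then show False using a f_less[of w v] fe(4) by simp
      qed
    qed
    have le: "s1 * fst w \<le> s1 * fst e"
    proof (rule ccontr)
      assume a: "\<not> ?thesis"
      then have "fst e = i" "fst w \<noteq> i" using diag fe1 s(1) by auto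
      then have "e = (i, y)" using e(3) by (cases e) simp
      then show False using diag eL \<open>fst w \<noteq> i\<close> by auto
    qed
    have wK2: "s1 * pos w < s1 * K2"
    proof (rule ccontr)
      assume "\<not> ?thesis"
      moreover have "s1 * pos w \<le> s1 * pos e" using le sw e(3) s(1) by (auto simp: pos_def)
      ultimately have "E\<^sup>*\<^sup>* e w" using down[of "pos w"] ce cw by simp
      then show False using f_reach_less[OF e(1)] ew f_reach by fastforce
    qed
    \<comment> \<open>If \<open>y\<close> were the row of \<open>t\<close>, then \<open>t\<close>
      would be the chain sink \<open>K2\<close> and lie strictly beyond \<open>w\<close> in
      direction \<open>s1\<close>, contrary to \<open>away1\<close>.\<close>
    have ty: "s2 * snd t < s2 * y"
    proof (rule ccontr)
      assume "\<not> ?thesis"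
      then have ty: "snd t = y" using qy s(2) by auto
      have rt: "E\<^sup>*\<^sup>* v t" and tno: "\<And>w. \<not> E t w" using U unfolding unique_sink_def by auto
      have tL: "t \<in> strip_points n" using reach_strip[OF rt v] .
      have ct: "ch y (pos t) = t" using row_pos'[OF tL] ty by (simp add: pos_def)
      have "csink y (pos t)" unfolding csink_def ct using tno chain_orient[of 1 y "pos t"] chain_orient[of "-1" y "pos t"] ct
        by auto
      then have "K2 = pos t" using sink_pos_unique[OF v U K2(2) _ K2(1)] rt ct by simp
      then have "s1 * fst w < s1 * fst t" using wK2 sw ty s(1) by (auto simp: pos_def)
      then show False using wi away1 unfolding i_def by linarith
    qed
    \<comment> \<open>Induction from \<open>K2\<close> back to \<open>w\<close>. A point of the
      barrier can only move to the next point of the barrier or towards the row of \<open>t\<close>;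
      the first case is the inner hypothesis, the second the outer one.\<close>
    have stuck: "\<not> E\<^sup>*\<^sup>* (ch y (K2 - s1 * int d)) e" if "int d \<le> s1 * (K2 - pos w)" for d
      using that
    proof (induction d)
      case 0
      have "E\<^sup>*\<^sup>* e (ch y K2)" using down[of K2] ce K2e by simp
      moreover have "e \<noteq> ch y K2" using chain_inj[OF n5, of y "pos e" K2] ce K2e by auto
      ultimately show ?case using f_reach_less f_reach by fastforce
    next
      case (Suc d)
      define \<kappa> where "\<kappa> = K2 - s1 * int (Suc d)"
      define u where "u = ch y \<kappa>"
      have k1: "s1 * pos w \<le> s1 * \<kappa>" and k2: "s1 * \<kappa> < s1 * K2" 
        using Suc.prems s(1) unfolding \<kappa>_def by (auto simp: algebra_simps)
      have wu: "E\<^sup>*\<^sup>* w u"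
        using flow_toward(3)[OF v U _ K2(2) K2(1) s(1), of "pos w" \<kappa>] rw cw k1 k2 wK2 unfolding u_def by simp
      have ru: "E\<^sup>*\<^sup>* v u" using rw wu by simp
      have uL: "u \<in> strip_points n" unfolding u_def by (rule chain_in_strip[OF n5])
      have su: "snd u = y"
        using chain_mono_sign(2)[OF n5 s(1) k1, of y] chain_mono_sign(2)[OF n5 s(1), of \<kappa> "pos e" y] k2 K2e
          cw ce sw e(3) s(1) unfolding u_def by auto
      have fu: "s1 * fst u \<ge> s1 * fst w"
        using chain_mono_sign(1)[OF n5 s(1) k1, of y] cw unfolding u_def by simp
      have pu: "\<kappa> = pos u" 
        using chain_inj[OF n5, of y \<kappa> "pos u"] row_pos'[OF uL] su unfolding u_def pos_def by simp
      have m1: "ch y (\<kappa> + s1) = mv1 n s1 u" "ch y (\<kappa> - s1) = mv1 n (- s1) u"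
        using row_mv[OF uL s(1)] row_mv[OF uL ns1] su pu by (simp_all add: pos_def)
      have Eu: "E u (mv1 n s1 u)" "\<not> E u (mv1 n (- s1) u)"
        using flow_toward(1,2)[OF v U _ K2(2) K2(1) s(1) k2] ru m1 unfolding u_def by auto
      have Uu: "unique_sink E u t" using unique_sink_mono[OF U ru v] .
      have fut: "s1 * fst t \<le> s1 * fst u" using fu wi away1 unfolding i_def by linarith
      have n2: "\<not> E u (mv2 n s2 u)"
        using not_both_away[OF Uu uL s fut _ Eu(1)] su qy by auto
      show ?case
      proof
        assume "E\<^sup>*\<^sup>* (ch y (K2 - s1 * int (Suc d))) e"
        then have "E\<^sup>*\<^sup>* u e" unfolding u_def \<kappa>_def .
        moreover have "u \<noteq> e" using pu k2 K2e by auto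
        ultimately obtain z where z: "E u z" "E\<^sup>*\<^sup>* z e" by (metis converse_rtranclpE)
        obtain \<tau> where \<tau>: "\<tau> = 1 \<or> \<tau> = -1" "z = mv1 n \<tau> u \<or> z = mv2 n \<tau> u" using E_move[OF z(1)] by auto
        consider "z = mv1 n s1 u" | "z = mv1 n (- s1) u" | "z = mv2 n s2 u" | "z = mv2 n (- s2) u"
          using \<tau> s by auto
        then show False
        proof cases
          case 1
          then have "z = ch y (K2 - s1 * int d)" unfolding m1(1)[symmetric] \<kappa>_def by (simp add: algebra_simps)
          then show ?thesis using Suc z(2) by simp
        next
          case 4
          have "nat (s2 * (snd u - snd t)) < nat (s2 * (snd v - snd t))"
            using ty su s(2) unfolding y_def j_def by auto
          from less.hyps[OF this Uu uL fut _ Eu(1) _ z(2)[unfolded 4]] show ?thesis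
            using ty su z(1) 4 e(3) by simp
        qed (use z Eu n2 in auto)
      qed
    qed
    have "K2 - s1 * int (nat (s1 * (K2 - pos w))) = pos w" using wK2 s(1) by (auto simp: algebra_simps)
    then show False using stuck[of "nat (s1 * (K2 - pos w))"] e(1) cw wK2 s(1) by (auto simp: algebra_simps)
  qed
qed

end

section \<open>Which lifts of sinks and sources are reachable\<close>

context strip
begin

definition csource :: "int \<Rightarrow> int \<Rightarrow> bool" where
  "csource i k \<longleftrightarrow> E (ch i k) (ch i (k - 1)) \<and> E (ch i k) (ch i (k + 1))"

text \<open>A path starting at distance \<open>n\<close> or more from the row of \<open>t\<close>
  meets a row whose chain contains \<open>t\<close> about two periods away. But that chain flows
  from the path to a sink within one period, and only one of its sinks is reachable.\<close>

lemma snd_bound: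
  assumes U: "unique_sink E v t" and v: "v \<in> strip_points n"
  shows "\<bar>snd v - snd t\<bar> < n"
proof (rule ccontr)
  assume "\<not> ?thesis"
  then obtain s where s: "s = 1 \<or> s = (-1::int)" "s * (snd v - snd t) \<ge> n"
    by (metis abs_if linorder_not_less minus_mult_minus mult_1 mult_minus1)
  define j where "j = snd t + s * n"
  have rt: "E\<^sup>*\<^sup>* v t" and tno: "\<And>w. \<not> E t w" using U unfolding unique_sink_def by auto
  have tL: "t \<in> strip_points n" using reach_strip[OF rt v] .
  have "s * snd t \<le> s * j" "s * j \<le> s * snd v" using s n5 unfolding j_def by (auto simp: algebra_simps)
  then obtain m where m: "E\<^sup>*\<^sup>* v m" "snd m = j" using ivt_snd[OF rt s(1)] by blast
  have mL: "m \<in> strip_points n" using reach_strip[OF m(1) v] .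
  have cm: "ch j (fst m - j + 1) = m" using row_pos'[OF mL] m(2) by simp
  obtain K where K: "csink j K" "E\<^sup>*\<^sup>* v (ch j K)" "\<bar>K - (fst m - j + 1)\<bar> < n - 2"
    using reachable_csink[of v j "fst m - j + 1"] cm m(1) by metis
  define k where "k = fst t - snd t + 1 - s * (2 * (n - 2))"
  have ct: "ch j k = t" unfolding j_def k_def chain_shift[OF n5] using row_pos'[OF tL] by simp
  have "csink j k" unfolding csink_def ct
    using tno chain_orient[of 1 j k] chain_orient[of "-1" j k] ct by auto
  then have "K = k" using sink_pos_unique[OF v U K(2) _ K(1)] rt ct by simp
  then show False using K(3) mL tL m(2) s(1) unfolding k_def strip_points_def by (cases m; cases t) auto
qed

lemma fst_bound:
  assumes U: "unique_sink E v t" and v: "v \<in> strip_points n"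
  shows "\<bar>fst v - fst t\<bar> < n"
proof -
  have "unique_sink E (deck n v) (deck n t)" using U by (simp add: unique_sink_deck)
  from snd_bound[OF this] v show ?thesis by (simp add: deck_def deck_strip[unfolded deck_def])
qed

text \<open>Descend as long as some successor still reaches several sinks. At the end all successors
  lead to a single sink each, two of them to different ones; these two have no common descendant, so
  \<open>fork\<close> exhibits the source of a chain.\<close>

lemma not_unique_source:
  assumes "u \<in> strip_points n" "\<And>t. \<not> unique_sink E u t"
  shows "\<exists>i k. E\<^sup>*\<^sup>* u (ch i k) \<and> csource i k"
  using assms
proof (induction "nat (f u)" arbitrary: u rule: less_induct)
  case less
  show ?case
  proof (cases "\<exists>w. E u w \<and> (\<forall>t. \<not> unique_sink E w t)")
    case True
    then obtain w where w: "E u w" "\<And>t. \<not> unique_sink E w t" by blast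
    have "nat (f w) < nat (f u)"
      using f_less[OF w(1)] f_bound[OF E_strip(2)[OF w(1)]] by simp
    then obtain i k where "E\<^sup>*\<^sup>* w (ch i k) \<and> csource i k"
      using less.hyps[OF _ E_strip(2)[OF w(1)] w(2)] by blast
    then show ?thesis using w(1) by (meson converse_rtranclp_into_rtranclp)
  next
    case False
    obtain t where t: "E\<^sup>*\<^sup>* u t" "\<forall>w. \<not> E t w" using ex_sink[OF less.prems(1)] by blast
    then obtain s where s: "E\<^sup>*\<^sup>* u s" "\<forall>w. \<not> E s w" "s \<noteq> t"
      using less.prems(2)[of t] unfolding unique_sink_def by blast
    have "u \<noteq> t" using t(2) s by (metis converse_rtranclpE)
    then obtain a where a: "E u a" "E\<^sup>*\<^sup>* a t" using t(1) by (metis converse_rtranclpE)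
    have "u \<noteq> s" using s(2) t s by (metis converse_rtranclpE)
    then obtain b where b: "E u b" "E\<^sup>*\<^sup>* b s" using s(1) by (metis converse_rtranclpE)
    obtain a' where a': "unique_sink E a a'" using False a(1) by blast
    obtain b' where b': "unique_sink E b b'" using False b(1) by blast
    have eq: "a' = t" "b' = s" 
      using a' a(2) t(2) b' b(2) s(2) unfolding unique_sink_def by blast+
    have "\<not> (E\<^sup>*\<^sup>* a c \<and> E\<^sup>*\<^sup>* b c)" for c
    proof
      assume c: "E\<^sup>*\<^sup>* a c \<and> E\<^sup>*\<^sup>* b c"
      then have "unique_sink E c a'" "unique_sink E c b'"
        using unique_sink_mono a' b' E_strip a(1) b(1) by blast+
      then show False using eq s(3) unfolding unique_sink_def by blast
    qed
    then obtain i k where "u = ch i k" "E (ch i k) (ch i (k - 1)) \<and> E (ch i k) (ch i (k + 1))"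
      using fork[OF a(1) b(1)] by blast
    then show ?thesis unfolding csource_def by blast
  qed
qed

lemma csource_f_ge:
  assumes "csource j l" shows "f (ch j k) \<le> f (ch j l)"
proof -
  interpret rev: strip n "\<lambda>u w. E w u" "\<lambda>u. M - f u" M by (rule reverse)
  have eq: "rev.csink i k \<longleftrightarrow> csource i k" for i k
    unfolding rev.csink_def csource_def by simp
  obtain K where K: "rev.csink j K" "(\<lambda>u w. E w u)\<^sup>*\<^sup>* (ch j k) (ch j K)" using rev.to_csink by blast
  then have "E\<^sup>*\<^sup>* (ch j K) (ch j k)" by (simp only: rtranclp_swap[of E])
  then have "f (ch j k) \<le> f (ch j K)" by (rule f_reach)
  moreover have "M - f (ch j K) = M - f (ch j l)" using rev.csink_f[OF K(1)] assms eq by blast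
  ultimately show ?thesis by simp
qed

lemma csink_f_le:
  assumes "csink j l" shows "f (ch j l) \<le> f (ch j k)"
proof -
  obtain K where K: "csink j K" "E\<^sup>*\<^sup>* (ch j k) (ch j K)" using to_csink by blast
  then show ?thesis using f_reach csink_f[OF K(1) assms] by fastforce
qed

text \<open>Any two polygons intersect, because the faces of a neighborly dual do.\<close>

lemma chains_meet: "\<exists>k l. ch i k = ch j l"
proof (cases "n dvd (j - i)")
  case True
  then obtain c where "j - i = n * c" by (elim dvdE)
  then have j: "j = i + c * n" by (simp add: algebra_simps)
  have "ch j 0 = ch i (0 + c * (2 * (n - 2)))" unfolding j by (rule chain_shift[OF n5])
  then show ?thesis by metis
next
  case False
  define j' where "j' = i + (j - i) mod n"
  have "(j - i) mod n \<noteq> 0" using False by (simp add: dvd_eq_mod_eq_0)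
  then have j': "i < j'" "j' < i + n" using n5 pos_mod_bound[of n "j - i"] pos_mod_sign[of n "j - i"]
    unfolding j'_def by linarith+
  define z where "z = ch i (j' - i - 1)"
  have sz: "snd z = j'" unfolding z_def using j' n5 chain_neg[OF n5, of "j' - i - 1" i] by auto
  have "z \<in> strip_points n" unfolding z_def by (rule chain_in_strip[OF n5])
  then have cz: "ch j' (fst z - j' + 1) = z" using row_pos'[of z] sz by simp
  define c where "c = (j - i) div n"
  have j: "j = j' + c * n" unfolding j'_def c_def by (simp add: algebra_simps)
  have "ch j (fst z - j' + 1 - c * (2 * (n - 2))) = z" unfolding j chain_shift[OF n5] using cz by simp
  then show ?thesis unfolding z_def by metis
qed

text \<open>At a common point of the two chains the height is at least that of the sink and at most
  that of the source, which squeezes the heights along the path.\<close>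

lemma sink_source_clash:
  assumes "csink i k" "E\<^sup>*\<^sup>* (ch i k) u" "E\<^sup>*\<^sup>* u (ch j l)" "csource j l"
  shows "f u = f (ch i k)" "f u = f (ch j l)"
proof -
  obtain a b where "ch i a = ch j b" using chains_meet by blast
  then have "f (ch i k) \<le> f (ch j l)"
    using csink_f_le[OF assms(1), of a] csource_f_ge[OF assms(4), of b] by simp
  then show "f u = f (ch i k)" "f u = f (ch j l)" using f_reach[OF assms(2)] f_reach[OF assms(3)] by auto
qed

lemma not_unique_source_rev:
  assumes "u \<in> strip_points n" "\<And>t. \<not> unique_sink (\<lambda>u w. E w u) u t"
  shows "\<exists>i k. E\<^sup>*\<^sup>* (ch i k) u \<and> csink i k"
proof -
  interpret rev: strip n "\<lambda>u w. E w u" "\<lambda>u. M - f u" M by (rule reverse)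
  have "rev.csource i k \<longleftrightarrow> csink i k" for i k
    unfolding rev.csource_def csink_def by simp
  then show ?thesis using rev.not_unique_source[OF assms] by (simp only: rtranclp_swap[of E])
qed

text \<open>By the reversed form of \<open>not_unique_source\<close>, \<open>u\<close> is reachable
  from a chain sink. If \<open>w\<close> reached several sinks, it would reach a chain source, and
  \<open>sink_source_clash\<close> would make the arc from \<open>u\<close> to \<open>w\<close>
  level.\<close>

lemma neither_step:
  assumes u: "u \<in> strip_points n" and no: "\<And>t. \<not> unique_sink (\<lambda>u w. E w u) u t" and uw: "E u w"
  shows "\<exists>t. unique_sink E w t"
proof (rule ccontr)
  assume "\<not> ?thesis"
  then obtain j l where jl: "E\<^sup>*\<^sup>* w (ch j l)" "csource j l"
    using not_unique_source[OF E_strip(2)[OF uw]] by blast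
  obtain i k where ik: "E\<^sup>*\<^sup>* (ch i k) u" "csink i k" using not_unique_source_rev[OF u no] by blast
  have "E\<^sup>*\<^sup>* u (ch j l)" using uw jl(1) by (rule converse_rtranclp_into_rtranclp)
  then have "f u = f (ch j l)" using sink_source_clash(2)[OF ik(2,1) _ jl(2)] by blast
  then show False using f_reach[OF jl(1)] f_less[OF uw] by simp
qed

end

section \<open>The potential\<close>

text \<open>Lines are counted instead of points, so leaving one row or column for good is worth
  exactly one unit. In the phase with a unique sink both sets are finite, so \<open>card\<close> is
  meaningful.\<close>

definition shadow :: "(int \<times> int \<Rightarrow> int \<times> int \<Rightarrow> bool) \<Rightarrow> int \<times> int \<Rightarrow> int" where
  "shadow E u = int (card (fst ` {m. E\<^sup>*\<^sup>* u m}) + card (snd ` {m. E\<^sup>*\<^sup>* u m}))"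

definition taxi :: "int \<times> int \<Rightarrow> int \<times> int \<Rightarrow> int" where
  "taxi t u = \<bar>fst u - fst t\<bar> + \<bar>snd u - snd t\<bar>"

text \<open>The lifts where the algorithm makes a fair choice between one horizontal and one
  vertical unit step.\<close>

definition straight :: "int \<Rightarrow> (int \<times> int \<Rightarrow> int \<times> int \<Rightarrow> bool) \<Rightarrow> int \<times> int \<Rightarrow> int \<Rightarrow> int \<Rightarrow> bool" where
  "straight n E u s1 s2 \<longleftrightarrow> fst u + 3 \<le> snd u \<and> snd u \<le> fst u + n - 3 \<and>
     (s1 = 1 \<or> s1 = -1) \<and> (s2 = 1 \<or> s2 = -1) \<and>
     E u (mv1 n s1 u) \<and> \<not> E u (mv1 n (- s1) u) \<and> E u (mv2 n s2 u) \<and> \<not> E u (mv2 n (- s2) u)"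

text \<open>The undecided case: one move decreases \<open>taxi\<close> by 1, the other increases it
  by 1.\<close>

definition mixed :: "int \<Rightarrow> (int \<times> int \<Rightarrow> int \<times> int \<Rightarrow> bool) \<Rightarrow> int \<times> int \<Rightarrow> int \<times> int \<Rightarrow> bool" where
  "mixed n E t u \<longleftrightarrow> (\<exists>s1 s2. straight n E u s1 s2 \<and>
     (s1 * fst u < s1 * fst t) \<noteq> (s2 * snd u < s2 * snd t))"

text \<open>Here \<open>t\<close> is a source, so distance and shadow grow and carry negative signs.
  At a mixed vertex the total drop of 2 must come either from a gained line or from the lost bonus,
  so both weigh 2; the weight 3 of \<open>taxi\<close> leaves a drop of 1 even when a step away from
  \<open>t\<close> acquires the bonus.\<close>

definition source_potential :: "int \<Rightarrow> (int \<times> int \<Rightarrow> int \<times> int \<Rightarrow> bool) \<Rightarrow> int \<times> int \<Rightarrow> int \<times> int \<Rightarrow> int" where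
  "source_potential n E t u = - 3 * taxi t u - 2 * shadow (\<lambda>u w. E w u) u + (if mixed n E t u then 2 else 0)"

context strip
begin

lemma straight_strip: "straight n E u s1 s2 \<Longrightarrow> u \<in> strip_points n"
  unfolding straight_def by (cases u) (auto simp: strip_points_def)

lemma straight_moves: assumes "straight n E u s1 s2"
  shows "mv1 n s1 u = (fst u + s1, snd u)" "mv2 n s2 u = (fst u, snd u + s2)"
  using assms unfolding straight_def mv1_def mv2_def by auto

lemma straight_out: assumes "straight n E u s1 s2"
  shows "E u w \<longleftrightarrow> w = mv1 n s1 u \<or> w = mv2 n s2 u"
proof
  assume "E u w"
  moreover obtain s where "s = 1 \<or> s = -1" "w = mv1 n s u \<or> w = mv2 n s u"
    using E_move[OF \<open>E u w\<close>] by auto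
  ultimately show "w = mv1 n s1 u \<or> w = mv2 n s2 u" using assms unfolding straight_def by auto
qed (use assms in \<open>auto simp: straight_def\<close>)

lemma straight_in: assumes "straight n E u s1 s2"
  shows "E (mv1 n (- s1) u) u" "E (mv2 n (- s2) u) u"
proof -
  have "- s1 \<in> {1, -1}" "- s2 \<in> {1, -1}" using assms unfolding straight_def by auto
  then show "E (mv1 n (- s1) u) u" "E (mv2 n (- s2) u) u"
    using E_orient[OF straight_strip[OF assms]] assms unfolding straight_def by blast+
qed

lemma shadow_sets:
  assumes U: "unique_sink E u t" and u: "u \<in> strip_points n"
  shows "fst ` {m. E\<^sup>*\<^sup>* u m} \<subseteq> {fst t - n..<fst t + n}" "snd ` {m. E\<^sup>*\<^sup>* u m} \<subseteq> {snd t - n..<snd t + n}"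
proof -
  have "\<bar>fst m - fst t\<bar> < n \<and> \<bar>snd m - snd t\<bar> < n" if "E\<^sup>*\<^sup>* u m" for m
    using fst_bound snd_bound unique_sink_mono[OF U that u] reach_strip[OF that u] by blast
  then show "fst ` {m. E\<^sup>*\<^sup>* u m} \<subseteq> {fst t - n..<fst t + n}" "snd ` {m. E\<^sup>*\<^sup>* u m} \<subseteq> {snd t - n..<snd t + n}"
    by fastforce+
qed

lemma shadow_bound:
  assumes U: "unique_sink E u t" and u: "u \<in> strip_points n"
  shows "0 \<le> shadow E u" "shadow E u \<le> 4 * n"
proof -
  show "0 \<le> shadow E u" by (simp add: shadow_def)
  have "card (fst ` {m. E\<^sup>*\<^sup>* u m}) \<le> card {fst t - n..<fst t + n}"
    by (rule card_mono[OF _ shadow_sets(1)[OF U u]]) simp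
  moreover have "card (snd ` {m. E\<^sup>*\<^sup>* u m}) \<le> card {snd t - n..<snd t + n}"
    by (rule card_mono[OF _ shadow_sets(2)[OF U u]]) simp
  ultimately show "shadow E u \<le> 4 * n" using n5 unfolding shadow_def by simp
qed

lemma shadow_mono:
  assumes U: "unique_sink E u t" and u: "u \<in> strip_points n" and w: "E u w"
  shows "shadow E w \<le> shadow E u"
    "(\<And>m. E\<^sup>*\<^sup>* w m \<Longrightarrow> snd m \<noteq> snd u) \<Longrightarrow> shadow E w + 1 \<le> shadow E u"
    "(\<And>m. E\<^sup>*\<^sup>* w m \<Longrightarrow> fst m \<noteq> fst u) \<Longrightarrow> shadow E w + 1 \<le> shadow E u"
proof -
  have fin: "finite (fst ` {m. E\<^sup>*\<^sup>* u m})" "finite (snd ` {m. E\<^sup>*\<^sup>* u m})"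
    using shadow_sets[OF U u] finite_subset by blast+
  have sub: "{m. E\<^sup>*\<^sup>* w m} \<subseteq> {m. E\<^sup>*\<^sup>* u m}" using w by (auto intro: converse_rtranclp_into_rtranclp)
  have le: "card (fst ` {m. E\<^sup>*\<^sup>* w m}) \<le> card (fst ` {m. E\<^sup>*\<^sup>* u m})"
    "card (snd ` {m. E\<^sup>*\<^sup>* w m}) \<le> card (snd ` {m. E\<^sup>*\<^sup>* u m})"
    using fin sub by (auto intro!: card_mono)
  then show "shadow E w \<le> shadow E u" unfolding shadow_def by simp
  {
    assume "\<And>m. E\<^sup>*\<^sup>* w m \<Longrightarrow> snd m \<noteq> snd u"
    then have "snd u \<notin> snd ` {m. E\<^sup>*\<^sup>* w m}" by (metis imageE mem_Collect_eq)
    moreover have "snd u \<in> snd ` {m. E\<^sup>*\<^sup>* u m}" by auto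
    ultimately have "snd ` {m. E\<^sup>*\<^sup>* w m} \<subset> snd ` {m. E\<^sup>*\<^sup>* u m}" using sub by blast
    then have "card (snd ` {m. E\<^sup>*\<^sup>* w m}) < card (snd ` {m. E\<^sup>*\<^sup>* u m})"
      using fin by (intro psubset_card_mono)
    then show "shadow E w + 1 \<le> shadow E u" using le unfolding shadow_def by simp
  }
  {
    assume "\<And>m. E\<^sup>*\<^sup>* w m \<Longrightarrow> fst m \<noteq> fst u"
    then have "fst u \<notin> fst ` {m. E\<^sup>*\<^sup>* w m}" by (metis imageE mem_Collect_eq)
    moreover have "fst u \<in> fst ` {m. E\<^sup>*\<^sup>* u m}" by auto
    ultimately have "fst ` {m. E\<^sup>*\<^sup>* w m} \<subset> fst ` {m. E\<^sup>*\<^sup>* u m}" using sub by blast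
    then have "card (fst ` {m. E\<^sup>*\<^sup>* w m}) < card (fst ` {m. E\<^sup>*\<^sup>* u m})"
      using fin by (intro psubset_card_mono)
    then show "shadow E w + 1 \<le> shadow E u" using le unfolding shadow_def by simp
  }
qed

lemma no_return_fst:
  assumes s: "s1 = 1 \<or> s1 = (-1::int)" "s2 = 1 \<or> s2 = (-1::int)" and U: "unique_sink E v t" and v: "v \<in> strip_points n"
    and away: "s1 * snd v \<ge> s1 * snd t" "s2 * fst v > s2 * fst t"
    and E: "E v (mv2 n s1 v)" "E v (mv1 n (- s2) v)" and m: "E\<^sup>*\<^sup>* (mv1 n (- s2) v) m"
  shows "fst m \<noteq> fst v"
proof -
  have ns: "- s2 = 1 \<or> - s2 = -1" using s by auto
  have "E\<^sup>*\<^sup>* (mv2 n (- s2) (deck n v)) (deck n m)" unfolding mv_deck(2)[OF ns] using m by (rule reach_deck)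
  moreover have "s1 * fst (deck n v) \<ge> s1 * fst (deck n t)" "s2 * snd (deck n v) > s2 * snd (deck n t)"
    using away s by (auto simp: deck_def)
  moreover have "E (deck n v) (mv1 n s1 (deck n v))" "E (deck n v) (mv2 n (- s2) (deck n v))"
    unfolding mv_deck(1)[OF s(1)] mv_deck(2)[OF ns] E_deck using E by auto
  ultimately have "snd (deck n m) \<noteq> snd (deck n v)"
    using no_return[OF s, of "deck n v" "deck n t" "deck n m"] U v by (simp add: unique_sink_deck deck_strip)
  then show ?thesis by (simp add: deck_def)
qed

lemma taxi_step:
  assumes "s = 1 \<or> s = (-1::int)"
  shows "taxi t (fst u + s, snd u) = taxi t u + (if s * fst u < s * fst t then -1 else 1)"
    "taxi t (fst u, snd u + s) = taxi t u + (if s * snd u < s * snd t then -1 else 1)"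
  using assms unfolding taxi_def by auto

lemma taxi_bound: assumes "unique_sink E u t" "u \<in> strip_points n"
  shows "0 \<le> taxi t u" "taxi t u \<le> 2 * n"
  using fst_bound[OF assms] snd_bound[OF assms] unfolding taxi_def by auto

lemma taxi_edge: "E u w \<Longrightarrow> \<bar>taxi t w - taxi t u\<bar> \<le> 2"
  using E_step[of u w] unfolding taxi_def by auto

text \<open>Two moves towards \<open>t\<close> lower the distance by 2 in total. If only one does,
  the distances cancel, but this move abandons its row or column by \<open>no_return\<close>, and
  the shadow has weight 2. That neither does is excluded by \<open>not_both_away\<close>.\<close>

lemma sink_phase_straight:
  assumes U: "unique_sink E u t" and st: "straight n E u s1 s2"
  shows "taxi t (mv1 n s1 u) + 2 * shadow E (mv1 n s1 u) + (taxi t (mv2 n s2 u) + 2 * shadow E (mv2 n s2 u))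
     \<le> 2 * (taxi t u + 2 * shadow E u) - 2"
proof -
  note u = straight_strip[OF st]
  have s: "s1 = 1 \<or> s1 = -1" "s2 = 1 \<or> s2 = -1" and E: "E u (mv1 n s1 u)" "E u (mv2 n s2 u)"
    using st unfolding straight_def by auto
  have ns: "- s1 = 1 \<or> - s1 = -1" "- s2 = 1 \<or> - s2 = -1" using s by auto
  note mono = shadow_mono[OF U u E(1)] shadow_mono[OF U u E(2)]
  note taxi = taxi_step(1)[OF s(1), of t u] taxi_step(2)[OF s(2), of t u]
  consider "s1 * fst u \<ge> s1 * fst t" "s2 * snd u \<ge> s2 * snd t"
    | "s1 * fst u \<ge> s1 * fst t" "s2 * snd u < s2 * snd t"
    | "s1 * fst u < s1 * fst t" "s2 * snd u \<ge> s2 * snd t"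
    | "s1 * fst u < s1 * fst t" "s2 * snd u < s2 * snd t" by linarith
  then show ?thesis
  proof cases
    case 1 then show ?thesis using not_both_away[OF U u s _ _ E] by blast
  next
    case 2
    have "snd m \<noteq> snd u" if "E\<^sup>*\<^sup>* (mv2 n s2 u) m" for m
      using no_return[OF s(1) ns(2) U u 2(1) _ E(1)] 2(2) E(2) that by simp
    from mono(5)[OF this] mono(1) show ?thesis using 2 taxi unfolding straight_moves[OF st] by simp
  next
    case 3
    have "fst m \<noteq> fst u" if "E\<^sup>*\<^sup>* (mv1 n s1 u) m" for m
      using no_return_fst[OF s(2) ns(1) U u 3(2) _ E(2)] 3(1) E(1) that by simp
    from mono(3)[OF this] mono(4) show ?thesis using 3 taxi unfolding straight_moves[OF st] by simp
  next
    case 4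
    then show ?thesis using taxi mono(1,4) unfolding straight_moves[OF st] by simp
  qed
qed

text \<open>8 = 3 * 2 + 2, for a change of the distance by at most 2 and a newly acquired bonus; the
  reversed shadow only grows.\<close>

lemma source_phase_edge:
  assumes U: "unique_sink (\<lambda>u w. E w u) w t" and uw: "E u w"
  shows "source_potential n E t w \<le> source_potential n E t u + 8"
proof -
  interpret rev: strip n "\<lambda>u w. E w u" "\<lambda>u. M - f u" M by (rule reverse)
  have "shadow (\<lambda>u w. E w u) u \<le> shadow (\<lambda>u w. E w u) w"
    using rev.shadow_mono(1)[OF U E_strip(2)[OF uw] uw] .
  then show ?thesis using taxi_edge[OF uw, of t] unfolding source_potential_def by auto
qed

text \<open>Reversal makes \<open>u\<close> a successor of \<open>w1\<close> and \<open>w2\<close>,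
  so \<open>no_return\<close> concerns the line of the later point, and it applies only if that
  point is mixed. If it is, a line is gained; if not, the bonus of \<open>u\<close> disappears. The
  value -12 stands for leaving the phase and is the gap built into \<open>C1\<close>.\<close>

lemma source_phase_straight:
  assumes U: "unique_sink (\<lambda>u w. E w u) u t" and st: "straight n E u s1 s2"
  defines "g \<equiv> \<lambda>w. if unique_sink (\<lambda>u w. E w u) w t then source_potential n E t w - source_potential n E t u else -12"
  shows "g (mv1 n s1 u) + g (mv2 n s2 u) \<le> -2"
proof -
  interpret rev: strip n "\<lambda>u w. E w u" "\<lambda>u. M - f u" M by (rule reverse)
  let ?R = "\<lambda>u w. E w u"
  note u = straight_strip[OF st]
  have s: "s1 = 1 \<or> s1 = -1" "s2 = 1 \<or> s2 = -1" and E: "E u (mv1 n s1 u)" "E u (mv2 n s2 u)"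
    using st unfolding straight_def by auto
  have ns: "- s1 = 1 \<or> - s1 = -1" "- s2 = 1 \<or> - s2 = -1" using s by auto
  define w1 where "w1 = mv1 n s1 u"
  define w2 where "w2 = mv2 n s2 u"
  have w: "w1 = (fst u + s1, snd u)" "w2 = (fst u, snd u + s2)"
    using straight_moves[OF st] by (auto simp: w1_def w2_def)
  have E1: "E u w1" and E2: "E u w2" using E by (auto simp: w1_def w2_def)
  note wL = E_strip(2)[OF E1] E_strip(2)[OF E2]
  have su: "fst u + 3 \<le> snd u" "snd u \<le> fst u + n - 3" using st unfolding straight_def by auto
  have sh1: "shadow ?R u \<le> shadow ?R w1" if "unique_sink ?R w1 t"
    using rev.shadow_mono(1)[OF that wL(1)] E1 .
  have sh2: "shadow ?R u \<le> shadow ?R w2" if "unique_sink ?R w2 t"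
    using rev.shadow_mono(1)[OF that wL(2)] E2 .
  \<comment> \<open>The arc from \<open>u\<close> enters \<open>w2\<close>, so the vertical arc out
    of \<open>w2\<close> continues away from \<open>t\<close>. Being mixed, \<open>w2\<close> sends
    its horizontal arc towards \<open>t\<close>; the horizontal arc entering it comes from the far
    side, and its reversal is the away move required by \<open>no_return\<close>.\<close>
  have inc2: "shadow ?R u + 1 \<le> shadow ?R w2" 
    if U2: "unique_sink ?R w2 t" and away: "s2 * snd u \<ge> s2 * snd t" and mx: "mixed n E t w2"
  proof -
    obtain r1 r2 where r: "straight n E w2 r1 r2" "(r1 * fst w2 < r1 * fst t) \<noteq> (r2 * snd w2 < r2 * snd t)"
      using mx unfolding mixed_def by blast
    have rs: "r1 = 1 \<or> r1 = -1" "r2 = 1 \<or> r2 = -1" 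
      and sw: "fst w2 + 3 \<le> snd w2" "snd w2 \<le> fst w2 + n - 3" using r unfolding straight_def by auto
    have inv: "mv2 n (- s2) w2 = u" using s(2) su sw w(2) by (cases u) (auto simp: mv2_def)
    have "\<not> E w2 u" using f_less E2 by (meson not_less_iff_gr_or_eq)
    then have "r2 = s2" using r(1) inv s(2) rs(2) unfolding straight_def by auto
    then have "r1 * fst w2 < r1 * fst t" using r(2) away w(2) s(2) by auto
    moreover have "s2 * snd w2 > s2 * snd t" using away w(2) s(2) by auto
    moreover have "E (mv1 n (- r1) w2) w2" using straight_in[OF r(1)] by simp
    moreover have "- r1 = 1 \<or> - r1 = -1" using rs by auto
    ultimately have "snd m \<noteq> snd w2" if "?R\<^sup>*\<^sup>* u m" for m
      using rev.no_return[of "- r1" s2 w2 t m] s(2) U2 wL(2) E2 that inv by simp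
    then show ?thesis using rev.shadow_mono(2)[OF U2 wL(2)] E2 by blast
  qed
  have inc1: "shadow ?R u + 1 \<le> shadow ?R w1" 
    if U1: "unique_sink ?R w1 t" and away: "s1 * fst u \<ge> s1 * fst t" and mx: "mixed n E t w1"
  proof -
    obtain r1 r2 where r: "straight n E w1 r1 r2" "(r1 * fst w1 < r1 * fst t) \<noteq> (r2 * snd w1 < r2 * snd t)"
      using mx unfolding mixed_def by blast
    have rs: "r1 = 1 \<or> r1 = -1" "r2 = 1 \<or> r2 = -1" 
      and sw: "fst w1 + 3 \<le> snd w1" "snd w1 \<le> fst w1 + n - 3" using r unfolding straight_def by auto
    have inv: "mv1 n (- s1) w1 = u" using s(1) su sw w(1) by (cases u) (auto simp: mv1_def)
    have "\<not> E w1 u" using f_less E1 by (meson not_less_iff_gr_or_eq)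
    then have "r1 = s1" using r(1) inv s(1) rs(1) unfolding straight_def by auto
    then have "r2 * snd w1 < r2 * snd t" using r(2) away w(1) s(1) by auto
    moreover have "s1 * fst w1 > s1 * fst t" using away w(1) s(1) by auto
    moreover have "E (mv2 n (- r2) w1) w1" using straight_in[OF r(1)] by simp
    moreover have "- r2 = 1 \<or> - r2 = -1" using rs by auto
    ultimately have "fst m \<noteq> fst w1" if "?R\<^sup>*\<^sup>* u m" for m
      using rev.no_return_fst[of "- r2" s1 w1 t m] s(1) U1 wL(1) E1 that inv by simp
    then show ?thesis using rev.shadow_mono(3)[OF U1 wL(1)] E1 by blast
  qed
  have t1: "taxi t w1 = taxi t u + (if s1 * fst u < s1 * fst t then -1 else 1)"
    and t2: "taxi t w2 = taxi t u + (if s2 * snd u < s2 * snd t then -1 else 1)"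
    using taxi_step(1)[OF s(1)] taxi_step(2)[OF s(2)] w by auto
  \<comment> \<open>Reversing two moves towards the source gives two moves away from it, as excluded
    by \<open>not_both_away\<close>.\<close>
  have nb: "\<not> (s1 * fst u < s1 * fst t \<and> s2 * snd u < s2 * snd t)"
    using rev.not_both_away[OF U u ns] straight_in[OF st] by auto
  have mu: "mixed n E t u" if "(s1 * fst u < s1 * fst t) \<noteq> (s2 * snd u < s2 * snd t)"
    using st that unfolding mixed_def by blast
  consider "s1 * fst u < s1 * fst t" "\<not> s2 * snd u < s2 * snd t"
    | "\<not> s1 * fst u < s1 * fst t" "s2 * snd u < s2 * snd t"
    | "\<not> s1 * fst u < s1 * fst t" "\<not> s2 * snd u < s2 * snd t" using nb by blast
  then have "g w1 + g w2 \<le> -2"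
  proof cases
    case 1
    \<comment> \<open>For \<open>w1\<close>: 3 from the distance, any bonus being already present at
      \<open>u\<close>. For \<open>w2\<close>: -3 from the distance and -2 from a gained row or a
      lost bonus.\<close>
    have "g w1 \<le> 3" using sh1 t1 1 mu unfolding g_def source_potential_def by auto
    moreover have "g w2 \<le> -5" using sh2 inc2 t2 1 mu unfolding g_def source_potential_def by auto
    ultimately show ?thesis by simp
  next
    case 2
    have "g w2 \<le> 3" using sh2 t2 2 mu unfolding g_def source_potential_def by auto
    moreover have "g w1 \<le> -5" using sh1 inc1 t1 2 mu unfolding g_def source_potential_def by auto
    ultimately show ?thesis by simp
  next
    case 3
    have "g w2 \<le> -1" using sh2 t2 3 unfolding g_def source_potential_def by auto
    moreover have "g w1 \<le> -1" using sh1 t1 3 unfolding g_def source_potential_def by auto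
    ultimately show ?thesis by simp
  qed
  then show ?thesis unfolding w1_def w2_def .
qed

lemma source_potential_bound:
  assumes "unique_sink (\<lambda>u w. E w u) u t" "u \<in> strip_points n"
  shows "- 14 * n \<le> source_potential n E t u" "source_potential n E t u \<le> 2"
proof -
  interpret rev: strip n "\<lambda>u w. E w u" "\<lambda>u. M - f u" M by (rule reverse)
  show "- 14 * n \<le> source_potential n E t u" "source_potential n E t u \<le> 2"
    using rev.taxi_bound[OF assms] rev.shadow_bound[OF assms] unfolding source_potential_def by auto
qed

text \<open>\<open>\<beta>\<close> will count the bad vertices still ahead. Its weight 3 in the sink
  phase beats the change 2 of \<open>taxi\<close> on an arc leaving a bad vertex, its weight 9 in
  the source phase beats the change 8 of \<open>source_potential\<close>.\<close>

lemma potential: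
  fixes \<beta> :: "int \<times> int \<Rightarrow> int"
  assumes b: "\<And>u. u \<in> strip_points n \<Longrightarrow> 0 \<le> \<beta> u \<and> \<beta> u \<le> B"
    and mono: "\<And>u w. E u w \<Longrightarrow> \<beta> w \<le> \<beta> u"
    and drop: "\<And>u w. E u w \<Longrightarrow> (\<And>s1 s2. \<not> straight n E u s1 s2) \<Longrightarrow> \<beta> w \<le> \<beta> u - 1"
  obtains \<Phi> :: "int \<times> int \<Rightarrow> int" where
    "\<And>u. u \<in> strip_points n \<Longrightarrow> 0 \<le> \<Phi> u \<and> \<Phi> u \<le> 24 * n + 12 * B + 34"
    "\<And>u s1 s2. straight n E u s1 s2 \<Longrightarrow> \<Phi> (mv1 n s1 u) + \<Phi> (mv2 n s2 u) \<le> 2 * \<Phi> u - 2"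
    "\<And>u w. E u w \<Longrightarrow> (\<And>s1 s2. \<not> straight n E u s1 s2) \<Longrightarrow> \<Phi> w \<le> \<Phi> u - 1"
proof -
  interpret rev: strip n "\<lambda>u w. E w u" "\<lambda>u. M - f u" M by (rule reverse)
  let ?R = "\<lambda>u w. E w u"
  \<comment> \<open>The sink phase stays below 2 n + 8 n + 3 B, so \<open>C0\<close> leaves a gap of
    20; the source potential is at least -14 n, so \<open>C1\<close> places that phase at least 12
    above \<open>C0\<close>.\<close>
  define C0 where "C0 = 10 * n + 3 * B + 20"
  define C1 where "C1 = C0 + 14 * n + 12"
  define \<Phi> where "\<Phi> u = (if \<exists>t. unique_sink E u t then
      (let t = THE t. unique_sink E u t in taxi t u + 2 * shadow E u + 3 * \<beta> u)
      else if \<exists>t. unique_sink ?R u t then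
      (let t = THE t. unique_sink ?R u t in C1 + source_potential n E t u + 9 * \<beta> u) else C0)" for u
  have the: "(THE t. unique_sink F u t) = t" if "unique_sink F u t" for F u t
    using that unfolding unique_sink_def by (intro the_equality) auto
  have P1: "\<Phi> u = taxi t u + 2 * shadow E u + 3 * \<beta> u" if "unique_sink E u t" for u t
  proof -
    have ex: "\<exists>t. unique_sink E u t" using that by blast
    show ?thesis unfolding \<Phi>_def if_P[OF ex] Let_def the[OF that] ..
  qed
  have P2: "\<Phi> u = C1 + source_potential n E t u + 9 * \<beta> u" 
    if "\<not> (\<exists>t. unique_sink E u t)" "unique_sink ?R u t" for u t
  proof -
    have ex: "\<exists>t. unique_sink ?R u t" using that(2) by blast
    show ?thesis unfolding \<Phi>_def if_not_P[OF that(1)] if_P[OF ex] Let_def the[OF that(2)] ..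
  qed
  have P3: "\<Phi> u = C0" if "\<not> (\<exists>t. unique_sink E u t)" "\<not> (\<exists>t. unique_sink ?R u t)" for u
    unfolding \<Phi>_def if_not_P[OF that(1)] if_not_P[OF that(2)] ..
  have B1: "0 \<le> \<Phi> u \<and> \<Phi> u \<le> C0 - 20" if "unique_sink E u t" "u \<in> strip_points n" for u t
    using P1[OF that(1)] taxi_bound[OF that] shadow_bound[OF that] b[OF that(2)] unfolding C0_def by auto
  have B2: "C0 + 12 \<le> \<Phi> u \<and> \<Phi> u \<le> C1 + 2 + 9 * B" 
    if "\<not> (\<exists>t. unique_sink E u t)" "unique_sink ?R u t" "u \<in> strip_points n" for u t
    using P2[OF that(1,2)] source_potential_bound[OF that(2,3)] b[OF that(3)] unfolding C1_def by auto
  have B0: "0 \<le> B" using b[OF chain_in_strip[OF n5, of 0 0]] by linarith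
  have same: "unique_sink ?R u t" if "unique_sink ?R w t" "E u w" for u w t
    using rev.unique_sink_mono[OF that(1) _ E_strip(2)[OF that(2)]] that(2) by blast
  have inv: "t = t'" if "unique_sink ?R u t" "unique_sink ?R w t'" "E u w" for u w t t'
    using same[OF that(2,3)] that(1) the by metis
  have bounds: "0 \<le> \<Phi> u \<and> \<Phi> u \<le> 24 * n + 12 * B + 34" if u: "u \<in> strip_points n" for u
  proof -
    consider (1) t where "unique_sink E u t" | (2) t where "\<not> (\<exists>t. unique_sink E u t)" "unique_sink ?R u t"
      | (3) "\<not> (\<exists>t. unique_sink E u t)" "\<not> (\<exists>t. unique_sink ?R u t)" by blast
    then show ?thesis
    proof cases
      case (1 t) then show ?thesis using B1[OF 1 u] B0 n5 unfolding C0_def by simp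
    next
      case (2 t) then show ?thesis using B2[OF 2 u] B0 n5 unfolding C0_def C1_def by simp
    next
      case 3 then show ?thesis using P3[OF 3] B0 n5 unfolding C0_def by simp
    qed
  qed
  text \<open>Leaving the source phase, or a vertex belonging to neither phase, costs at least a constant.\<close>
  have leave: "\<Phi> w \<le> \<Phi> u - 12" if uw: "E u w" "unique_sink ?R u t" "\<not> (\<exists>t. unique_sink E u t)"
    "\<not> unique_sink ?R w t" for u w t
  proof (cases "\<exists>t. unique_sink E w t")
    case True
    then show ?thesis using B1 B2[OF uw(3,2)] E_strip[OF uw(1)] by fastforce
  next
    case False
    have "\<not> (\<exists>t. unique_sink ?R w t)" using inv[OF uw(2) _ uw(1)] uw(4) by blast
    then show ?thesis using P3[OF False] B2[OF uw(3,2)] E_strip[OF uw(1)] by simp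
  qed
  have leave3: "\<Phi> w \<le> \<Phi> u - 12" if uw: "E u w" "\<not> (\<exists>t. unique_sink ?R u t)" "\<not> (\<exists>t. unique_sink E u t)" for u w
  proof -
    obtain t where "unique_sink E w t" using neither_step[OF E_strip(1)[OF uw(1)] _ uw(1)] uw(2) by blast
    then show ?thesis using B1 P3[OF uw(3,2)] E_strip[OF uw(1)] by fastforce
  qed
  have bent: "\<Phi> w \<le> \<Phi> u - 1" if uw: "E u w" and no: "\<And>s1 s2. \<not> straight n E u s1 s2" for u w
  proof -
    note uL = E_strip(1)[OF uw]
    have bw: "\<beta> w \<le> \<beta> u - 1" using drop[OF uw no] .
    consider (1) t where "unique_sink E u t" | (2) t where "\<not> (\<exists>t. unique_sink E u t)" "unique_sink ?R u t"
      | (3) "\<not> (\<exists>t. unique_sink E u t)" "\<not> (\<exists>t. unique_sink ?R u t)" by blast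
    then show ?thesis
    proof cases
      case (1 t)
      have "unique_sink E w t" using unique_sink_mono[OF 1 _ uL] uw by blast
      then show ?thesis using P1 1 shadow_mono(1)[OF 1 uL uw] taxi_edge[OF uw, of t] bw by simp
    next
      case (2 t)
      show ?thesis
      proof (cases "unique_sink ?R w t \<and> \<not> (\<exists>t. unique_sink E w t)")
        case True
        then show ?thesis using P2[OF 2] P2[of w t] source_phase_edge[OF _ uw, of t] bw by simp
      next
        case False
        then show ?thesis using leave[OF uw 2(2,1)] B1 B2[OF 2 uL] E_strip(2)[OF uw] by fastforce
      qed
    next
      case 3
      then show ?thesis using leave3[OF uw] by simp
    qed
  qed
  have st: "\<Phi> (mv1 n s1 u) + \<Phi> (mv2 n s2 u) \<le> 2 * \<Phi> u - 2" if st: "straight n E u s1 s2" for u s1 s2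
  proof -
    note uL = straight_strip[OF st]
    have E: "E u (mv1 n s1 u)" "E u (mv2 n s2 u)" using st unfolding straight_def by auto
    consider (1) t where "unique_sink E u t" | (2) t where "\<not> (\<exists>t. unique_sink E u t)" "unique_sink ?R u t"
      | (3) "\<not> (\<exists>t. unique_sink E u t)" "\<not> (\<exists>t. unique_sink ?R u t)" by blast
    then show ?thesis
    proof cases
      case (1 t)
      have "unique_sink E (mv1 n s1 u) t" "unique_sink E (mv2 n s2 u) t"
        using unique_sink_mono[OF 1 _ uL] E by blast+
      then show ?thesis using P1 1 sink_phase_straight[OF 1 st] mono[OF E(1)] mono[OF E(2)] by simp
    next
      case (2 t)
      have "\<Phi> w - \<Phi> u \<le> (if unique_sink ?R w t then source_potential n E t w - source_potential n E t u else -12)"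
        if uw: "E u w" for w
      proof (cases "unique_sink ?R w t")
        case True
        show ?thesis
        proof (cases "\<exists>t. unique_sink E w t")
          \<comment> \<open>A point satisfying both conditions is valued by the sink phase. Its
            value is so small that the drop still exceeds the one shown by the source
            potential.\<close>
          case T: True
          then have "\<Phi> w \<le> C0 - 20" using B1 E_strip(2)[OF uw] by blast
          then have "\<Phi> w - \<Phi> u \<le> C0 - 20 - C1 - source_potential n E t u" using P2[OF 2] b[OF uL] by simp
          then show ?thesis using True source_potential_bound(1)[OF True E_strip(2)[OF uw]] unfolding C1_def by simp
        next
          case False
          then show ?thesis using P2[OF 2] P2[OF False True] True mono[OF uw] by simp
        qed
      next
        case False
        then show ?thesis using leave[OF uw 2(2,1)] by simp
      qed
      from this[OF E(1)] this[OF E(2)] show ?thesis using source_phase_straight[OF 2(2) st] by linarith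
    next
      case 3
      then show ?thesis using leave3[OF E(1) 3(2,1)] leave3[OF E(2) 3(2,1)] by linarith
    qed
  qed
  show thesis using that[OF bounds st bent] by blast
qed

end

section \<open>Gale sets\<close>

definition gale :: "int \<Rightarrow> int \<times> int \<Rightarrow> int set" where
  "gale n u = {fst u mod n, (fst u + 1) mod n, snd u mod n, (snd u + 1) mod n}"

text \<open>The orbit under \<open>deck\<close>: even powers translate, odd powers exchange the
  pairs as well.\<close>

definition same_orbit :: "int \<Rightarrow> int \<times> int \<Rightarrow> int \<times> int \<Rightarrow> bool" where
  "same_orbit n u w \<longleftrightarrow> (\<exists>h. w = (fst u + h * n, snd u + h * n) \<or> w = (snd u + h * n, fst u + (h + 1) * n))"

definition drop1 :: "int \<Rightarrow> int \<Rightarrow> int \<times> int \<Rightarrow> int" where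
  "drop1 n s u = (if s = 1 then fst u else fst u + 1) mod n"

definition drop2 :: "int \<Rightarrow> int \<Rightarrow> int \<times> int \<Rightarrow> int" where
  "drop2 n s u = (if s = 1 then snd u else snd u + 1) mod n"

text \<open>Within this window congruence leaves three possible differences, which reduces
  statements on Gale sets to linear arithmetic.\<close>

lemma mod_near:
  fixes a b n :: int
  assumes "n > 0" "- 2 * n < a - b" "a - b < 2 * n"
  shows "a mod n = b mod n \<longleftrightarrow> a = b \<or> a = b + n \<or> b = a + n"
proof
  assume "a mod n = b mod n"
  then have "n dvd a - b" by (simp add: mod_eq_dvd_iff)
  then obtain c where c: "a - b = n * c" by (elim dvdE)
  have "n * c < n * 2" "n * (- 2) < n * c" using c assms by linarith+
  then have "c < 2" "- 2 < c" unfolding mult_less_cancel_left_pos[OF assms(1)] .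
  then have "c = -1 \<or> c = 0 \<or> c = 1" by auto
  then show "a = b \<or> a = b + n \<or> b = a + n" using c by auto
next
  assume "a = b \<or> a = b + n \<or> b = a + n"
  then show "a mod n = b mod n" by (metis mod_add_self2)
qed

lemma mod_shift: "((a::int) + h * n) mod n = a mod n" "(a + h * n + 1) mod n = (a + 1) mod n"
proof -
  show "(a + h * n) mod n = a mod n" for a by simp
  have "a + h * n + 1 = (a + 1) + h * n" by simp
  then show "(a + h * n + 1) mod n = (a + 1) mod n" by (simp only: mod_mult_self1)
qed

lemma same_orbit_gale: "same_orbit n u w \<Longrightarrow> gale n w = gale n u"
  unfolding same_orbit_def gale_def by (elim exE disjE; hypsubst; simp only: fst_conv snd_conv mod_shift; blast)

lemma same_orbit_strip:
  assumes "same_orbit n u w" shows "w \<in> strip_points n \<longleftrightarrow> u \<in> strip_points n"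
proof -
  obtain h where h: "w = (fst u + h * n, snd u + h * n) \<or> w = (snd u + h * n, fst u + (h + 1) * n)"
    using assms unfolding same_orbit_def by (elim exE)
  define H where "H = h * n"
  have "(h + 1) * n = H + n" by (simp add: H_def distrib_right)
  then have "w = (fst u + H, snd u + H) \<or> w = (snd u + H, fst u + (H + n))" using h by (simp add: H_def)
  then show ?thesis by (cases u) (elim disjE; simp add: strip_points_def; linarith)
qed

lemma orbit_rep:
  assumes "a mod n = fst w mod n \<or> a mod n = snd w mod n"
  obtains w' where "same_orbit n w w'" "fst w' = a"
proof -
  from assms show thesis
  proof
    assume "a mod n = fst w mod n"
    then obtain h where "a - fst w = n * h" unfolding mod_eq_dvd_iff by (elim dvdE)
    then have "a = fst w + h * n" by (simp add: algebra_simps)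
    then show thesis using that[of "(a, snd w + h * n)"] unfolding same_orbit_def by auto
  next
    assume "a mod n = snd w mod n"
    then obtain h where "a - snd w = n * h" unfolding mod_eq_dvd_iff by (elim dvdE)
    then have "a = snd w + h * n" by (simp add: algebra_simps)
    then show thesis using that[of "(a, fst w + (h + 1) * n)"] unfolding same_orbit_def by auto
  qed
qed

lemma gale_rep:
  assumes "n \<ge> 5" "w \<in> strip_points n" "a mod n \<in> gale n w"
  obtains w' where "same_orbit n w w'" "fst w' = a \<or> fst w' = a - 1" "w' \<in> strip_points n" "gale n w' = gale n w"
proof -
  have s: "a mod n = (c + 1) mod n \<Longrightarrow> (a - 1) mod n = c mod n" for c
    by (metis add_diff_cancel_right' mod_diff_left_eq)
  consider "a mod n = fst w mod n \<or> a mod n = snd w mod n"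
    | "(a - 1) mod n = fst w mod n \<or> (a - 1) mod n = snd w mod n"
    using assms(3) s unfolding gale_def by auto
  then obtain w' where w': "same_orbit n w w'" "fst w' = a \<or> fst w' = a - 1"
    by cases (metis orbit_rep)+
  then show thesis using that same_orbit_strip assms(2) same_orbit_gale by blast
qed

lemma gale_card: assumes "n \<ge> 5" "u \<in> strip_points n" 
  shows "card (gale n u) = 4" "distinct [fst u mod n, (fst u + 1) mod n, snd u mod n, (snd u + 1) mod n]"
proof -
  have "fst u + 2 \<le> snd u" "snd u \<le> fst u + n - 2" using assms(2) by (auto simp: strip_points_def)
  then show d: "distinct [fst u mod n, (fst u + 1) mod n, snd u mod n, (snd u + 1) mod n]"
    using assms(1) by (simp add: mod_near)
  have "gale n u = set [fst u mod n, (fst u + 1) mod n, snd u mod n, (snd u + 1) mod n]" by (simp add: gale_def)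
  then show "card (gale n u) = 4" using distinct_card[OF d] by simp
qed

lemma gale_deck: "gale n (deck n u) = gale n u"
proof (rule same_orbit_gale)
  have "deck n u = (snd u + 0 * n, fst u + (0 + 1) * n)" by (simp add: deck_def)
  then show "same_orbit n u (deck n u)" unfolding same_orbit_def by blast
qed

lemma gale_mem:
  assumes "n \<ge> 5" "- 2 < a - z" "a - z < 2 * n" "z + 2 \<le> v" "v \<le> z + n - 2"
  shows "a mod n \<in> gale n (z, v) \<longleftrightarrow> a = z \<or> a = z + 1 \<or> a = v \<or> a = v + 1 \<or>
    a = z + n \<or> a = z + n + 1 \<or> a = v + n \<or> a = v + 1 + n \<or> a = v + 1 - n"
proof -
  have n: "n > 0" using assms by simp
  have "a mod n = z mod n \<longleftrightarrow> a = z \<or> a = z + n \<or> z = a + n"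
    "a mod n = (z + 1) mod n \<longleftrightarrow> a = z + 1 \<or> a = z + 1 + n \<or> z + 1 = a + n"
    "a mod n = v mod n \<longleftrightarrow> a = v \<or> a = v + n \<or> v = a + n"
    "a mod n = (v + 1) mod n \<longleftrightarrow> a = v + 1 \<or> a = v + 1 + n \<or> v + 1 = a + n"
    by (rule mod_near[OF n]; use assms in linarith)+
  then have "a mod n \<in> gale n (z, v) \<longleftrightarrow> (a = z \<or> a = z + n \<or> z = a + n) \<or>
    (a = z + 1 \<or> a = z + 1 + n \<or> z + 1 = a + n) \<or> (a = v \<or> a = v + n \<or> v = a + n) \<or>
    (a = v + 1 \<or> a = v + 1 + n \<or> v + 1 = a + n)"
    by (simp only: gale_def insert_iff empty_iff fst_conv snd_conv simp_thms)
  also have "\<dots> \<longleftrightarrow> a = z \<or> a = z + 1 \<or> a = v \<or> a = v + 1 \<or>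
    a = z + n \<or> a = z + n + 1 \<or> a = v + n \<or> a = v + 1 + n \<or> a = v + 1 - n"
    using assms by (smt (verit))
  finally show ?thesis .
qed

lemma gale_mv1:
  assumes "n \<ge> 5" "u \<in> strip_points n" "s = 1 \<or> s = -1"
  shows "gale n u \<inter> gale n (mv1 n s u) = gale n u - {drop1 n s u}"
proof -
  obtain x y where u: "u = (x, y)" "x + 2 \<le> y" "y \<le> x + n - 2"
    using assms(2) by (auto simp: strip_points_def)
  have gu: "gale n u = {x mod n, (x + 1) mod n, y mod n, (y + 1) mod n}" by (simp add: gale_def u)
  obtain z v where zv: "mv1 n s u = (z, v)" by (cases "mv1 n s u")
  have L: "z + 2 \<le> v" "v \<le> z + n - 2" using mv_strip(1)[OF assms] zv by (auto simp: strip_points_def)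
  have mem: "(x + k) mod n \<in> gale n (mv1 n s u) \<longleftrightarrow> x + k = z \<or> x + k = z + 1 \<or> x + k = v \<or> x + k = v + 1 \<or>
    x + k = z + n \<or> x + k = z + n + 1 \<or> x + k = v + n \<or> x + k = v + 1 + n \<or> x + k = v + 1 - n"
    if "- 2 < x + k - z" "x + k - z < 2 * n" for k
    unfolding zv by (rule gale_mem[OF assms(1) that L])
  have z: "z = x + s" and v: "v = (if s = 1 then (if y \<ge> x + 3 then y else y + 1) else (if y \<le> x + n - 3 then y else y - 1))"
    using zv assms(3) unfolding u mv1_def by (auto split: if_splits)
  have b: "- 2 < x + k - z" "x + k - z < 2 * n" if "0 \<le> k" "k \<le> n" for k
    using z assms(1,3) that by auto
  define k where "k = (if s = 1 then 0 else 1::int)"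
  have d: "drop1 n s u = (x + k) mod n" using assms(3) unfolding drop1_def k_def u by auto
  have "drop1 n s u \<notin> gale n (mv1 n s u)"
    unfolding d using mem[OF b, of k] z v L u assms(1,3) unfolding k_def by (auto split: if_splits)
  moreover have "y mod n \<in> gale n (mv1 n s u)" using mem[OF b, of "y - x"] z v u assms(1,3) by (auto split: if_splits)
  moreover have "(y + 1) mod n \<in> gale n (mv1 n s u)" using mem[OF b, of "y + 1 - x"] z v u assms(1,3) by (auto split: if_splits)
  moreover have "x mod n \<in> gale n (mv1 n s u)" if "s = -1" using mem[OF b, of 0] z v u assms(1) that by auto
  moreover have "(x + 1) mod n \<in> gale n (mv1 n s u)" if "s = 1" using mem[OF b, of 1] z v u assms(1) that by auto
  ultimately show ?thesis using assms(3) unfolding gu unfolding drop1_def u by auto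
qed

text \<open>Three tight facets determine an edge, and an edge has two ends. Let \<open>a\<close> be
  the surviving element of the first pair: every vertex containing it has a lift whose first pair
  starts at \<open>a\<close> or \<open>a - 1\<close>, and the other two elements then force the
  second pair.\<close>

lemma gale_unique1:
  assumes "n \<ge> 5" "u \<in> strip_points n" "w \<in> strip_points n" "s = 1 \<or> s = -1"
    "gale n u - {drop1 n s u} \<subseteq> gale n w"
  shows "gale n w = gale n u \<or> gale n w = gale n (mv1 n s u)"
proof -
  obtain x y where u: "u = (x, y)" "x + 2 \<le> y" "y \<le> x + n - 2"
    using assms(2) by (auto simp: strip_points_def)
  define a where "a = (if s = 1 then x + 1 else x)"
  have mem: "a mod n \<in> gale n w" "y mod n \<in> gale n w" "(y + 1) mod n \<in> gale n w"
  proof -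
    have gu: "gale n u = {x mod n, (x + 1) mod n, y mod n, (y + 1) mod n}" by (simp add: gale_def u)
    have d: "drop1 n s u = (if s = 1 then x else x + 1) mod n" by (simp add: drop1_def u)
    have ne: "x mod n \<noteq> (x + 1) mod n" "x mod n \<noteq> y mod n" "x mod n \<noteq> (y + 1) mod n"
      "(x + 1) mod n \<noteq> y mod n" "(x + 1) mod n \<noteq> (y + 1) mod n"
      using gale_card(2)[OF assms(1,2)] unfolding u(1) by simp_all
    show "a mod n \<in> gale n w" "y mod n \<in> gale n w" "(y + 1) mod n \<in> gale n w"
      by (rule subsetD[OF assms(5)]; use ne in \<open>simp add: gu d a_def\<close>)+
  qed
  obtain w' where w': "fst w' = a \<or> fst w' = a - 1" "w' \<in> strip_points n" "gale n w' = gale n w"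
    using gale_rep[OF assms(1,3) mem(1)] by metis
  obtain z v where zv: "w' = (z, v)" "z + 2 \<le> v" "v \<le> z + n - 2" using w'(2) by (auto simp: strip_points_def)
  have za: "z = a \<or> z = a - 1" using w'(1) zv(1) by simp
  have b: "- 2 < y - z" "y - z < 2 * n" "- 2 < y + 1 - z" "y + 1 - z < 2 * n" using za u assms(1) unfolding a_def by auto
  note y = mem(2)[folded w'(3), unfolded zv(1) gale_mem[OF assms(1) b(1,2) zv(2,3)]]
  note y1 = mem(3)[folded w'(3), unfolded zv(1) gale_mem[OF assms(1) b(3,4) zv(2,3)]]
  have "z = x \<and> v = y \<or> s = 1 \<and> z = x + 1 \<and> v = (if y \<ge> x + 3 then y else y + 1) \<or>
     s = -1 \<and> z = x - 1 \<and> v = (if y \<le> x + n - 3 then y else y - 1)"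
    using assms(4) za
  proof (elim disjE)
    assume "s = 1" "z = a" then have z: "s = 1" "z = x + 1" by (auto simp: a_def)
    have "v = (if y \<ge> x + 3 then y else y + 1)" using y y1 zv u assms(1) z by (smt (verit))
    then show ?thesis using z by simp
  next
    assume "s = 1" "z = a - 1" then have z: "s = 1" "z = x" by (auto simp: a_def)
    have "v = y" using y y1 zv u assms(1) z by (smt (verit))
    then show ?thesis using z by simp
  next
    assume "s = - 1" "z = a" then have z: "s = -1" "z = x" by (auto simp: a_def)
    have "v = y" using y y1 zv u assms(1) z by (smt (verit))
    then show ?thesis using z by simp
  next
    assume "s = - 1" "z = a - 1" then have z: "s = -1" "z = x - 1" by (auto simp: a_def)
    have "v = (if y \<le> x + n - 3 then y else y - 1)" using y y1 zv u assms(1) z by (smt (verit))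
    then show ?thesis using z by simp
  qed
  then have "w' = u \<or> w' = mv1 n s u" using zv(1) u(1) by (auto simp: mv1_def)
  then show ?thesis using w'(3) by auto
qed

lemma gale_mv2:
  assumes "n \<ge> 5" "u \<in> strip_points n" "s = 1 \<or> s = -1"
  shows "gale n u \<inter> gale n (mv2 n s u) = gale n u - {drop2 n s u}"
  using gale_mv1[OF assms(1) _ assms(3), of "deck n u"] assms(2)
  by (simp add: mv_deck(1)[OF assms(3)] gale_deck deck_strip drop1_def drop2_def) (simp add: deck_def)

lemma gale_unique2:
  assumes "n \<ge> 5" "u \<in> strip_points n" "w \<in> strip_points n" "s = 1 \<or> s = -1"
    "gale n u - {drop2 n s u} \<subseteq> gale n w"
  shows "gale n w = gale n u \<or> gale n w = gale n (mv2 n s u)"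
proof -
  have "drop1 n s (deck n u) = drop2 n s u" by (simp add: drop1_def drop2_def deck_def)
  then show ?thesis
    using gale_unique1[OF assms(1) _ assms(3,4), of "deck n u"] assms(2,5)
    by (simp add: mv_deck(1)[OF assms(4)] gale_deck deck_strip)
qed

lemma gale_eq_orbit:
  assumes "n \<ge> 5" "u \<in> strip_points n" "w \<in> strip_points n" "gale n u = gale n w"
  shows "same_orbit n w u"
proof -
  obtain x y where u: "u = (x, y)" "x + 2 \<le> y" "y \<le> x + n - 2"
    using assms(2) by (auto simp: strip_points_def)
  have n: "n \<ge> 5" "n > 0" using assms by auto
  have mem: "x mod n \<in> gale n w" "(x + 1) mod n \<in> gale n w" "y mod n \<in> gale n w" "(y + 1) mod n \<in> gale n w"
    using assms(4) u by (auto simp: gale_def)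
  obtain w' where w': "same_orbit n w w'" "fst w' = x \<or> fst w' = x - 1" "w' \<in> strip_points n" "gale n w' = gale n w"
    by (rule gale_rep[OF assms(1,3) mem(1)])
  obtain z v where zv: "w' = (z, v)" "z + 2 \<le> v" "v \<le> z + n - 2" using w'(3) by (auto simp: strip_points_def)
  have b: "- 2 < y - z" "y - z < 2 * n" "- 2 < y + 1 - z" "y + 1 - z < 2 * n" 
    "- 2 < x + 1 - z" "x + 1 - z < 2 * n" using w'(2) zv(1) u assms(1) by auto
  note X = mem(2)[folded w'(4), unfolded zv(1) gale_mem[OF assms(1) b(5,6) zv(2,3)]]
  note Y = mem(3)[folded w'(4), unfolded zv(1) gale_mem[OF assms(1) b(1,2) zv(2,3)]]
  note Y1 = mem(4)[folded w'(4), unfolded zv(1) gale_mem[OF assms(1) b(3,4) zv(2,3)]]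
  have "z = x \<and> v = y" using w'(2)
  proof
    assume "fst w' = x" then have z: "z = x" using zv by simp
    have "v = y" using Y Y1 zv u assms(1) z by (smt (verit))
    then show ?thesis using z by simp
  next
    \<comment> \<open>The two sets would consist of four consecutive facets starting at
      \<open>x\<close> and at \<open>x - 1\<close>; they could agree only for
      \<open>n = 4\<close>.\<close>
    assume "fst w' = x - 1" then have z: "z = x - 1" using zv by simp
    have "v = x + 1" using X zv(2,3) assms(1) z by (elim disjE; linarith)
    have "y = x + 2" using Y \<open>v = x + 1\<close> z u(2,3) assms(1) by (elim disjE; linarith)
    then have False using Y1 \<open>v = x + 1\<close> z assms(1) by (elim disjE; linarith)
    then show ?thesis ..
  qed
  then show ?thesis using w'(1) zv(1) u(1) by simp
qed

section \<open>Adjacency and polygons in terms of Gale sets\<close>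

definition neighbor :: "int \<Rightarrow> int \<times> int \<Rightarrow> int \<times> int \<Rightarrow> bool" where
  "neighbor n u w \<longleftrightarrow> u \<in> strip_points n \<and> (\<exists>s\<in>{1, -1}. w = mv1 n s u \<or> w = mv2 n s u)"

lemma neighbor_strip: assumes "n \<ge> 5" "neighbor n u w" shows "u \<in> strip_points n" "w \<in> strip_points n"
proof -
  obtain s where s: "s = 1 \<or> s = -1" "w = mv1 n s u \<or> w = mv2 n s u" and u: "u \<in> strip_points n"
    using assms(2) unfolding neighbor_def by auto
  show "u \<in> strip_points n" "w \<in> strip_points n" using u s(2) mv_strip[OF assms(1) u s(1)] by auto
qed

lemma neighbor_sym: assumes "n \<ge> 5" "neighbor n u w" shows "neighbor n w u"
proof -
  obtain s where s: "s = 1 \<or> s = -1" "w = mv1 n s u \<or> w = mv2 n s u" and u: "u \<in> strip_points n"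
    using assms(2) unfolding neighbor_def by auto
  have "- s \<in> {1, -1}" using s(1) by auto
  then show ?thesis using mv_inverse_ex[OF assms(1) u s] neighbor_strip(2)[OF assms] unfolding neighbor_def by blast
qed

lemma neighborI: "u \<in> strip_points n \<Longrightarrow> s = 1 \<or> s = -1 \<Longrightarrow> neighbor n u (mv1 n s u)"
  "u \<in> strip_points n \<Longrightarrow> s = 1 \<or> s = -1 \<Longrightarrow> neighbor n u (mv2 n s u)"
  unfolding neighbor_def by blast+

lemma neighbor_drop:
  assumes n: "n \<ge> 5" and uw: "neighbor n u w"
  obtains c where "c \<in> gale n u" "gale n u \<inter> gale n w = gale n u - {c}"
    "\<And>v. v \<in> strip_points n \<Longrightarrow> gale n u - {c} \<subseteq> gale n v \<Longrightarrow> gale n v = gale n u \<or> gale n v = gale n w"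
proof -
  obtain s where s: "s = 1 \<or> s = -1" "w = mv1 n s u \<or> w = mv2 n s u" and u: "u \<in> strip_points n"
    using uw unfolding neighbor_def by auto
  from s(2) show thesis
  proof
    assume w: "w = mv1 n s u"
    have "drop1 n s u \<in> gale n u" by (simp add: drop1_def gale_def)
    then show thesis using that gale_mv1[OF n u s(1)] gale_unique1[OF n u _ s(1)] w by blast
  next
    assume w: "w = mv2 n s u"
    have "drop2 n s u \<in> gale n u" by (simp add: drop2_def gale_def)
    then show thesis using that gale_mv2[OF n u s(1)] gale_unique2[OF n u _ s(1)] w by blast
  qed
qed

lemma ex_neighbor_drop:
  assumes n: "n \<ge> 5" and u: "u \<in> strip_points n" and c: "c \<in> gale n u"
  obtains w where "neighbor n u w" "gale n u \<inter> gale n w = gale n u - {c}"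
    "\<And>v. v \<in> strip_points n \<Longrightarrow> gale n u - {c} \<subseteq> gale n v \<Longrightarrow> gale n v = gale n u \<or> gale n v = gale n w"
proof -
  have "c = drop1 n 1 u \<or> c = drop1 n (-1) u \<or> c = drop2 n 1 u \<or> c = drop2 n (-1) u"
    using c by (auto simp: gale_def drop1_def drop2_def)
  then obtain s where s: "s = 1 \<or> s = (-1::int)" "c = drop1 n s u \<or> c = drop2 n s u" by blast
  from s(2) show thesis
  proof
    assume "c = drop1 n s u"
    then show thesis using that[of "mv1 n s u"] gale_mv1[OF n u s(1)] gale_unique1[OF n u _ s(1)] neighborI[OF u s(1)] by blast
  next
    assume "c = drop2 n s u"
    then show thesis using that[of "mv2 n s u"] gale_mv2[OF n u s(1)] gale_unique2[OF n u _ s(1)] neighborI[OF u s(1)] by blast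
  qed
qed

text \<open>The four moves drop the four elements of the Gale set, each a different one, so a
  neighbor is known by what it drops.\<close>

lemma neighbor_drops_distinct:
  assumes n: "n \<ge> 5" and uw: "neighbor n u w" "neighbor n u v" "v \<noteq> w"
    and d: "gale n u \<inter> gale n w = gale n u - {c}" "gale n u \<inter> gale n v = gale n u - {d}"
    "c \<in> gale n u" "d \<in> gale n u"
  shows "c \<noteq> d"
proof -
  have u: "u \<in> strip_points n" using uw unfolding neighbor_def by blast
  have ne: "fst u mod n \<noteq> (fst u + 1) mod n" "fst u mod n \<noteq> snd u mod n" "fst u mod n \<noteq> (snd u + 1) mod n"
      "(fst u + 1) mod n \<noteq> snd u mod n" "(fst u + 1) mod n \<noteq> (snd u + 1) mod n" "snd u mod n \<noteq> (snd u + 1) mod n"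
    using gale_card(2)[OF n u] by simp_all
  have dd: "drop1 n s u \<in> gale n u" "drop2 n s u \<in> gale n u" for s by (simp_all add: drop1_def drop2_def gale_def)
  have *: "\<exists>s. (s = 1 \<or> s = -1) \<and> (w = mv1 n s u \<and> c = drop1 n s u \<or> w = mv2 n s u \<and> c = drop2 n s u)"
    if w: "neighbor n u w" "gale n u \<inter> gale n w = gale n u - {c}" "c \<in> gale n u" for w c
  proof -
    obtain s where s: "s = 1 \<or> s = -1" "w = mv1 n s u \<or> w = mv2 n s u"
      using w(1) unfolding neighbor_def by auto
    from s(2) show ?thesis
    proof
      assume e: "w = mv1 n s u"
      have "gale n u - {c} = gale n u - {drop1 n s u}" using gale_mv1[OF n u s(1)] w(2) e by simp
      then have "c = drop1 n s u" using w(3) dd(1)[of s] by blast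
      then show ?thesis using s(1) e by blast
    next
      assume e: "w = mv2 n s u"
      have "gale n u - {c} = gale n u - {drop2 n s u}" using gale_mv2[OF n u s(1)] w(2) e by simp
      then have "c = drop2 n s u" using w(3) dd(2)[of s] by blast
      then show ?thesis using s(1) e by blast
    qed
  qed
  obtain s where s: "s = 1 \<or> s = -1" "w = mv1 n s u \<and> c = drop1 n s u \<or> w = mv2 n s u \<and> c = drop2 n s u"
    using *[OF uw(1) d(1,3)] by blast
  obtain t where t: "t = 1 \<or> t = -1" "v = mv1 n t u \<and> d = drop1 n t u \<or> v = mv2 n t u \<and> d = drop2 n t u"
    using *[OF uw(2) d(2,4)] by blast
  show ?thesis
  proof
    assume cd: "c = d"
    from s(1) t(1) have "s = t \<or> s \<noteq> t \<and> (s = 1 \<and> t = -1 \<or> s = -1 \<and> t = 1)" by auto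
    then show False using s(2) t(2) cd uw(3) s(1)
      by (elim disjE conjE; simp add: drop1_def drop2_def ne ne[symmetric])
  qed
qed

lemma neighbor_gale_card: assumes "n \<ge> 5" "neighbor n u w"
  shows "card (gale n u \<inter> gale n w) = 3"
proof -
  obtain c where "c \<in> gale n u" "gale n u \<inter> gale n w = gale n u - {c}" using neighbor_drop[OF assms] by metis
  then show ?thesis using gale_card(1)[OF assms(1) neighbor_strip(1)[OF assms]] by (simp add: card_Diff_singleton)
qed

text \<open>Serves to lift an arc of the polytope to a prescribed lift of its tail; the lift of the
  head is found within its orbit.\<close>

lemma card3_neighbor:
  assumes n: "n \<ge> 5" and u: "u \<in> strip_points n" and w: "w \<in> strip_points n" and c3: "card (gale n u \<inter> gale n w) = 3"
  obtains v where "neighbor n u v" "gale n v = gale n w"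
proof -
  have fin: "finite (gale n u)" by (simp add: gale_def)
  have "card (gale n u - gale n u \<inter> gale n w) = 1"
    using card_Diff_subset[of "gale n u \<inter> gale n w" "gale n u"] fin gale_card(1)[OF n u] c3 by simp
  then obtain c where c: "gale n u - gale n u \<inter> gale n w = {c}" by (auto simp: card_1_singleton_iff)
  then have cu: "c \<in> gale n u" "gale n u - {c} \<subseteq> gale n w" by blast+
  obtain v where v: "neighbor n u v" 
    "\<And>z. z \<in> strip_points n \<Longrightarrow> gale n u - {c} \<subseteq> gale n z \<Longrightarrow> gale n z = gale n u \<or> gale n z = gale n v"
    using ex_neighbor_drop[OF n u cu(1)] by metis
  have "gale n w \<noteq> gale n u" using c3 gale_card(1)[OF n u] by auto
  then show thesis using that[OF v(1)] v(2)[OF w cu(2)] by blast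
qed

text \<open>What one neighbor drops the other keeps, so the projection to the polytope does not
  identify arcs at a vertex.\<close>

lemma neighbors_gale_ne:
  assumes n: "n \<ge> 5" and uw: "neighbor n u w" "neighbor n u v" "v \<noteq> w"
  shows "gale n w \<noteq> gale n v"
proof -
  obtain c where c: "c \<in> gale n u" "gale n u \<inter> gale n w = gale n u - {c}" using neighbor_drop[OF n uw(1)] by metis
  obtain d where d: "d \<in> gale n u" "gale n u \<inter> gale n v = gale n u - {d}" using neighbor_drop[OF n uw(2)] by metis
  have "d \<in> gale n u - {c}" using neighbor_drops_distinct[OF n uw c(2) d(2) c(1) d(1)] d(1) by simp
  then have "d \<in> gale n w" unfolding c(2)[symmetric] by simp
  moreover have "d \<notin> gale n u \<inter> gale n v" unfolding d(2) by simp
  ultimately show ?thesis using d(1) by auto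
qed

lemma neighbor_gale_ne: assumes "n \<ge> 5" "neighbor n u w" shows "gale n w \<noteq> gale n u"
proof -
  obtain c where c: "c \<in> gale n u" "gale n u \<inter> gale n w = gale n u - {c}" using neighbor_drop[OF assms] by metis
  have "c \<notin> gale n u \<inter> gale n w" unfolding c(2) by simp
  then show ?thesis using c(1) by auto
qed

lemma chain_neighbor: assumes "n \<ge> 5"
  shows "neighbor n (chain n i k) (chain n i (k + 1))" "neighbor n (chain n i k) (chain n i (k - 1))"
proof -
  show *: "neighbor n (chain n i k) (chain n i (k + 1))" for k
    using chain_succ(1)[OF assms, of i k] chain_in_strip[OF assms] unfolding neighbor_def by blast
  show "neighbor n (chain n i k) (chain n i (k - 1))" using neighbor_sym[OF assms *[of "k - 1"]] by simp
qed

lemma chain_gale: assumes "n \<ge> 5" shows "i mod n \<in> gale n (chain n i k)" "(i + 1) mod n \<in> gale n (chain n i k)"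
proof -
  obtain h r where k: "k = 2 * (n - 2) * h + r" "0 \<le> r" "r < 2 * (n - 2)"
    using chain_split[OF assms] .
  have sh: "gale n (a + h * n, b + h * n) = gale n (a, b)" for a b
    unfolding gale_def fst_conv snd_conv mod_shift ..
  have "(i + n) mod n = i mod n" "(i + n + 1) mod n = (i + 1) mod n"
    using mod_shift[of i 1 n] by simp_all
  then have g: "i mod n \<in> gale n (i - 1, i + 1)" "(i + 1) mod n \<in> gale n (i - 1, i + 1)"
    "i mod n \<in> gale n (i, v)" "(i + 1) mod n \<in> gale n (i, v)"
    "i mod n \<in> gale n (i + 1, i + n - 1)" "(i + 1) mod n \<in> gale n (i + 1, i + n - 1)"
    "i mod n \<in> gale n (v, i + n)" "(i + 1) mod n \<in> gale n (v, i + n)" for v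
    by (simp_all add: gale_def)
  have "i mod n \<in> gale n (chain n i k) \<and> (i + 1) mod n \<in> gale n (chain n i k)"
    unfolding k(1) chain_eq[OF assms k(2,3)] using g by (simp only: sh split: if_split) blast
  then show "i mod n \<in> gale n (chain n i k)" "(i + 1) mod n \<in> gale n (chain n i k)" by auto
qed

text \<open>Choose a lift whose first pair starts at \<open>i\<close>, a point of the column, or at
  \<open>i - 1\<close>; in the latter case the second pair must start at \<open>i + 1\<close>, the
  boundary point at index 0.\<close>

lemma gale_chain:
  assumes n: "n \<ge> 5" and u: "u \<in> strip_points n" and g: "i mod n \<in> gale n u" "(i + 1) mod n \<in> gale n u"
  obtains k where "gale n (chain n i k) = gale n u"
proof -
  obtain w where w: "same_orbit n u w" "fst w = i \<or> fst w = i - 1" "w \<in> strip_points n" "gale n w = gale n u"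
    by (rule gale_rep[OF n u g(1)])
  obtain z v where zv: "w = (z, v)" "z + 2 \<le> v" "v \<le> z + n - 2" using w(3) by (auto simp: strip_points_def)
  from w(2) show thesis
  proof
    assume "fst w = i"
    then have "chain n i (v - i - 1) = w" using chain_col(1)[OF n, of i v 1] w(3) zv by simp
    then show thesis using that w(4) by metis
  next
    assume "fst w = i - 1"
    then have z: "z = i - 1" using zv by simp
    have b: "- 2 < i + 1 - z" "i + 1 - z < 2 * n" using z n by auto
    have "(i + 1) mod n \<in> gale n (z, v)" using g(2) w(4) zv by simp
    then have "v = i + 1" unfolding gale_mem[OF n b zv(2,3)] using zv(2,3) z n by (elim disjE; linarith)
    then have "chain n i 0 = w" using chain_neg[OF n, of 0 i] zv z n by simp
    then show thesis using that w(4) by metis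
  qed
qed

text \<open>One period visits each vertex of the polygon once. The two alternatives in
  \<open>same_orbit\<close> are the even and the odd multiples of the period
  \<open>n - 2\<close>.\<close>

lemma chain_orbit:
  assumes n: "n \<ge> 5"
  shows "gale n (chain n i k) = gale n (chain n i l) \<longleftrightarrow> (n - 2) dvd (k - l)"
proof
  have sh: "chain n i (k + h * (2 * (n - 2))) = (fst (chain n i k) + h * n, snd (chain n i k) + h * n)" for k h
  proof -
    obtain g r where k: "k = 2 * (n - 2) * g + r" "0 \<le> r" "r < 2 * (n - 2)"
      using chain_split[OF n] .
    have e: "k + h * (2 * (n - 2)) = 2 * (n - 2) * (g + h) + r" using k by (simp add: algebra_simps)
    show ?thesis unfolding e chain_eq[OF n k(2,3)] unfolding k(1) chain_eq[OF n k(2,3)] by (auto simp: distrib_right)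
  qed
  {
    assume "gale n (chain n i k) = gale n (chain n i l)"
    then have "same_orbit n (chain n i l) (chain n i k)" using gale_eq_orbit[OF n chain_in_strip[OF n] chain_in_strip[OF n]] by blast
    then obtain h where h: "chain n i k = (fst (chain n i l) + h * n, snd (chain n i l) + h * n) \<or>
      chain n i k = (snd (chain n i l) + h * n, fst (chain n i l) + (h + 1) * n)" unfolding same_orbit_def by blast
    then show "(n - 2) dvd (k - l)"
    proof
      assume "chain n i k = (fst (chain n i l) + h * n, snd (chain n i l) + h * n)"
      then have "k = l + h * (2 * (n - 2))" using sh chain_inj[OF n] by metis
      then have "k - l = (n - 2) * (2 * h)" by (simp add: algebra_simps)
      then show ?thesis by simp
    next
      assume a: "chain n i k = (snd (chain n i l) + h * n, fst (chain n i l) + (h + 1) * n)"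
      have "chain n i ((l + (n - 2)) + h * (2 * (n - 2))) = (snd (chain n i l) + h * n, fst (chain n i l) + (h + 1) * n)"
        unfolding sh chain_deck[OF n] by (simp add: deck_def distrib_right)
      then have "k = (l + (n - 2)) + h * (2 * (n - 2))" using a chain_inj[OF n] by metis
      then have "k - l = (n - 2) * (1 + 2 * h)" by (simp add: algebra_simps)
      then show ?thesis by simp
    qed
  }
  assume "(n - 2) dvd (k - l)"
  then obtain c where "k - l = (n - 2) * c" by (elim dvdE)
  then have c: "k = l + c * (n - 2)" by (simp add: algebra_simps)
  have *: "gale n (chain n i (l + int m * (n - 2))) = gale n (chain n i l)" for l m
  proof (induction m)
    case (Suc m)
    have e: "l + int (Suc m) * (n - 2) = l + int m * (n - 2) + (n - 2)" by (simp add: algebra_simps)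
    show ?case unfolding e chain_deck[OF n] gale_deck using Suc .
  qed simp
  show "gale n (chain n i k) = gale n (chain n i l)"
  proof (cases "c \<ge> 0")
    case True then show ?thesis using *[of l "nat c"] c by simp
  next
    case False then show ?thesis using *[of k "nat (- c)"] c by simp
  qed
qed

text \<open>Any two edges at a vertex of a simple polytope span a polygon, which is a triangle,
  a quadrangle or one of the large polygons.\<close>

lemma neighbor_pair:
  assumes n: "n \<ge> 5" and ab: "neighbor n u a" "neighbor n u b" "a \<noteq> b"
  shows "neighbor n a b \<or>
    (\<exists>d k l. d \<noteq> u \<and> neighbor n a d \<and> neighbor n b d \<and> k \<noteq> l \<and> k \<in> {0..<n} \<and> l \<in> {0..<n} \<and>
        {k, l} \<subseteq> gale n u \<inter> gale n a \<inter> gale n b \<inter> gale n d) \<or>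
    (\<exists>i k. u = chain n i k \<and> {a, b} = {chain n i (k - 1), chain n i (k + 1)})" (is "?T a b \<or> ?S a b \<or> ?C a b")
proof -
  obtain x y where u: "u = (x, y)" "x + 2 \<le> y" "y \<le> x + n - 2"
    using ab(1) by (auto simp: neighbor_def strip_points_def)
  have uL: "u \<in> strip_points n" using ab(1) by (auto simp: neighbor_def)
  have sym: "?T b a \<or> ?S b a \<or> ?C b a \<Longrightarrow> ?T a b \<or> ?S a b \<or> ?C a b" for a b
  proof (elim disjE)
    show "?T b a \<Longrightarrow> ?T a b \<or> ?S a b \<or> ?C a b" for a b using neighbor_sym[OF n] by blast
    show "?S b a \<Longrightarrow> ?T a b \<or> ?S a b \<or> ?C a b" for a b by blast
    show "?C b a \<Longrightarrow> ?T a b \<or> ?S a b \<or> ?C a b" for a b unfolding insert_commute[of b a "{}"] by blast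
  qed
  have row: "?C (mv1 n 1 u) (mv1 n (-1) u)"
  proof (intro exI conjI)
    show "u = chain n y (x - y + 1)" using chain_row(1)[OF n, of x y 1] u uL by simp
    have "chain n y (x - y + 1 + 1) = mv1 n 1 u" "chain n y (x - y + 1 + (- 1)) = mv1 n (-1) u"
      using chain_row(2)[OF n, of x y 1] chain_row(2)[OF n, of x y "-1"] u(1) uL by simp_all
    then show "{mv1 n 1 u, mv1 n (-1) u} = {chain n y (x - y + 1 - 1), chain n y (x - y + 1 + 1)}"
      by (simp add: insert_commute)
  qed
  have col: "?C (mv2 n 1 u) (mv2 n (-1) u)"
  proof (intro exI conjI)
    show "u = chain n x (y - x - 1)" using chain_col(1)[OF n, of x y 1] u uL by simp
    have "chain n x (y - x - 1 + 1) = mv2 n 1 u" "chain n x (y - x - 1 + (- 1)) = mv2 n (-1) u"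
      using chain_col(2)[OF n, of x y 1] chain_col(2)[OF n, of x y "-1"] u(1) uL by simp_all
    then show "{mv2 n 1 u, mv2 n (-1) u} = {chain n x (y - x - 1 - 1), chain n x (y - x - 1 + 1)}"
      by (simp add: insert_commute)
  qed
  \<comment> \<open>Away from the boundary a horizontal and a vertical move commute;
    \<open>k\<close> and \<open>l\<close> come from the elements of the two pairs that both moves
    keep.\<close>
  have sq: "?S (x + s, y) (x, y + t)" if st: "s = 1 \<or> s = -1" "t = 1 \<or> t = -1"
    and L: "(x + s, y) \<in> strip_points n" "(x, y + t) \<in> strip_points n" "(x + s, y + t) \<in> strip_points n" for s t
  proof -
    have L': "x + s + 2 \<le> y" "y \<le> x + s + n - 2" "x + 2 \<le> y + t" "y + t \<le> x + n - 2"
      "x + s + 2 \<le> y + t" "y + t \<le> x + s + n - 2" using L by (auto simp: strip_points_def)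
    define k where "k = (if s = 1 then x + 1 else x)"
    define l where "l = (if t = 1 then y + 1 else y)"
    have "(x + s, y + t) = mv2 n t (x + s, y)" "(x + s, y + t) = mv1 n s (x, y + t)"
      using st L' by (auto simp: mv1_def mv2_def)
    then have "neighbor n (x + s, y) (x + s, y + t)" "neighbor n (x, y + t) (x + s, y + t)"
      using neighborI(2)[OF L(1) st(2)] neighborI(1)[OF L(2) st(1)] by auto
    moreover have "k mod n \<noteq> l mod n" 
    proof -
      have "x mod n \<noteq> y mod n" "x mod n \<noteq> (y + 1) mod n" "(x + 1) mod n \<noteq> y mod n" "(x + 1) mod n \<noteq> (y + 1) mod n"
        using gale_card(2)[OF n uL] unfolding u(1) by simp_all
      then show ?thesis unfolding k_def l_def by (simp split: if_split)
    qed
    moreover have "{k mod n, l mod n} \<subseteq> gale n u \<inter> gale n (x + s, y) \<inter> gale n (x, y + t) \<inter> gale n (x + s, y + t)"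
    proof -
      have "k = x \<or> k = x + 1" "k = x + s \<or> k = x + s + 1" "l = y \<or> l = y + 1" "l = y + t \<or> l = y + t + 1"
        using st unfolding k_def l_def by auto
      note kl = this
      have in2: "a = b \<or> a = b + 1 \<Longrightarrow> a mod n \<in> {b mod n, (b + 1) mod n}" for a b :: int by auto
      note in2[OF kl(1)] in2[OF kl(2)] in2[OF kl(3)] in2[OF kl(4)]
      then show ?thesis unfolding gale_def u(1) fst_conv snd_conv by blast
    qed
    moreover have "(x + s, y + t) \<noteq> u" using u st by auto
    moreover have "k mod n \<in> {0..<n}" "l mod n \<in> {0..<n}" using n by auto
    ultimately show ?thesis by blast
  qed
  have mix: "?T (mv1 n s u) (mv2 n t u) \<or> ?S (mv1 n s u) (mv2 n t u) \<or> ?C (mv1 n s u) (mv2 n t u)"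
    if st: "s = 1 \<or> s = -1" "t = 1 \<or> t = -1" for s t
  proof -
    have aL: "mv1 n s u \<in> strip_points n" and bL: "mv2 n t u \<in> strip_points n" using mv_strip[OF n uL] st by auto
    have T1: "?T (mv1 n s u) (mv2 n t u)" if "mv1 n r (mv2 n t u) = mv1 n s u \<or> mv2 n r (mv1 n s u) = mv2 n t u" "r = 1 \<or> r = -1" for r
      using that(1)
    proof
      assume "mv1 n r (mv2 n t u) = mv1 n s u"
      then have "neighbor n (mv2 n t u) (mv1 n s u)" using neighborI(1)[OF bL that(2)] by simp
      then show ?thesis by (rule neighbor_sym[OF n])
    next
      assume "mv2 n r (mv1 n s u) = mv2 n t u"
      then show ?thesis using neighborI(2)[OF aL that(2)] by simp
    qed
    from st have "s = t \<or> s = 1 \<and> t = -1 \<or> s = -1 \<and> t = 1" by auto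
    then show ?thesis
    proof (elim disjE conjE)
      assume st': "s = t"
      consider "y = x + 2" | "y = x + n - 2" | "x + 3 \<le> y" "y \<le> x + n - 3" using u(2,3) by linarith
      then show ?thesis
      proof cases
        case 1 note low = st' 1
      have "mv1 n 1 (mv2 n 1 u) = mv1 n 1 u" "mv2 n (-1) (mv1 n (-1) u) = mv2 n (-1) u"
        using low(2) u(1) n by (simp_all add: mv1_def mv2_def)
      then show ?thesis using T1[of 1] T1[of "-1"] low(1) st(1) by (elim disjE) simp_all
      next
        case 2 note high = st' 2
      have "mv2 n 1 (mv1 n 1 u) = mv2 n 1 u" "mv1 n (-1) (mv2 n (-1) u) = mv1 n (-1) u"
        using high(2) u(1) n by (simp_all add: mv1_def mv2_def)
      then show ?thesis using T1[of 1] T1[of "-1"] high(1) st(1) by (elim disjE) simp_all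
      next
        case 3 note mid = st' 3
      have e: "mv1 n s u = (x + s, y)" "mv2 n t u = (x, y + t)" using st u mid by (auto simp: mv1_def mv2_def)
      have "(x + s, y + t) \<in> strip_points n" using mid st u by (auto simp: strip_points_def)
      then show ?thesis using sq[OF st] aL bL unfolding e by blast
      qed
    next
      assume st': "s = 1" "t = -1"
      consider "y = x + 2" | "y = x + 3" | "x + 4 \<le> y" using u(2,3) by linarith
      then show ?thesis
      proof cases
        \<comment> \<open>Four consecutive facets contain a third adjacent pair, the middle one, and
          these two moves run along its chain.\<close>
        case 1 note p1 = st' 1
      have "u = chain n (x + 1) 0" "mv1 n s u = chain n (x + 1) (0 + 1)" "mv2 n t u = chain n (x + 1) (0 - 1)"
        using p1 u(1) n by (simp_all add: chain_neg mv1_def mv2_def)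
      then have "?C (mv1 n s u) (mv2 n t u)" by (intro exI[of _ "x + 1"] exI[of _ 0]) (simp add: insert_commute)
      then show ?thesis by blast
      next
        case 2 note p2 = st' 2
      have "mv1 n 1 (mv2 n t u) = mv1 n s u" using p2 u(1) n by (simp add: mv1_def mv2_def)
      then show ?thesis using T1[of 1] by simp
      next
        case 3 note p3 = st' 3
      have e: "mv1 n s u = (x + s, y)" "mv2 n t u = (x, y + t)" using st u p3 by (auto simp: mv1_def mv2_def)
      have "(x + s, y + t) \<in> strip_points n" using p3 st u by (auto simp: strip_points_def)
      then show ?thesis using sq[OF st] aL bL unfolding e by blast
      qed
    next
      assume st': "s = -1" "t = 1"
      consider "y = x + n - 2" | "y = x + n - 3" | "y \<le> x + n - 4" using u(2,3) by linarith
      then show ?thesis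
      proof cases
        case 1 note q1 = st' 1
      have "u = chain n (x - 1) (n - 2)" "mv1 n s u = chain n (x - 1) (n - 2 - 1)"
        using q1 u(1) n by (simp_all add: chain_neg mv1_def)
      moreover have "chain n (x - 1) (1 + (n - 2)) = mv2 n t u"
        unfolding chain_deck[OF n] using q1 u(1) n by (simp add: chain_neg mv2_def deck_def)
      ultimately have "?C (mv1 n s u) (mv2 n t u)" 
        by (intro exI[of _ "x - 1"] exI[of _ "n - 2"]) (simp add: add.commute[of "n - 2" 1])
      then show ?thesis by blast
      next
        case 2 note q2 = st' 2
      have "mv1 n (-1) (mv2 n t u) = mv1 n s u" using q2 u(1) n by (simp add: mv1_def mv2_def)
      then show ?thesis using T1[of "-1"] by simp
      next
        case 3 note q3 = st' 3
      have e: "mv1 n s u = (x + s, y)" "mv2 n t u = (x, y + t)" using st u q3 by (auto simp: mv1_def mv2_def)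
      have "(x + s, y + t) \<in> strip_points n" using q3 st u by (auto simp: strip_points_def)
      then show ?thesis using sq[OF st] aL bL unfolding e by blast
      qed
    qed
  qed
  obtain s where s: "s = 1 \<or> s = -1" "a = mv1 n s u \<or> a = mv2 n s u" using ab(1) unfolding neighbor_def by auto
  obtain t where t: "t = 1 \<or> t = -1" "b = mv1 n t u \<or> b = mv2 n t u" using ab(2) unfolding neighbor_def by auto
  from s(2) t(2) show ?thesis
  proof (elim disjE)
    assume "a = mv1 n s u" "b = mv1 n t u"
    moreover then have "s = 1 \<and> t = -1 \<or> s = -1 \<and> t = 1" using s(1) t(1) ab(3) by auto
    ultimately show ?thesis using row sym[OF disjI2[OF disjI2[OF row]]] by (elim disjE conjE) simp_all
  next
    assume "a = mv2 n s u" "b = mv2 n t u"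
    moreover then have "s = 1 \<and> t = -1 \<or> s = -1 \<and> t = 1" using s(1) t(1) ab(3) by auto
    ultimately show ?thesis using col sym[OF disjI2[OF disjI2[OF col]]] by (elim disjE conjE) simp_all
  next
    assume "a = mv1 n s u" "b = mv2 n t u"
    then show ?thesis using mix[OF s(1) t(1)] by simp
  next
    assume "a = mv2 n s u" "b = mv1 n t u"
    then show ?thesis using mix[OF t(1) s(1)] sym[of b a] by blast
  qed
qed

section \<open>Orientations of the dual cyclic polytope\<close>

text \<open>A periodic two-valued sequence with one fall per period has one rise per period. An AUSO
  speaks of sinks only; this supplies the unique source of each large polygon.\<close>

lemma unique_up_start:
  fixes up :: "int \<Rightarrow> bool" and N K :: int
  assumes N: "N > 0" and per: "\<And>k. up (k + N) = up k"
    and sink: "\<And>k. up (k - 1) \<and> \<not> up k \<longleftrightarrow> N dvd (k - K)"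
  shows "\<exists>K. \<forall>k. \<not> up (k - 1) \<and> up k \<longleftrightarrow> N dvd (k - K)"
proof -
  have K: "up (K - 1)" "\<not> up K" using sink[of K] by auto
  have perm: "up (k + c * N) = up k" for k c
  proof -
    have nat: "up (k + int m * N) = up k" for k m
    proof (induction m)
      case (Suc m)
      then show ?case using per[of "k + int m * N"] by (simp add: algebra_simps)
    qed simp
    show ?thesis
    proof (cases "c \<ge> 0")
      case True then show ?thesis using nat[of k "nat c"] by simp
    next
      case False then show ?thesis using nat[of "k + c * N" "nat (- c)"] by simp
    qed
  qed
  \<comment> \<open>The first rise after the fall at \<open>K\<close>. Up to the end of the period
    \<open>up\<close> stays true, because the next fall is a whole period away.\<close>
  define d where "d = (LEAST d. up (K + int d))"
  have ex: "up (K + int (nat (N - 1)))" using per[of "K - 1"] K(1) N by (simp add: algebra_simps)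
  have d: "up (K + int d)" unfolding d_def by (rule LeastI[of _ "nat (N - 1)"], rule ex)
  have dN: "int d < N" using Least_le[of "\<lambda>d. up (K + int d)" "nat (N - 1)", OF ex] N unfolding d_def by linarith
  have low: "\<not> up (K + int e)" if "e < d" for e using not_less_Least[of e "\<lambda>d. up (K + int d)"] that d_def by auto
  have d0: "d > 0" using d K(2) by (cases d) auto
  have high: "up (K + int e)" if "d \<le> e" "int e < N" for e
    using that
  proof (induction e rule: dec_induct)
    case base then show ?case using d by simp
  next
    case (step e)
    show ?case
    proof (rule ccontr)
      assume "\<not> ?thesis"
      then have "N dvd (K + int (Suc e) - K)" using sink[of "K + int (Suc e)"] step by (simp add: algebra_simps)
      then have "N dvd int (Suc e)" by simp
      then show False using step N zdvd_imp_le[of N "int (Suc e)"] by simp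
    qed
  qed
  have "\<not> up (k - 1) \<and> up k \<longleftrightarrow> N dvd (k - (K + int d))" for k
  proof -
    define e where "e = (k - K) mod N"
    have e: "0 \<le> e" "e < N" using N unfolding e_def by auto
    define c where "c = (k - K) div N"
    have kc: "k = (K + e) + c * N" unfolding e_def c_def by (simp add: algebra_simps)
    have u1: "up k = up (K + e)" unfolding kc by (rule perm)
    have k1: "k - 1 = (K + e - 1) + c * N" using kc by simp
    have u2: "up (k - 1) = up (K + e - 1)" unfolding k1 by (rule perm)
    have dv: "N dvd (k - (K + int d)) \<longleftrightarrow> e = int d"
    proof
      assume "N dvd (k - (K + int d))"
      then have "N dvd (e - int d) + c * N" by (simp add: kc algebra_simps)
      then have "N dvd e - int d" by (simp add: dvd_add_left_iff)
      then show "e = int d" using e dN N dvd_imp_le_int[of "e - int d" N] by fastforce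
    qed (simp add: kc)
    consider "e = 0" | "0 < e" "e < int d" | "e = int d" | "e > int d" using e by linarith
    then show ?thesis
    proof cases
      case 1 then show ?thesis using u1 K d0 dv by simp
    next
      case 2 then show ?thesis using u1 low[of "nat e"] dv by simp
    next
      case 3
      have "\<not> up (K + int (d - 1))" using low[of "d - 1"] d0 by simp
      then show ?thesis using u1 u2 d 3 dv d0 by (simp add: of_nat_diff algebra_simps)
    next
      case 4
      then have "up (K + (e - 1))" using high[of "nat (e - 1)"] e by simp
      then have "up (K + e - 1)" by (simp add: algebra_simps)
      then show ?thesis using u2 dv 4 by simp
    qed
  qed
  then show ?thesis by blast
qed

section \<open>Lifting an AUSO to the strip\<close>

locale cyclic_auso =
  fixes n :: int and vtx :: "int \<times> int \<Rightarrow> 'a" and D :: "('a \<times> 'a) set"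
  assumes n5: "n \<ge> 5"
    and vtx_eq: "u \<in> strip_points n \<Longrightarrow> w \<in> strip_points n \<Longrightarrow> vtx u = vtx w \<longleftrightarrow> gale n u = gale n w"
    and D_adj: "(a, b) \<in> D \<Longrightarrow> \<exists>u\<in>strip_points n. \<exists>w\<in>strip_points n. a = vtx u \<and> b = vtx w \<and> card (gale n u \<inter> gale n w) = 3"
    and D_or: "u \<in> strip_points n \<Longrightarrow> w \<in> strip_points n \<Longrightarrow> card (gale n u \<inter> gale n w) = 3 \<Longrightarrow>
        ((vtx u, vtx w) \<in> D) \<noteq> ((vtx w, vtx u) \<in> D)"
    and D_acyclic: "acyclic D"
    and face_sink: "k \<in> {0..<n} \<Longrightarrow> l \<in> {0..<n} \<Longrightarrow> k \<noteq> l \<Longrightarrow>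
        \<exists>!a. \<exists>u\<in>strip_points n. a = vtx u \<and> k \<in> gale n u \<and> l \<in> gale n u \<and>
          (\<forall>w\<in>strip_points n. k \<in> gale n w \<longrightarrow> l \<in> gale n w \<longrightarrow> (vtx u, vtx w) \<notin> D)"
begin

abbreviation "L \<equiv> strip_points n"

definition E :: "int \<times> int \<Rightarrow> int \<times> int \<Rightarrow> bool" where
  "E u w \<longleftrightarrow> neighbor n u w \<and> (vtx u, vtx w) \<in> D"

definition is_face_sink :: "int \<Rightarrow> int \<Rightarrow> int \<times> int \<Rightarrow> bool" where
  "is_face_sink k l u \<longleftrightarrow> u \<in> L \<and> k \<in> gale n u \<and> l \<in> gale n u \<and>
      (\<forall>w\<in>L. k \<in> gale n w \<longrightarrow> l \<in> gale n w \<longrightarrow> (vtx u, vtx w) \<notin> D)"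

lemma finite_vtx: "finite (vtx ` L)"
proof -
  have "gale n ` L \<subseteq> Pow {0..<n}" using n5 by (auto simp: gale_def)
  then have fin: "finite (gale n ` L)" by (rule finite_subset) simp
  have "vtx ` L \<subseteq> (\<lambda>g. vtx (SOME u. u \<in> L \<and> gale n u = g)) ` (gale n ` L)"
  proof
    fix a assume "a \<in> vtx ` L"
    then obtain u where u: "u \<in> L" "a = vtx u" by blast
    define w where "w = (SOME w. w \<in> L \<and> gale n w = gale n u)"
    have "w \<in> L \<and> gale n w = gale n u" unfolding w_def by (rule someI[of _ u]) (simp add: u)
    then have "a = vtx w" using vtx_eq u by simp
    then show "a \<in> (\<lambda>g. vtx (SOME u. u \<in> L \<and> gale n u = g)) ` (gale n ` L)" using u(1) unfolding w_def by blast
  qed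
  then show ?thesis using fin by (rule finite_subset[OF _ finite_imageI])
qed

lemma D_sub: "D \<subseteq> vtx ` L \<times> vtx ` L"
  using D_adj by fast

lemma neighbor_L: "neighbor n u w \<Longrightarrow> u \<in> L" "neighbor n u w \<Longrightarrow> w \<in> L"
  using neighbor_strip[OF n5] by blast+

lemma E_total: "neighbor n u w \<Longrightarrow> E u w \<noteq> E w u"
  using D_or[OF neighbor_L neighbor_gale_card[OF n5]] neighbor_sym[OF n5] unfolding E_def by blast

lemma D_neighbor:
  assumes "(vtx u, b) \<in> D" "u \<in> L"
  obtains w where "E u w" "b = vtx w"
proof -
  obtain u' w' where w: "u' \<in> L" "w' \<in> L" "vtx u = vtx u'" "b = vtx w'" "card (gale n u' \<inter> gale n w') = 3"
    using D_adj[OF assms(1)] by blast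
  then have "card (gale n u \<inter> gale n w') = 3" using vtx_eq[OF assms(2) w(1)] by simp
  then obtain v where v: "neighbor n u v" "gale n v = gale n w'" using card3_neighbor[OF n5 assms(2) w(2)] by blast
  then have "b = vtx v" using vtx_eq[OF neighbor_L(2)[OF v(1)] w(2)] w(4) by simp
  then show thesis using that[of v] v(1) assms(1) unfolding E_def by simp
qed

text \<open>In the 2-face of \<open>k\<close> and \<open>l\<close> the only neighbors of
  \<open>u\<close> are \<open>a\<close> and \<open>b\<close>: a third one would drop a third element
  of the Gale set, and the three dropped elements together with \<open>k\<close> and
  \<open>l\<close> would be five.\<close>

lemma face_sink_local:
  assumes ab: "neighbor n u a" "neighbor n u b" "a \<noteq> b" and k: "k \<noteq> l"
    "k \<in> gale n u" "l \<in> gale n u" "k \<in> gale n a" "l \<in> gale n a" "k \<in> gale n b" "l \<in> gale n b"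
    and E: "E a u" "E b u"
  shows "is_face_sink k l u"
proof -
  have u: "u \<in> L" using neighbor_L(1)[OF ab(1)] .
  have "(vtx u, vtx w) \<notin> D" if w: "w \<in> L" "k \<in> gale n w" "l \<in> gale n w" for w
  proof
    assume "(vtx u, vtx w) \<in> D"
    then obtain v where v: "E u v" "vtx w = vtx v" using D_neighbor u by blast
    then have vn: "neighbor n u v" unfolding E_def by blast
    have gv: "gale n v = gale n w" using vtx_eq[OF w(1) neighbor_L(2)[OF vn]] v(2) by simp
    obtain c where c: "c \<in> gale n u" "gale n u \<inter> gale n a = gale n u - {c}" using neighbor_drop[OF n5 ab(1)] by metis
    obtain d where d: "d \<in> gale n u" "gale n u \<inter> gale n b = gale n u - {d}" using neighbor_drop[OF n5 ab(2)] by metis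
    obtain e where e: "e \<in> gale n u" "gale n u \<inter> gale n v = gale n u - {e}" using neighbor_drop[OF n5 vn] by metis
    have "v \<noteq> a" "v \<noteq> b" using v(1) E E_total[OF ab(1)] E_total[OF ab(2)] by auto
    then have "c \<noteq> e" "d \<noteq> e" using neighbor_drops_distinct[OF n5 ab(1) vn _ c(2) e(2) c(1) e(1)]
        neighbor_drops_distinct[OF n5 ab(2) vn _ d(2) e(2) d(1) e(1)] by auto
    moreover have "c \<noteq> d" using neighbor_drops_distinct[OF n5 ab(1,2) _ c(2) d(2) c(1) d(1)] ab(3) by auto
    moreover have "k \<in> gale n u - {c}" "l \<in> gale n u - {c}" unfolding c(2)[symmetric] using k by auto
    moreover have "k \<in> gale n u - {d}" "l \<in> gale n u - {d}" unfolding d(2)[symmetric] using k by auto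
    moreover have "k \<in> gale n u - {e}" "l \<in> gale n u - {e}" unfolding e(2)[symmetric] using k gv w by auto
    ultimately have "card {c, d, e, k, l} = 5" "{c, d, e, k, l} \<subseteq> gale n u" using k(1) c(1) d(1) e(1) by auto
    then show False using card_mono[of "gale n u" "{c, d, e, k, l}"] gale_card(1)[OF n5 u] by (simp add: gale_def)
  qed
  then show ?thesis using u k unfolding is_face_sink_def by blast
qed

lemma face_sink_unique:
  assumes "is_face_sink k l u" "is_face_sink k l w" "k \<noteq> l" "k \<in> {0..<n}" "l \<in> {0..<n}"
  shows "gale n u = gale n w"
proof -
  have "vtx u = vtx w" using face_sink[OF assms(4,5,3)] assms(1,2) unfolding is_face_sink_def by blast
  then show ?thesis using vtx_eq assms(1,2) unfolding is_face_sink_def by blast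
qed

text \<open>The quadrangle lies in the 2-face of \<open>k\<close> and \<open>l\<close>, of which
  both \<open>u\<close> and \<open>d\<close> would be sinks.\<close>

lemma no_opposite_sinks:
  assumes "neighbor n u a" "neighbor n u b" "neighbor n a d" "neighbor n b d" "a \<noteq> b" "u \<noteq> d" "k \<noteq> l"
    "k \<in> {0..<n}" "l \<in> {0..<n}" "{k, l} \<subseteq> gale n u \<inter> gale n a \<inter> gale n b \<inter> gale n d"
    and E: "E a u" "E b u" "E a d" "E b d"
  shows False
proof -
  have "is_face_sink k l u" using face_sink_local[OF assms(1,2,5,7)] assms(10) E by auto
  moreover have "is_face_sink k l d"
    using face_sink_local[OF neighbor_sym[OF n5 assms(3)] neighbor_sym[OF n5 assms(4)] assms(5,7)] assms(10) E by auto
  ultimately have "gale n u = gale n d" using face_sink_unique assms(7-9) by blast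
  then show False using neighbors_gale_ne[OF n5 neighbor_sym[OF n5 assms(1)] assms(3)] assms(6) by auto
qed

lemma chain_E: "E (chain n i k) (chain n i (k + 1)) \<noteq> E (chain n i (k + 1)) (chain n i k)"
  by (rule E_total[OF chain_neighbor(1)[OF n5]])

lemma chain_face:
  "is_face_sink (i mod n) ((i + 1) mod n) (chain n i k) \<longleftrightarrow>
    E (chain n i (k - 1)) (chain n i k) \<and> E (chain n i (k + 1)) (chain n i k)"
proof
  note nb = chain_neighbor[OF n5, of i k]
  have L: "chain n i j \<in> L" for j by (rule chain_in_strip[OF n5])
  {
    assume "is_face_sink (i mod n) ((i + 1) mod n) (chain n i k)"
    then have "\<not> E (chain n i k) (chain n i j)" for j
      using chain_gale[OF n5] L unfolding is_face_sink_def E_def by blast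
    then show "E (chain n i (k - 1)) (chain n i k) \<and> E (chain n i (k + 1)) (chain n i k)"
      using E_total[OF nb(1)] E_total[OF nb(2)] by blast
  }
  assume E: "E (chain n i (k - 1)) (chain n i k) \<and> E (chain n i (k + 1)) (chain n i k)"
  have "chain n i (k + 1) \<noteq> chain n i (k - 1)" using chain_inj[OF n5, of i "k + 1" "k - 1"] by auto
  moreover have "i mod n \<noteq> (i + 1) mod n" using mod_near[of n i "i + 1"] n5 by simp
  ultimately show "is_face_sink (i mod n) ((i + 1) mod n) (chain n i k)"
    using face_sink_local[OF nb] chain_gale[OF n5] E by blast
qed

lemma chain_sink_ex: "\<exists>K. \<forall>k. E (chain n i (k - 1)) (chain n i k) \<and> E (chain n i (k + 1)) (chain n i k)
        \<longleftrightarrow> (n - 2) dvd (k - K)"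
proof -
  let ?k = "i mod n" and ?l = "(i + 1) mod n"
  have kl: "?k \<in> {0..<n}" "?l \<in> {0..<n}" "?k \<noteq> ?l" using mod_near[of n i "i + 1"] n5 by auto
  obtain u where u: "is_face_sink ?k ?l u" using face_sink[OF kl] unfolding is_face_sink_def by blast
  then obtain K where K: "gale n (chain n i K) = gale n u" using gale_chain[OF n5] unfolding is_face_sink_def by blast
  have "is_face_sink ?k ?l (chain n i k) \<longleftrightarrow> (n - 2) dvd (k - K)" for k
  proof
    assume "is_face_sink ?k ?l (chain n i k)"
    then have "gale n (chain n i k) = gale n (chain n i K)" using face_sink_unique[OF _ u kl(3,1,2)] K by simp
    then show "(n - 2) dvd (k - K)" using chain_orbit[OF n5] by blast
  next
    assume "(n - 2) dvd (k - K)"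
    then have "gale n (chain n i k) = gale n u" using chain_orbit[OF n5] K by blast
    moreover have "chain n i k \<in> L" by (rule chain_in_strip[OF n5])
    moreover then have "vtx (chain n i k) = vtx u" using calculation vtx_eq u unfolding is_face_sink_def by blast
    ultimately show "is_face_sink ?k ?l (chain n i k)" using u unfolding is_face_sink_def by simp
  qed
  then show ?thesis unfolding chain_face by blast
qed

lemma E_deck: "E (deck n u) (deck n w) \<longleftrightarrow> E u w"
proof -
  have nb: "neighbor n (deck n u) (deck n w) \<longleftrightarrow> neighbor n u w"
  proof -
    have inj: "deck n a = deck n b \<longleftrightarrow> a = b" for a b by (cases a; cases b) (auto simp: deck_def)
    have "(\<exists>s\<in>{1, -1}. deck n w = mv1 n s (deck n u) \<or> deck n w = mv2 n s (deck n u)) \<longleftrightarrow>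
      (\<exists>s\<in>{1, -1}. w = mv1 n s u \<or> w = mv2 n s u)"
      by (rule bex_cong[OF refl]) (auto simp: mv_deck inj)
    then show ?thesis unfolding neighbor_def deck_strip by blast
  qed
  have "vtx (deck n a) = vtx a" if "a \<in> L" for a
    using vtx_eq[of "deck n a" a] that by (simp add: deck_strip gale_deck)
  then show ?thesis using neighbor_L[of u w] unfolding E_def nb by (cases "neighbor n u w") simp_all
qed

lemma chain_source_ex: "\<exists>K. \<forall>k. E (chain n i k) (chain n i (k - 1)) \<and> E (chain n i k) (chain n i (k + 1))
        \<longleftrightarrow> (n - 2) dvd (k - K)"
proof -
  obtain K where K: "\<And>k. E (chain n i (k - 1)) (chain n i k) \<and> E (chain n i (k + 1)) (chain n i k)
        \<longleftrightarrow> (n - 2) dvd (k - K)" using chain_sink_ex by blast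
  define up where "up k = E (chain n i k) (chain n i (k + 1))" for k
  have e: "E (chain n i (k + 1)) (chain n i k) \<longleftrightarrow> \<not> up k" "E (chain n i (k - 1)) (chain n i k) \<longleftrightarrow> up (k - 1)"
    "E (chain n i k) (chain n i (k - 1)) \<longleftrightarrow> \<not> up (k - 1)" for k
    using chain_E[of i k] chain_E[of i "k - 1"] unfolding up_def by auto
  have "up (k + (n - 2)) = up k" for k
    using E_deck[of "chain n i k" "chain n i (k + 1)"] chain_deck[OF n5, of i k] chain_deck[OF n5, of i "k + 1"]
    unfolding up_def by (simp add: algebra_simps)
  then show ?thesis using unique_up_start[of "n - 2" up K] K n5 unfolding e up_def[symmetric] by simp
qed

text \<open>A height that depends on the vertex alone, hence is the same for all its lifts; it falls
  along arcs by acyclicity.\<close>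

definition rank :: "int \<times> int \<Rightarrow> int" where "rank u = int (card {b. (vtx u, b) \<in> D\<^sup>+})"

lemma succ_finite: "finite {b. (a, b) \<in> D\<^sup>+}" "{b. (a, b) \<in> D\<^sup>+} \<subseteq> vtx ` L"
proof -
  show s: "{b. (a, b) \<in> D\<^sup>+} \<subseteq> vtx ` L" using trancl_subset_Sigma[OF D_sub] by blast
  show "finite {b. (a, b) \<in> D\<^sup>+}" by (rule finite_subset[OF s finite_vtx])
qed

lemma rank_less: assumes "(vtx u, vtx w) \<in> D" shows "rank w < rank u"
proof -
  have "{b. (vtx w, b) \<in> D\<^sup>+} \<subset> {b. (vtx u, b) \<in> D\<^sup>+}"
    using assms D_acyclic unfolding acyclic_def by (auto intro: trancl_into_trancl2)
  then show ?thesis unfolding rank_def using psubset_card_mono[OF succ_finite(1)] by simp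
qed

text \<open>Two arcs at a vertex span a triangle, a quadrangle or a piece of a chain. In the first
  two cases their other ends have a common descendant, respectively ancestor, and this is what
  \<open>fork\<close> and \<open>cofork\<close> ask for.\<close>

sublocale strip n E rank "int (card (vtx ` L))"
proof (rule strip.intro)
  show "n \<ge> 5" by (rule n5)
  show "E u w \<Longrightarrow> u \<in> L \<and> (\<exists>s\<in>{1, -1}. w = mv1 n s u \<or> w = mv2 n s u)" for u w
    unfolding E_def neighbor_def by blast
  show "u \<in> L \<Longrightarrow> s \<in> {1, - 1} \<Longrightarrow> w = mv1 n s u \<or> w = mv2 n s u \<Longrightarrow> E u w \<noteq> E w u" for u s w
    by (rule E_total) (auto simp: neighbor_def)
  show "E (deck n u) (deck n w) = E u w" for u w by (rule E_deck)
  show "u \<in> L \<Longrightarrow> rank (deck n u) = rank u" for u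
    using vtx_eq[of "deck n u" u] unfolding rank_def by (simp add: deck_strip gale_deck)
  show "E u w \<Longrightarrow> rank w < rank u" for u w using rank_less unfolding E_def by blast
  show "u \<in> L \<Longrightarrow> 0 \<le> rank u \<and> rank u \<le> int (card (vtx ` L))" for u
    using card_mono[OF finite_vtx succ_finite(2)] unfolding rank_def by simp
  show "\<exists>K. \<forall>k. (E (chain n i (k - 1)) (chain n i k) \<and> E (chain n i (k + 1)) (chain n i k)) = (n - 2 dvd k - K)" for i
    by (rule chain_sink_ex)
  show "\<exists>K. \<forall>k. (E (chain n i k) (chain n i (k - 1)) \<and> E (chain n i k) (chain n i (k + 1))) = (n - 2 dvd k - K)" for i
    by (rule chain_source_ex)
  fix u v w
  {
    assume E: "E u v" "E u w"
    show "(\<exists>c. E\<^sup>*\<^sup>* v c \<and> E\<^sup>*\<^sup>* w c) \<or>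
       (\<exists>i k. u = chain n i k \<and> E (chain n i k) (chain n i (k - 1)) \<and> E (chain n i k) (chain n i (k + 1)))"
    proof (cases "v = w")
      case False
      have nb: "neighbor n u v" "neighbor n u w" using E unfolding E_def by blast+
      from neighbor_pair[OF n5 nb False] show ?thesis
      proof (elim disjE exE conjE)
        assume "neighbor n v w"
        then have "E v w \<or> E w v" using E_total by blast
        then show ?thesis by blast
      next
        fix d k l
        assume sq: "d \<noteq> u" "neighbor n v d" "neighbor n w d" "k \<noteq> l" "k \<in> {0..<n}" "l \<in> {0..<n}"
          "{k, l} \<subseteq> gale n u \<inter> gale n v \<inter> gale n w \<inter> gale n d"
        \<comment> \<open>Otherwise \<open>v\<close> and \<open>w\<close> would be two sinks of the
          quadrangle.\<close>
        have "\<not> (E d v \<and> E d w)"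
          using no_opposite_sinks[OF neighbor_sym[OF n5 nb(1)] sq(2) nb(2) neighbor_sym[OF n5 sq(3)], of k l]
            sq False E by auto
        then consider "E v d" "E w d" | "E v d" "E d w" | "E d v" "E w d"
          using E_total[OF sq(2)] E_total[OF sq(3)] by blast
        then have "\<exists>c. E\<^sup>*\<^sup>* v c \<and> E\<^sup>*\<^sup>* w c" 
          by cases (meson r_into_rtranclp rtranclp.rtrancl_refl rtranclp_trans)+
        then show ?thesis ..
      next
        fix i k assume "u = chain n i k" "{v, w} = {chain n i (k - 1), chain n i (k + 1)}"
        then show ?thesis using E by (metis doubleton_eq_iff)
      qed
    qed blast
  }
  {
    assume E: "E v u" "E w u"
    show "(\<exists>c. E\<^sup>*\<^sup>* c v \<and> E\<^sup>*\<^sup>* c w) \<or>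
       (\<exists>i k. u = chain n i k \<and> E (chain n i (k - 1)) (chain n i k) \<and> E (chain n i (k + 1)) (chain n i k))"
    proof (cases "v = w")
      case False
      have nb: "neighbor n u v" "neighbor n u w" using E neighbor_sym[OF n5] unfolding E_def by blast+
      from neighbor_pair[OF n5 nb False] show ?thesis
      proof (elim disjE exE conjE)
        assume "neighbor n v w"
        then have "E v w \<or> E w v" using E_total by blast
        then show ?thesis by blast
      next
        fix d k l
        assume sq: "d \<noteq> u" "neighbor n v d" "neighbor n w d" "k \<noteq> l" "k \<in> {0..<n}" "l \<in> {0..<n}"
          "{k, l} \<subseteq> gale n u \<inter> gale n v \<inter> gale n w \<inter> gale n d"
        have "\<not> (E v d \<and> E w d)"
          using no_opposite_sinks[OF nb sq(2,3) False, of k l] sq E by auto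
        then consider "E d v" "E d w" | "E v d" "E d w" | "E d v" "E w d"
          using E_total[OF sq(2)] E_total[OF sq(3)] by blast
        then have "\<exists>c. E\<^sup>*\<^sup>* c v \<and> E\<^sup>*\<^sup>* c w" 
          by cases (meson r_into_rtranclp rtranclp.rtrancl_refl rtranclp_trans)+
        then show ?thesis ..
      next
        fix i k assume "u = chain n i k" "{v, w} = {chain n i (k - 1), chain n i (k + 1)}"
        then show ?thesis using E by (metis doubleton_eq_iff)
      qed
    qed blast
  }
qed

end

section \<open>Counting bad vertices and bounding the expectation\<close>

context cyclic_auso
begin

definition bad :: "'a set" where
  "bad = vtx ` {u \<in> L. \<forall>s1 s2. \<not> straight n E u s1 s2}"

text \<open>\<open>T\<close> stands for the pattern of a sink or of a source. Reducing
  \<open>j\<close> modulo \<open>n\<close> only reindexes the chain, and one period contains the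
  pattern once, so each polygon contributes a single vertex.\<close>

lemma vtx_chain_exceptional:
  assumes K: "\<And>i k. T (chain n i (k - 1)) (chain n i k) (chain n i (k + 1)) \<longleftrightarrow> (n - 2) dvd (k - K i)"
    and T: "T (chain n j (k - 1)) (chain n j k) (chain n j (k + 1))"
  shows "vtx (chain n j k) = vtx (chain n (j mod n) (K (j mod n)))"
proof -
  define m where "m = j div n * (2 * (n - 2))"
  have c: "chain n j l = chain n (j mod n) (l + m)" for l
    using chain_shift[OF n5, of "j mod n" "j div n" l] unfolding m_def by simp
  have "(n - 2) dvd (k + m - K (j mod n))"
    using T unfolding c K[symmetric] by (simp add: algebra_simps)
  then show ?thesis
    unfolding c using vtx_eq[OF chain_in_strip[OF n5] chain_in_strip[OF n5]] chain_orbit[OF n5] by blast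
qed

text \<open>\<open>deck\<close> exchanges the two boundaries of the strip; both consist of the sets
  of four consecutive facets.\<close>

lemma vtx_boundary:
  assumes u: "u \<in> L" "snd u = fst u + 2 \<or> snd u = fst u + n - 2"
  shows "\<exists>i\<in>{0..<n}. vtx u = vtx (i, i + 2)"
proof -
  have b: "vtx (x, x + 2) = vtx (x mod n, x mod n + 2)" for x
  proof -
    have "gale n (x, x + 2) = gale n (x mod n, x mod n + 2)"
      unfolding gale_def by (simp add: mod_simps add.assoc)
    then show ?thesis using vtx_eq n5 by (simp add: strip_points_def)
  qed
  have "x mod n \<in> {0..<n}" for x using n5 by simp
  moreover have "\<exists>x. vtx u = vtx (x, x + 2)"
    using u(2)
  proof
    assume "snd u = fst u + 2"
    then show ?thesis by (metis prod.collapse)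
  next
    assume "snd u = fst u + n - 2"
    then have d: "u = deck n (snd u - n, snd u - n + 2)" by (simp add: deck_def prod_eq_iff)
    moreover have "(snd u - n, snd u - n + 2) \<in> L" using n5 by (simp add: strip_points_def)
    ultimately have "gale n u = gale n (snd u - n, snd u - n + 2)" "(snd u - n, snd u - n + 2) \<in> L"
      using gale_deck by metis+
    then show ?thesis using vtx_eq[OF u(1)] by blast
  qed
  ultimately show ?thesis using b by metis
qed

lemma card_bad: "finite bad" "card bad \<le> nat (3 * n)"
proof -
  show fin: "finite bad" unfolding bad_def by (rule finite_subset[OF _ finite_vtx]) auto
  obtain K where K: "\<And>i k. E (chain n i (k - 1)) (chain n i k) \<and> E (chain n i (k + 1)) (chain n i k)
        \<longleftrightarrow> (n - 2) dvd (k - K i)" using chain_sink_ex by metis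
  obtain J where J: "\<And>i k. E (chain n i k) (chain n i (k - 1)) \<and> E (chain n i k) (chain n i (k + 1))
        \<longleftrightarrow> (n - 2) dvd (k - J i)" using chain_source_ex by metis
  define A where "A i = {vtx (i, i + 2), vtx (chain n i (K i)), vtx (chain n i (J i))}" for i
  have "bad \<subseteq> (\<Union>i\<in>{0..<n}. A i)"
  proof
    fix a assume "a \<in> bad"
    then obtain u where u: "u \<in> L" "\<And>s1 s2. \<not> straight n E u s1 s2" "a = vtx u" unfolding bad_def by blast
    have mn: "x mod n \<in> {0..<n}" for x using n5 by simp
    \<comment> \<open>Two chain arcs that are both outgoing or both incoming make \<open>u\<close>
      the source or the sink of that chain.\<close>
    have exc: "a \<in> (\<Union>i\<in>{0..<n}. A i)" if c: "chain n j k = u"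
      and T: "E u (chain n j (k - 1)) = E u (chain n j (k + 1))" for j k
    proof -
      have "E u (chain n j (k - 1)) \<noteq> E (chain n j (k - 1)) u" "E u (chain n j (k + 1)) \<noteq> E (chain n j (k + 1)) u"
        using chain_E[of j k] chain_E[of j "k - 1"] c by auto
      then have "a = vtx (chain n (j mod n) (K (j mod n))) \<or> a = vtx (chain n (j mod n) (J (j mod n)))"
        using T vtx_chain_exceptional[of "\<lambda>a b c. E a b \<and> E c b" K, OF K, of j k]
          vtx_chain_exceptional[of "\<lambda>a b c. E b a \<and> E b c" J, OF J, of j k] unfolding c u(3) by blast
      then show ?thesis using mn unfolding A_def by blast
    qed
    obtain x y where xy: "u = (x, y)" by (cases u)
    show "a \<in> (\<Union>i\<in>{0..<n}. A i)"
    proof (cases "y = x + 2 \<or> y = x + n - 2")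
      case True
      then show ?thesis using vtx_boundary[OF u(1)] u(3) xy unfolding A_def by auto
    next
      case False
      then have "x + 3 \<le> y" "y \<le> x + n - 3" using u(1) xy by (auto simp: strip_points_def)
      then have "E u (mv1 n (-1) u) = E u (mv1 n 1 u) \<or> E u (mv2 n (-1) u) = E u (mv2 n 1 u)"
        using u(2)[of 1 1] u(2)[of 1 "-1"] u(2)[of "-1" 1] u(2)[of "-1" "-1"] xy unfolding straight_def by auto
      then show ?thesis
      proof
        assume "E u (mv1 n (-1) u) = E u (mv1 n 1 u)"
        then show ?thesis using exc[of y "x - y + 1"] chain_row[OF n5, of x y 1] chain_row[OF n5, of x y "-1"] u(1) xy by simp
      next
        assume "E u (mv2 n (-1) u) = E u (mv2 n 1 u)"
        then show ?thesis using exc[of x "y - x - 1"] chain_col[OF n5, of x y 1] chain_col[OF n5, of x y "-1"] u(1) xy by simp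
      qed
    qed
  qed
  then have "card bad \<le> card (\<Union>i\<in>{0..<n}. A i)" by (rule card_mono[rotated]) (simp add: A_def)
  also have "\<dots> \<le> (\<Sum>i\<in>{0..<n}. card (A i))" by (rule card_UN_le) simp
  also have "\<dots> \<le> (\<Sum>i\<in>{0..<n}. 3)" by (rule sum_mono) (auto simp: A_def card_insert_if)
  also have "\<dots> = nat (3 * n)" using n5 by (simp add: nat_mult_distrib)
  finally show "card bad \<le> nat (3 * n)" .
qed

lemma potential_ex:
  "\<exists>\<Phi> :: int \<times> int \<Rightarrow> int. (\<forall>u\<in>L. 0 \<le> \<Phi> u \<and> \<Phi> u \<le> 60 * n + 34) \<and>
    (\<forall>u s1 s2. straight n E u s1 s2 \<longrightarrow> \<Phi> (mv1 n s1 u) + \<Phi> (mv2 n s2 u) \<le> 2 * \<Phi> u - 2) \<and>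
    (\<forall>u w. E u w \<longrightarrow> (\<forall>s1 s2. \<not> straight n E u s1 s2) \<longrightarrow> \<Phi> w \<le> \<Phi> u - 1)"
proof -
  \<comment> \<open>With the reflexive closure the current vertex is counted too, and by acyclicity
    it is lost on leaving it.\<close>
  define \<beta> where "\<beta> u = int (card (bad \<inter> {b. (vtx u, b) \<in> D\<^sup>*}))" for u
  have b: "0 \<le> \<beta> u \<and> \<beta> u \<le> 3 * n" for u
  proof -
    have "card (bad \<inter> {b. (vtx u, b) \<in> D\<^sup>*}) \<le> card bad" by (rule card_mono[OF card_bad(1)]) simp
    then show ?thesis using card_bad(2) n5 unfolding \<beta>_def by linarith
  qed
  have sub: "bad \<inter> {b. (vtx w, b) \<in> D\<^sup>*} \<subseteq> bad \<inter> {b. (vtx u, b) \<in> D\<^sup>*}" if "E u w" for u w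
    using that unfolding E_def by (auto intro: converse_rtrancl_into_rtrancl)
  have mono: "\<beta> w \<le> \<beta> u" if "E u w" for u w
    unfolding \<beta>_def using card_mono[OF _ sub[OF that]] card_bad(1) by simp
  have drop: "\<beta> w \<le> \<beta> u - 1" if uw: "E u w" and ns: "\<And>s1 s2. \<not> straight n E u s1 s2" for u w
  proof -
    have "vtx u \<in> bad" using ns neighbor_L uw unfolding bad_def E_def by blast
    then have "vtx u \<in> bad \<inter> {b. (vtx u, b) \<in> D\<^sup>*}" by simp
    moreover have "vtx u \<notin> bad \<inter> {b. (vtx w, b) \<in> D\<^sup>*}"
    proof
      assume "vtx u \<in> bad \<inter> {b. (vtx w, b) \<in> D\<^sup>*}"
      then have "(vtx u, vtx u) \<in> D\<^sup>+" using uw rtrancl_into_trancl2[of "vtx u" "vtx w" D "vtx u"] unfolding E_def by simp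
      then show False using D_acyclic unfolding acyclic_def by simp
    qed
    ultimately have "bad \<inter> {b. (vtx w, b) \<in> D\<^sup>*} \<noteq> bad \<inter> {b. (vtx u, b) \<in> D\<^sup>*}" by metis
    then have "bad \<inter> {b. (vtx w, b) \<in> D\<^sup>*} \<subset> bad \<inter> {b. (vtx u, b) \<in> D\<^sup>*}" using sub[OF uw] by (simp add: psubset_eq)
    then have "card (bad \<inter> {b. (vtx w, b) \<in> D\<^sup>*}) < card (bad \<inter> {b. (vtx u, b) \<in> D\<^sup>*})"
      by (rule psubset_card_mono[rotated]) (simp add: card_bad(1))
    then show ?thesis unfolding \<beta>_def by simp
  qed
  show ?thesis
  \<comment> \<open>With \<open>B = 3 n\<close> the bound becomes 24 n + 36 n + 34.\<close>
  proof (rule potential[of \<beta> "3 * n"])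
    fix \<Phi> :: "int \<times> int \<Rightarrow> int"
    assume p1: "\<And>u. u \<in> L \<Longrightarrow> 0 \<le> \<Phi> u \<and> \<Phi> u \<le> 24 * n + 12 * (3 * n) + 34"
      and p2: "\<And>u s1 s2. straight n E u s1 s2 \<Longrightarrow> \<Phi> (mv1 n s1 u) + \<Phi> (mv2 n s2 u) \<le> 2 * \<Phi> u - 2"
      and p3: "\<And>u w. E u w \<Longrightarrow> (\<And>s1 s2. \<not> straight n E u s1 s2) \<Longrightarrow> \<Phi> w \<le> \<Phi> u - 1"
    show ?thesis
      by (rule exI[of _ \<Phi>], intro conjI ballI allI impI) (use p1 p2 p3 in \<open>force+\<close>)
  qed (use b mono drop in blast)+
qed

lemma out_vtx: "u \<in> L \<Longrightarrow> {b. (vtx u, b) \<in> D} = vtx ` {w. E u w}"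
  using D_neighbor unfolding E_def by blast

text \<open>\<open>h\<close> will be the expected number of pivot steps. Induction on
  \<open>rank\<close> compares it with the potential; as \<open>h\<close> takes values in
  \<open>ennreal\<close>, this also shows that it is finite.\<close>

lemma expected_steps_le:
  fixes h :: "'a \<Rightarrow> ennreal"
  assumes h0: "\<And>a. a \<in> vtx ` L \<Longrightarrow> {b. (a, b) \<in> D} = {} \<Longrightarrow> h a = 0"
    and h1: "\<And>a. a \<in> vtx ` L \<Longrightarrow> {b. (a, b) \<in> D} \<noteq> {} \<Longrightarrow>
      h a \<le> (\<Sum>b\<in>{b. (a, b) \<in> D}. 1 + h b) / of_nat (card {b. (a, b) \<in> D})"
    and u: "u \<in> L"
  shows "h (vtx u) \<le> ennreal (of_int (60 * n + 34))"
proof -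
  obtain \<Phi> :: "int \<times> int \<Rightarrow> int" where "(\<forall>u\<in>L. 0 \<le> \<Phi> u \<and> \<Phi> u \<le> 60 * n + 34) \<and>
    (\<forall>u s1 s2. straight n E u s1 s2 \<longrightarrow> \<Phi> (mv1 n s1 u) + \<Phi> (mv2 n s2 u) \<le> 2 * \<Phi> u - 2) \<and>
    (\<forall>u w. E u w \<longrightarrow> (\<forall>s1 s2. \<not> straight n E u s1 s2) \<longrightarrow> \<Phi> w \<le> \<Phi> u - 1)"
    using potential_ex ..
  then have \<Phi>: "\<And>u. u \<in> L \<Longrightarrow> 0 \<le> \<Phi> u \<and> \<Phi> u \<le> 60 * n + 34"
    and st: "\<And>u s1 s2. straight n E u s1 s2 \<Longrightarrow> \<Phi> (mv1 n s1 u) + \<Phi> (mv2 n s2 u) \<le> 2 * \<Phi> u - 2"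
    and ns: "\<And>u w. E u w \<Longrightarrow> \<forall>s1 s2. \<not> straight n E u s1 s2 \<Longrightarrow> \<Phi> w \<le> \<Phi> u - 1"
    by blast+
  have "h (vtx u) \<le> ennreal (of_int (\<Phi> u))" using u
  proof (induction "nat (rank u)" arbitrary: u rule: less_induct)
    case less
    define S where "S = {b. (vtx u, b) \<in> D}"
    have S: "S = vtx ` {w. E u w}" unfolding S_def by (rule out_vtx[OF less.prems])
    have IH: "h (vtx w) \<le> ennreal (of_int (\<Phi> w))" "0 \<le> \<Phi> w" if "E u w" for w
    proof -
      have "w \<in> L" using that neighbor_L unfolding E_def by blast
      moreover have "rank w < rank u" "0 \<le> rank w" using that rank_less unfolding E_def rank_def by auto
      ultimately show "h (vtx w) \<le> ennreal (of_int (\<Phi> w))" "0 \<le> \<Phi> w" using less.hyps[of w] \<Phi> by auto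
    qed
    show ?case
    proof (cases "S = {}")
      case True
      then show ?thesis using h0[of "vtx u"] less.prems unfolding S_def by simp
    next
      case False
      have hS: "h (vtx u) \<le> (\<Sum>b\<in>S. 1 + h b) / of_nat (card S)"
        using h1[of "vtx u"] less.prems False unfolding S_def by simp
      have finS: "finite S" unfolding S_def by (rule finite_subset[OF _ finite_vtx]) (use D_sub in auto)
      have c0: "card S > 0" using finS False by (simp add: card_gt_0_iff)
      have "(\<Sum>b\<in>S. 1 + h b) \<le> ennreal (of_int (\<Phi> u)) * of_nat (card S)"
      proof (cases "\<exists>s1 s2. straight n E u s1 s2")
        case True
        then obtain s1 s2 where s: "straight n E u s1 s2" by blast
        let ?v = "mv1 n s1 u" and ?w = "mv2 n s2 u"
        have E: "E u ?v" "E u ?w" using straight_out[OF s] by blast+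
        have "?v \<noteq> ?w" using s unfolding straight_moves[OF s] straight_def by auto
        then have "vtx ?v \<noteq> vtx ?w"
          using neighbors_gale_ne[OF n5, of u ?w ?v] E vtx_eq neighbor_L unfolding E_def by blast
        moreover have "{w. E u w} = {?v, ?w}" using straight_out[OF s] by blast
        then have Svw: "S = {vtx ?v, vtx ?w}" unfolding S by simp
        ultimately have "(\<Sum>b\<in>S. 1 + h b) = (1 + h (vtx ?v)) + (1 + h (vtx ?w))" "card S = 2" by auto
        moreover have "(1 + h (vtx ?v)) + (1 + h (vtx ?w))
            \<le> (1 + ennreal (of_int (\<Phi> ?v))) + (1 + ennreal (of_int (\<Phi> ?w)))"
          using IH E by (intro add_mono) auto
        moreover have "\<dots> = ennreal (of_int (2 + \<Phi> ?v + \<Phi> ?w))"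
          using IH(2)[OF E(1)] IH(2)[OF E(2)] by (simp flip: ennreal_plus ennreal_1)
        moreover have "\<dots> \<le> ennreal (of_int (\<Phi> u) * 2)" using st[OF s] by (intro ennreal_leI) linarith
        moreover have "\<dots> = ennreal (of_int (\<Phi> u)) * 2" by (simp add: ennreal_mult'')
        ultimately show ?thesis by simp
      next
        case False
        \<comment> \<open>Every successor is lower by at least 1 here, so the bound holds term by
          term, whatever the number of arcs.\<close>
        have "1 + h b \<le> ennreal (of_int (\<Phi> u))" if bS: "b \<in> S" for b
        proof -
          obtain w where w: "E u w" "b = vtx w" using bS S by blast
          have "1 + h b \<le> 1 + ennreal (of_int (\<Phi> w))" using IH(1)[OF w(1)] w(2) by (intro add_mono) auto
          also have "\<dots> = ennreal (of_int (1 + \<Phi> w))" using IH(2)[OF w(1)] by (simp flip: ennreal_plus ennreal_1)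
          also have "\<dots> \<le> ennreal (of_int (\<Phi> u))" using ns[OF w(1)] False by (intro ennreal_leI) force
          finally show ?thesis .
        qed
        then have "(\<Sum>b\<in>S. 1 + h b) \<le> of_nat (card S) * ennreal (of_int (\<Phi> u))" by (intro sum_bounded_above)
        then show ?thesis by (simp add: mult.commute)
      qed
      then have "(\<Sum>b\<in>S. 1 + h b) / of_nat (card S) \<le> ennreal (of_int (\<Phi> u)) * of_nat (card S) / of_nat (card S)"
        by (rule divide_right_mono_ennreal)
      also have "\<dots> = ennreal (of_int (\<Phi> u))"
        using c0 by (simp add: ennreal_mult_divide_eq)
      finally show ?thesis using hS by simp
    qed
  qed
  also have "\<dots> \<le> ennreal (of_int (60 * n + 34))" using \<Phi>[OF u] by (intro ennreal_leI) simp
  finally show ?thesis .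
qed

end

section \<open>Vertices of the polar\<close>

text \<open>A point \<open>y\<close> is encoded by the polynomial of degree at most 4 whose values at the nodes are the
  slacks of the inequalities defining the polar; these are the polynomials with \<open>moment_eval c\<close> equal to 1.\<close>

definition moment_poly :: "real ^ 4 \<Rightarrow> real ^ 4 \<Rightarrow> real poly" where
  "moment_poly c y = [:1 + c \<bullet> y, - y $ 1, - y $ 2, - y $ 3, - y $ 4:]"

text \<open>The value at \<open>c\<close> of the affine function which for a polynomial
  \<open>p\<close> of degree at most 4 equals \<open>poly p t\<close> at
  \<open>moment_point t\<close>. The slack at the centre of polarity is 1, which explains the
  normalisation.\<close>

definition moment_eval :: "real ^ 4 \<Rightarrow> real poly \<Rightarrow> real" where
  "moment_eval c p = coeff p 0 + coeff p 1 * c $ 1 + coeff p 2 * c $ 2 + coeff p 3 * c $ 3 + coeff p 4 * c $ 4"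

definition tight_set :: "nat \<Rightarrow> real ^ 4 \<Rightarrow> real ^ 4 \<Rightarrow> int set" where
  "tight_set n c y = {k \<in> {0..<int n}. poly (moment_poly c y) (of_int k) = 0}"

lemma inner_vec_4: "(x :: real ^ 4) \<bullet> y = x $ 1 * y $ 1 + x $ 2 * y $ 2 + x $ 3 * y $ 3 + x $ 4 * y $ 4"
  by (simp add: inner_vec_def sum_4)

lemma vector_4:
  fixes a b c d :: "'a::zero"
  shows "(vector [a, b, c, d] :: 'a ^ 4) $ 1 = a" "(vector [a, b, c, d] :: 'a ^ 4) $ 2 = b"
    "(vector [a, b, c, d] :: 'a ^ 4) $ 3 = c" "(vector [a, b, c, d] :: 'a ^ 4) $ 4 = d"
  unfolding vector_def by simp_all

lemma moment_point_nth: "moment_point t $ 1 = t" "moment_point t $ 2 = t ^ 2" "moment_point t $ 3 = t ^ 3" "moment_point t $ 4 = t ^ 4"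
  unfolding moment_point_def by (rule vector_4)+

lemma poly_moment_poly: "poly (moment_poly c y) t = 1 - (moment_point t - c) \<bullet> y"
  unfolding moment_poly_def inner_diff_left inner_vec_4
  by (simp only: vector_minus_component moment_point_nth) (simp add: algebra_simps eval_nat_numeral)

lemma degree_moment_poly: "degree (moment_poly c y) \<le> 4"
  unfolding moment_poly_def by (rule degree_le) (auto simp: coeff_pCons split: nat.splits)

lemma coeff_moment_poly: "coeff (moment_poly c y) 0 = 1 + c \<bullet> y" "coeff (moment_poly c y) 1 = - y $ 1"
  "coeff (moment_poly c y) 2 = - y $ 2" "coeff (moment_poly c y) 3 = - y $ 3" "coeff (moment_poly c y) 4 = - y $ 4"
  unfolding moment_poly_def by (simp_all add: coeff_pCons eval_nat_numeral)

lemma moment_eval_moment_poly: "moment_eval c (moment_poly c y) = 1"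
  unfolding moment_eval_def coeff_moment_poly inner_vec_4 by simp

lemma moment_eval_add: "moment_eval c (p + q) = moment_eval c p + moment_eval c q"
  by (simp add: moment_eval_def algebra_simps)

lemma moment_eval_smult: "moment_eval c (smult a p) = a * moment_eval c p"
  by (simp add: moment_eval_def algebra_simps)

lemma moment_poly_inj: "moment_poly c y = moment_poly c z \<Longrightarrow> y = z"
  by (simp add: moment_poly_def vec_eq_iff forall_4)

lemma poly_eq_le4: fixes p :: "real poly" assumes "degree p \<le> 4"
  shows "p = [:coeff p 0, coeff p 1, coeff p 2, coeff p 3, coeff p 4:]"
proof (rule poly_eqI)
  fix k
  show "coeff p k = coeff [:coeff p 0, coeff p 1, coeff p 2, coeff p 3, coeff p 4:] k"
  proof (cases "k \<le> 4")
    case True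
    then have "k = 0 \<or> k = 1 \<or> k = 2 \<or> k = 3 \<or> k = 4" by linarith
    then show ?thesis by (elim disjE) (simp_all add: coeff_pCons eval_nat_numeral)
  next
    case False
    then obtain m where "k = Suc (Suc (Suc (Suc (Suc m))))"
      using le_Suc_ex[of 5 k] by (auto simp: eval_nat_numeral)
    then show ?thesis using coeff_eq_0[of p k] assms by simp
  qed
qed

lemma moment_poly_ex:
  assumes "degree p \<le> 4" "moment_eval c p = 1"
  obtains y where "moment_poly c y = p"
proof
  define y :: "real ^ 4" where "y = vector [- coeff p 1, - coeff p 2, - coeff p 3, - coeff p 4]"
  have y: "y $ 1 = - coeff p 1" "y $ 2 = - coeff p 2" "y $ 3 = - coeff p 3" "y $ 4 = - coeff p 4"
    unfolding y_def by (rule vector_4)+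
  have "1 + c \<bullet> y = coeff p 0" using assms(2) unfolding inner_vec_4 y moment_eval_def by (simp add: algebra_simps)
  then show "moment_poly c y = p" unfolding moment_poly_def y using poly_eq_le4[OF assms(1)] by simp
qed

text \<open>The kernel of \<open>moment_eval c\<close> is the direction space of the affine space of
  slack polynomials.\<close>

lemma moment_poly_direction:
  assumes "degree d \<le> 4" "moment_eval c d = 0" "d \<noteq> 0"
  obtains z where "z \<noteq> 0" "\<And>y e. moment_poly c (y + e *\<^sub>R z) = moment_poly c y + smult e d"
proof
  define z :: "real ^ 4" where "z = vector [- coeff d 1, - coeff d 2, - coeff d 3, - coeff d 4]"
  have z: "z $ 1 = - coeff d 1" "z $ 2 = - coeff d 2" "z $ 3 = - coeff d 3" "z $ 4 = - coeff d 4"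
    unfolding z_def by (rule vector_4)+
  have c: "c \<bullet> z = coeff d 0" using assms(2) unfolding inner_vec_4 z moment_eval_def by (simp add: algebra_simps)
  note d = poly_eq_le4[OF assms(1)]
  show "z \<noteq> 0"
  proof
    assume "z = 0"
    then have "c \<bullet> z = 0" "z $ 1 = 0" "z $ 2 = 0" "z $ 3 = 0" "z $ 4 = 0" by simp_all
    then have "d = 0" unfolding c z by (subst d) simp
    then show False using assms(3) by simp
  qed
  show "moment_poly c (y + e *\<^sub>R z) = moment_poly c y + smult e d" for y e
    by (subst d) (simp add: moment_poly_def z c inner_add_right)
qed

lemma poly_moment_poly_convex:
  "poly (moment_poly c ((1 - s) *\<^sub>R y + s *\<^sub>R z)) t = (1 - s) * poly (moment_poly c y) t + s * poly (moment_poly c z) t"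
  unfolding poly_moment_poly by (simp add: inner_add_right algebra_simps)

lemma cyclic_polytope4_nodes: "moment_point ` real ` {0..<n} = (\<lambda>k. moment_point (of_int k)) ` {0..<int n}"
proof -
  have "{0..<int n} = int ` {0..<n}" by (simp add: image_int_atLeastLessThan)
  then show ?thesis by (simp add: image_image)
qed

lemma polar_cyclic_iff:
  "y \<in> polar_at c (cyclic_polytope4 n) \<longleftrightarrow> (\<forall>k\<in>{0..<int n}. 0 \<le> poly (moment_poly c y) (of_int k))"
proof
  assume y: "y \<in> polar_at c (cyclic_polytope4 n)"
  have "moment_point (of_int k) \<in> cyclic_polytope4 n" if "k \<in> {0..<int n}" for k
    unfolding cyclic_polytope4_def cyclic_polytope4_nodes using that by (intro hull_inc imageI)
  then show "\<forall>k\<in>{0..<int n}. 0 \<le> poly (moment_poly c y) (of_int k)"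
    using y unfolding polar_at_def poly_moment_poly by force
next
  assume y: "\<forall>k\<in>{0..<int n}. 0 \<le> poly (moment_poly c y) (of_int k)"
  have "cyclic_polytope4 n \<subseteq> {x. y \<bullet> x \<le> 1 + y \<bullet> c}"
    unfolding cyclic_polytope4_def cyclic_polytope4_nodes
  proof (rule hull_minimal)
    show "(\<lambda>k. moment_point (of_int k)) ` {0..<int n} \<subseteq> {x. y \<bullet> x \<le> 1 + y \<bullet> c}"
      using y unfolding poly_moment_poly by (auto simp: inner_diff_left inner_commute algebra_simps)
  qed (rule convex_halfspace_le)
  then show "y \<in> polar_at c (cyclic_polytope4 n)"
    unfolding polar_at_def by (auto simp: inner_diff_left inner_commute algebra_simps)
qed

text \<open>The affine function belonging to \<open>p\<close> is nonnegative on the cyclic polytope,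
  hence positive at an interior point unless it is constant; a constant is settled by the node
  \<open>k\<close>.\<close>

lemma moment_eval_pos:
  assumes c: "c \<in> interior (cyclic_polytope4 n)" and p: "degree p \<le> 4"
    and nonneg: "\<And>k. k \<in> {0..<int n} \<Longrightarrow> 0 \<le> poly p (of_int k)" and k: "k \<in> {0..<int n}" "poly p (of_int k) \<noteq> 0"
  shows "moment_eval c p > 0"
proof -
  define v :: "real ^ 4" where "v = vector [coeff p 1, coeff p 2, coeff p 3, coeff p 4]"
  have v: "v $ 1 = coeff p 1" "v $ 2 = coeff p 2" "v $ 3 = coeff p 3" "v $ 4 = coeff p 4"
    unfolding v_def by (rule vector_4)+
  have ev: "poly p t = coeff p 0 + v \<bullet> moment_point t" for t
    by (subst poly_eq_le4[OF p]) (simp add: inner_vec_4 v moment_point_nth algebra_simps eval_nat_numeral)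
  have evc: "moment_eval c p = coeff p 0 + v \<bullet> c" unfolding moment_eval_def inner_vec_4 v by (simp add: algebra_simps)
  show ?thesis
  proof (cases "v = 0")
    case True
    then show ?thesis using evc ev[of "of_int k"] nonneg[OF k(1)] k(2) by simp
  next
    case False
    have "cyclic_polytope4 n \<subseteq> {x. v \<bullet> x \<ge> - coeff p 0}"
      unfolding cyclic_polytope4_def cyclic_polytope4_nodes
    proof (rule hull_minimal)
      show "(\<lambda>k. moment_point (of_int k)) ` {0..<int n} \<subseteq> {x. v \<bullet> x \<ge> - coeff p 0}"
        using nonneg unfolding ev by force
    qed (rule convex_halfspace_ge)
    then have "interior (cyclic_polytope4 n) \<subseteq> interior {x. v \<bullet> x \<ge> - coeff p 0}" by (rule interior_mono)
    then have "c \<in> {x. v \<bullet> x > - coeff p 0}" using c interior_halfspace_ge[OF False] by auto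
    then show ?thesis unfolding evc by simp
  qed
qed

lemma compact_convex_polar:
  assumes c: "c \<in> interior (cyclic_polytope4 n)"
  shows "compact (polar_at c (cyclic_polytope4 n))" "convex (polar_at c (cyclic_polytope4 n))"
proof -
  have eq: "polar_at c (cyclic_polytope4 n) = (\<Inter>x\<in>cyclic_polytope4 n. {y. (x - c) \<bullet> y \<le> 1})"
    unfolding polar_at_def by auto
  show "convex (polar_at c (cyclic_polytope4 n))" unfolding eq by (intro convex_INT convex_halfspace_le)
  have "closed (polar_at c (cyclic_polytope4 n))" unfolding eq by (intro closed_INT ballI closed_halfspace_le)
  moreover obtain e where e: "e > 0" "cball c e \<subseteq> cyclic_polytope4 n" using c unfolding mem_interior_cball by blast
  have "norm y \<le> 1 / e" if y: "y \<in> polar_at c (cyclic_polytope4 n)" for y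
  proof (cases "y = 0")
    case False
    \<comment> \<open>The point of the ball around \<open>c\<close> in direction \<open>y\<close>;
      its inequality reads \<open>e * norm y \<le> 1\<close>.\<close>
    define x where "x = c + (e / norm y) *\<^sub>R y"
    have "x \<in> cball c e" unfolding x_def using e(1) False by (simp add: dist_norm)
    then have "(x - c) \<bullet> y \<le> 1" using y e(2) unfolding polar_at_def by blast
    moreover have "(x - c) \<bullet> y = e * norm y" unfolding x_def using False by (simp add: dot_square_norm power2_eq_square)
    ultimately show ?thesis using e(1) by (simp add: field_simps)
  qed (use e in simp)
  then have "bounded (polar_at c (cyclic_polytope4 n))" unfolding bounded_iff by blast
  ultimately show "compact (polar_at c (cyclic_polytope4 n))" by (simp add: compact_eq_bounded_closed)
qed

lemma finite_tight: "finite (tight_set n c y)"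
  by (rule finite_subset[of _ "{0..<int n}"]) (auto simp: tight_set_def)

lemma card_roots_le:
  fixes p :: "real poly" and S :: "int set"
  assumes "p \<noteq> 0" "\<And>k. k \<in> S \<Longrightarrow> poly p (of_int k) = 0"
  shows "card S \<le> degree p"
proof -
  have "card S = card ((of_int :: int \<Rightarrow> real) ` S)" by (rule card_image[symmetric]) (simp add: inj_on_def)
  also have "\<dots> \<le> card {x. poly p x = 0}" by (rule card_mono) (use assms poly_roots_finite in auto)
  also have "\<dots> \<le> degree p" using card_poly_roots_bound[OF assms(1)] .
  finally show ?thesis .
qed

lemma poly_eq_0_if_4_roots:
  fixes p :: "real poly" and S :: "int set"
  assumes "degree p \<le> 4" "coeff p 4 = 0" "card S \<ge> 4" "\<And>k. k \<in> S \<Longrightarrow> poly p (of_int k) = 0"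
  shows "p = 0"
proof (rule ccontr)
  assume p: "p \<noteq> 0"
  then have "degree p \<ge> 4" using card_roots_le[OF p, of S] assms(3,4) by fastforce
  then have "degree p = 4" using assms(1) by simp
  then show False using assms(2) p leading_coeff_0_iff by metis
qed

text \<open>The combination \<open>r\<close> cancels the coefficients of degree 4 but keeps four
  roots, so it vanishes. Applying \<open>moment_eval\<close> to it shows that these coefficients
  agree, and then so do the polynomials.\<close>

lemma tight_determines:
  assumes S: "card S \<ge> 4" "S \<subseteq> tight_set n c y" "S \<subseteq> tight_set n c z"
  shows "y = z"
proof -
  let ?p = "moment_poly c y" and ?q = "moment_poly c z"
  have roots: "poly ?p (of_int k) = 0" "poly ?q (of_int k) = 0" if "k \<in> S" for k
    using that S unfolding tight_set_def by auto
  have low: "p = 0" if "degree p \<le> 4" "coeff p 4 = 0" "\<And>k. k \<in> S \<Longrightarrow> poly p (of_int k) = 0" for p :: "real poly"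
    using poly_eq_0_if_4_roots[OF that(1,2) S(1) that(3)] .
  define r where "r = smult (coeff ?q 4) ?p + smult (- coeff ?p 4) ?q"
  have "degree r \<le> 4" unfolding r_def
    using degree_moment_poly by (intro degree_add_le order_trans[OF degree_smult_le]) auto
  moreover have "coeff r 4 = 0" unfolding r_def by simp
  moreover have "poly r (of_int k) = 0" if "k \<in> S" for k unfolding r_def using roots[OF that] by simp
  ultimately have r0: "r = 0" by (rule low)
  then have "moment_eval c r = 0" by (simp add: moment_eval_def)
  then have eq: "coeff ?q 4 = coeff ?p 4" unfolding r_def moment_eval_add moment_eval_smult moment_eval_moment_poly by simp
  have "coeff ?p 4 \<noteq> 0"
  proof
    assume "coeff ?p 4 = 0"
    then have "?p = 0" using low[of ?p] degree_moment_poly roots(1) by blast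
    then have "moment_eval c ?p = 0" by (simp add: moment_eval_def)
    then show False unfolding moment_eval_moment_poly by simp
  qed
  moreover have "smult (coeff ?p 4) (?p - ?q) = 0" using r0 unfolding r_def eq by (simp add: smult_diff_right)
  ultimately have "?p = ?q" by simp
  then show ?thesis by (rule moment_poly_inj)
qed

text \<open>Used to move a point of the polar a little both ways along a direction that vanishes at
  its tight nodes.\<close>

lemma small_step:
  fixes f g :: "'b \<Rightarrow> real"
  assumes "finite A" "\<And>k. k \<in> A \<Longrightarrow> 0 \<le> f k" "\<And>k. k \<in> A \<Longrightarrow> f k = 0 \<Longrightarrow> g k = 0"
  shows "\<exists>e>0. \<forall>k\<in>A. 0 \<le> f k + e * g k \<and> 0 \<le> f k - e * g k"
proof -
  have "\<exists>e>0. \<forall>k\<in>A. e * \<bar>g k\<bar> \<le> f k" using assms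
  proof (induction A rule: finite_induct)
    case empty then show ?case by (intro exI[of _ 1]) simp
  next
    case (insert a A)
    then obtain e where e: "e > 0" "\<forall>k\<in>A. e * \<bar>g k\<bar> \<le> f k" by auto
    show ?case
    proof (cases "g a = 0")
      case True
      then show ?thesis using e insert.prems(1)[of a] by auto
    next
      case False
      then have fa: "f a > 0" using insert.prems(1,2)[of a] by (cases "f a = 0") (simp_all add: less_le)
      define e' where "e' = min e (f a / \<bar>g a\<bar>)"
      have "e' > 0" unfolding e'_def using e fa False by simp
      moreover have "e' * \<bar>g k\<bar> \<le> f k" if "k \<in> A" for k
        using that e mult_right_mono[of e' e "\<bar>g k\<bar>"] unfolding e'_def by fastforce
      moreover have "e' * \<bar>g a\<bar> \<le> f a"
        using mult_right_mono[of e' "f a / \<bar>g a\<bar>" "\<bar>g a\<bar>"] False unfolding e'_def by simp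
      ultimately show ?thesis by blast
    qed
  qed
  then obtain e where e: "e > 0" "\<forall>k\<in>A. e * \<bar>g k\<bar> \<le> f k" by blast
  have "0 \<le> f k + e * g k \<and> 0 \<le> f k - e * g k" if "k \<in> A" for k
    using e that abs_mult_pos[of e "g k"] abs_le_iff[of "e * g k" "f k"] by (auto simp: abs_mult mult.commute)
  then show ?thesis using e(1) by blast
qed

lemma tight_face:
  "{y \<in> polar_at c (cyclic_polytope4 n). S \<subseteq> tight_set n c y} face_of polar_at c (cyclic_polytope4 n)"
proof -
  let ?R = "polar_at c (cyclic_polytope4 n)"
  let ?g = "\<lambda>y k. poly (moment_poly c y) (real_of_int k)"
  have R: "0 \<le> ?g y k" if "y \<in> ?R" "k \<in> {0..<int n}" for y k using that polar_cyclic_iff by blast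
  show ?thesis
  proof (cases "S \<subseteq> {0..<int n}")
    case False
    then have e: "{y \<in> ?R. S \<subseteq> tight_set n c y} = {}" unfolding tight_set_def by auto
    show ?thesis unfolding e by (rule empty_face_of)
  next
    case True
    then have T: "S \<subseteq> tight_set n c y \<longleftrightarrow> (\<forall>k\<in>S. ?g y k = 0)" for y unfolding tight_set_def by auto
    have "convex {y \<in> ?R. S \<subseteq> tight_set n c y}"
      unfolding convex_alt T
    proof (intro ballI allI impI, elim conjE)
      fix x y and s :: real
      assume xy: "x \<in> {y \<in> ?R. \<forall>k\<in>S. ?g y k = 0}" "y \<in> {y \<in> ?R. \<forall>k\<in>S. ?g y k = 0}" and s: "0 \<le> s" "s \<le> 1"
      then have "(1 - s) *\<^sub>R x + s *\<^sub>R y \<in> ?R" unfolding polar_cyclic_iff poly_moment_poly_convex by auto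
      then show "(1 - s) *\<^sub>R x + s *\<^sub>R y \<in> {y \<in> ?R. \<forall>k\<in>S. ?g y k = 0}"
        using xy by (auto simp: poly_moment_poly_convex simp del: scaleR_conv_of_real)
    qed
    moreover have "S \<subseteq> tight_set n c a \<and> S \<subseteq> tight_set n c b" if ab: "a \<in> ?R" "b \<in> ?R" and x: "S \<subseteq> tight_set n c x" "x \<in> open_segment a b" for a b x
    proof -
      obtain s where s: "0 < s" "s < 1" "x = (1 - s) *\<^sub>R a + s *\<^sub>R b" using x(2) unfolding in_segment by blast
      have "?g a k = 0 \<and> ?g b k = 0" if "k \<in> S" for k
      proof -
        have k: "k \<in> {0..<int n}" using that True by blast
        have "(1 - s) * ?g a k + s * ?g b k = 0" using x(1) that unfolding T s(3) poly_moment_poly_convex by blast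
        moreover have "0 \<le> (1 - s) * ?g a k" "0 \<le> s * ?g b k" using s R[OF ab(1) k] R[OF ab(2) k] by auto
        ultimately have "(1 - s) * ?g a k = 0" "s * ?g b k = 0" by linarith+
        then show ?thesis using s by simp
      qed
      then show ?thesis unfolding T by blast
    qed
    ultimately show ?thesis unfolding face_of_def by blast
  qed
qed

text \<open>The midpoint \<open>m\<close> of \<open>u\<close> and \<open>w\<close> is tight only
  where both are. So the segment from \<open>z\<close> to \<open>m\<close> can be prolonged inside
  the polar, and \<open>m\<close> becomes an inner point of a segment with end
  \<open>z\<close>.\<close>

lemma tight_minimal_face:
  assumes H: "H face_of polar_at c (cyclic_polytope4 n)" and u: "u \<in> H" and w: "w \<in> H"
    and z: "z \<in> polar_at c (cyclic_polytope4 n)" "tight_set n c u \<inter> tight_set n c w \<subseteq> tight_set n c z"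
  shows "z \<in> H"
proof -
  let ?R = "polar_at c (cyclic_polytope4 n)"
  let ?g = "\<lambda>y k. poly (moment_poly c y) (real_of_int k)"
  define m where "m = (1 - 1/2) *\<^sub>R u + (1/2) *\<^sub>R w"
  have R: "u \<in> ?R" "w \<in> ?R" using H u w face_of_imp_subset by blast+
  have m: "?g m k = ?g u k / 2 + ?g w k / 2" for k unfolding m_def poly_moment_poly_convex by simp
  have mH: "m \<in> H" using face_of_imp_convex[OF H] u w unfolding m_def by (intro convexD_alt) auto
  show ?thesis
  proof (cases "z = m")
    case False
    have gz: "?g z k - ?g m k = 0" if "k \<in> {0..<int n}" "?g m k = 0" for k
    proof -
      have "0 \<le> ?g u k" "0 \<le> ?g w k" using R that unfolding polar_cyclic_iff by blast+
      then have "?g u k = 0" "?g w k = 0" using that(2) unfolding m by linarith+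
      then have "k \<in> tight_set n c u \<inter> tight_set n c w" using that(1) unfolding tight_set_def by simp
      then have "?g z k = 0" using z(2) unfolding tight_set_def by blast
      then show ?thesis using that(2) by simp
    qed
    have gm: "0 \<le> ?g m k" if "k \<in> {0..<int n}" for k
      using R that unfolding polar_cyclic_iff m by force
    have "\<exists>e>0. \<forall>k\<in>{0..<int n}. 0 \<le> ?g m k + e * (?g z k - ?g m k) \<and> 0 \<le> ?g m k - e * (?g z k - ?g m k)"
      by (rule small_step) (fact finite_atLeastLessThan_int gm gz)+
    then obtain e where e: "e > 0" "\<forall>k\<in>{0..<int n}. 0 \<le> ?g m k + e * (?g z k - ?g m k) \<and> 0 \<le> ?g m k - e * (?g z k - ?g m k)"
      by blast
    define x where "x = (1 - (- e)) *\<^sub>R m + (- e) *\<^sub>R z"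
    have xR: "x \<in> ?R" unfolding polar_cyclic_iff x_def poly_moment_poly_convex
      using e(2) by (simp add: algebra_simps)
    \<comment> \<open>Solves \<open>m = (1 - s) z + s x\<close> for the prolonged end
      \<open>x = (1 + e) m - e z\<close>.\<close>
    define s where "s = 1 / (1 + e)"
    have s: "0 < s" "s < 1" "s * (1 + e) = 1" using e(1) unfolding s_def by auto
    have "(1 - s) *\<^sub>R z + s *\<^sub>R x = (1 - s - s * e) *\<^sub>R z + (s * (1 + e)) *\<^sub>R m"
      unfolding x_def by (simp add: algebra_simps)
    also have "\<dots> = m" using s(3) by (simp add: algebra_simps)
    finally have "m = (1 - s) *\<^sub>R z + s *\<^sub>R x" ..
    moreover have "z \<noteq> x"
    proof
      assume "z = x"
      then have "(1 + e) *\<^sub>R (z - m) = 0" unfolding x_def by (simp add: algebra_simps)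
      then show False using e(1) False by simp
    qed
    ultimately have "m \<in> open_segment z x" unfolding in_segment using s(1,2) by (intro conjI exI[of _ s])
    then show ?thesis using face_ofD[OF H _ z(1) xR mH] by simp
  qed (use mH in simp)
qed

text \<open>The degree bounds the number of roots. With at most three tight nodes their root
  polynomial can be multiplied by a linear factor; its two coefficients are subject to the single
  equation \<open>moment_eval = 0\<close>, which leaves a direction in which \<open>y\<close> can be
  moved both ways.\<close>

lemma extreme_tight_card:
  assumes y: "y extreme_point_of polar_at c (cyclic_polytope4 n)"
  shows "card (tight_set n c y) = 4"
proof (rule antisym)
  let ?R = "polar_at c (cyclic_polytope4 n)"
  have yR: "y \<in> ?R" using y unfolding extreme_point_of_def by blast
  have ne: "moment_poly c y \<noteq> 0"
  proof
    assume "moment_poly c y = 0"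
    then have "moment_eval c (moment_poly c y) = 0" by (simp add: moment_eval_def)
    then show False unfolding moment_eval_moment_poly by simp
  qed
  have "card (tight_set n c y) \<le> degree (moment_poly c y)" by (rule card_roots_le[OF ne]) (simp add: tight_set_def)
  then show "card (tight_set n c y) \<le> 4" using degree_moment_poly order_trans by blast
  show "4 \<le> card (tight_set n c y)"
  proof (rule ccontr)
    assume "\<not> 4 \<le> card (tight_set n c y)"
    then have c3: "card (tight_set n c y) \<le> 3" by simp
    define q where "q = (\<Prod>k\<in>tight_set n c y. [:- real_of_int k, 1:])"
    have q: "degree q \<le> 3" "q \<noteq> 0" "\<And>k. k \<in> tight_set n c y \<Longrightarrow> poly q (of_int k) = 0"
    proof -
      show "q \<noteq> 0" unfolding q_def using finite_tight by simp
      have "degree q \<le> (\<Sum>k\<in>tight_set n c y. 1)" unfolding q_def by (rule order_trans[OF degree_prod_sum_le[OF finite_tight]]) simp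
      then show "degree q \<le> 3" using c3 by simp
      show "poly q (of_int k) = 0" if "k \<in> tight_set n c y" for k
        unfolding q_def poly_prod using that finite_tight by (intro prod_zero) auto
    qed
    obtain a b where ab: "[:a, b:] \<noteq> 0" "moment_eval c (q * [:a, b:]) = 0"
    proof (cases "moment_eval c q = 0")
      case True
      then show thesis using that[of 1 0] by simp
    next
      case False
      have "q * [:- moment_eval c (pCons 0 q), moment_eval c q:] =
          smult (- moment_eval c (pCons 0 q)) q + smult (moment_eval c q) (pCons 0 q)" by simp
      then show thesis using that[of "- moment_eval c (pCons 0 q)" "moment_eval c q"] False
        by (simp only: moment_eval_add moment_eval_smult) simp
    qed
    define d where "d = q * [:a, b:]"
    have "degree d \<le> degree q + degree [:a, b:]" unfolding d_def by (rule degree_mult_le)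
    also have "\<dots> \<le> 3 + 1" using q(1) by (intro add_mono) auto
    finally have "degree d \<le> 4" by simp
    moreover have "moment_eval c d = 0" "d \<noteq> 0" unfolding d_def using ab q(2) by (blast, simp del: mult_pCons_right)
    ultimately obtain z where z: "z \<noteq> 0" "\<And>y e. moment_poly c (y + e *\<^sub>R z) = moment_poly c y + smult e d"
      using moment_poly_direction by blast
    have "poly d (of_int k) = 0" if "k \<in> {0..<int n}" "poly (moment_poly c y) (of_int k) = 0" for k
      using q(3)[of k] that unfolding d_def tight_set_def by simp
    then obtain e where e: "e > 0" "\<forall>k\<in>{0..<int n}. 0 \<le> poly (moment_poly c y) (of_int k) + e * poly d (of_int k) \<and>
        0 \<le> poly (moment_poly c y) (of_int k) - e * poly d (of_int k)"
      using small_step[of "{0..<int n}" "\<lambda>k. poly (moment_poly c y) (of_int k)" "\<lambda>k. poly d (of_int k)"] yR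
      unfolding polar_cyclic_iff by auto
    have "y + e *\<^sub>R z \<in> ?R" "y + (- e) *\<^sub>R z \<in> ?R" unfolding polar_cyclic_iff z(2) using e(2) by auto
    moreover have "y \<in> open_segment (y + e *\<^sub>R z) (y + (- e) *\<^sub>R z)"
    proof -
      have "(y + e *\<^sub>R z) - (y + (- e) *\<^sub>R z) = (2 * e) *\<^sub>R z" by (simp add: scaleR_2 algebra_simps flip: scaleR_scaleR)
      then have "y + e *\<^sub>R z \<noteq> y + (- e) *\<^sub>R z" using e(1) z(1) by (metis diff_self mult_eq_0_iff less_irrefl scaleR_eq_0_iff zero_neq_numeral)
      moreover have "y = midpoint (y + e *\<^sub>R z) (y + (- e) *\<^sub>R z)" 
        by (simp add: midpoint_def scaleR_2[symmetric])
      ultimately show ?thesis using midpoint_in_open_segment by metis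
    qed
    ultimately show False using y unfolding extreme_point_of_def by blast
  qed
qed

text \<open>A quadratic with roots at a cyclically adjacent pair of nodes, signed to be nonnegative
  at all nodes: for the pair \<open>n - 1\<close>, \<open>0\<close> the other nodes lie between the
  roots, for any other pair none does.\<close>

definition gale_factor :: "int \<Rightarrow> int \<Rightarrow> real poly" where
  "gale_factor n x = (if x mod n = n - 1 then [:0, 1:] * [:of_int (n - 1), -1:]
     else [:- of_int (x mod n), 1:] * [:- of_int (x mod n + 1), 1:])"

lemma gale_factor:
  assumes n: "n \<ge> 5" and k: "k \<in> {0..<n}"
  shows "0 \<le> poly (gale_factor n x) (of_int k)"
    "poly (gale_factor n x) (of_int k) = 0 \<longleftrightarrow> k = x mod n \<or> k = (x + 1) mod n"
proof -
  have m: "0 \<le> x mod n" "x mod n < n" using n by auto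
  have s: "(x + 1) mod n = (if x mod n = n - 1 then 0 else x mod n + 1)"
  proof -
    have "(x + 1) mod n = (x mod n + 1) mod n" by (simp add: mod_simps)
    then show ?thesis using m by (auto simp: mod_pos_pos_trivial)
  qed
  have *: "poly (gale_factor n x) (of_int k) =
      of_int (if x mod n = n - 1 then k * (n - 1 - k) else (k - x mod n) * (k - (x mod n + 1)))"
    unfolding gale_factor_def by (simp add: algebra_simps)
  show "0 \<le> poly (gale_factor n x) (of_int k)"
  proof -
    have "0 \<le> (k - x mod n) * (k - (x mod n + 1))" by (cases "k \<le> x mod n") (auto intro: mult_nonpos_nonpos mult_nonneg_nonneg)
    then show ?thesis unfolding * of_int_0_le_iff using k by simp
  qed
  show "poly (gale_factor n x) (of_int k) = 0 \<longleftrightarrow> k = x mod n \<or> k = (x + 1) mod n"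
    unfolding * of_int_eq_0_iff s using k by auto
qed

lemma degree_gale_factor: "degree (gale_factor n x) \<le> 2"
proof -
  have "degree ([:a, b:] * [:c, d:]) \<le> 2" for a b c d :: real
  proof -
    have "degree ([:a, b:] * [:c, d:]) \<le> degree [:a, b:] + degree [:c, d:]" by (rule degree_mult_le)
    also have "\<dots> \<le> 1 + 1" by (intro add_mono) auto
    finally show ?thesis by simp
  qed
  then show ?thesis unfolding gale_factor_def by (simp del: mult_pCons_left mult_pCons_right)
qed

text \<open>The product of the two quadratics, scaled to \<open>moment_eval = 1\<close>, is a slack
  polynomial. The ends of an open segment through its point would be tight at the same four nodes
  and hence equal.\<close>

lemma gale_vertex:
  assumes n: "n \<ge> 5" and c: "c \<in> interior (cyclic_polytope4 n)" and u: "u \<in> strip_points (int n)"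
  shows "\<exists>y. y extreme_point_of polar_at c (cyclic_polytope4 n) \<and> tight_set n c y = gale (int n) u"
proof -
  let ?R = "polar_at c (cyclic_polytope4 n)"
  have n': "int n \<ge> 5" using n by simp
  define q where "q = gale_factor (int n) (fst u) * gale_factor (int n) (snd u)"
  have sub: "gale (int n) u \<subseteq> {0..<int n}" unfolding gale_def using n by auto
  have q: "0 \<le> poly q (of_int k)" "poly q (of_int k) = 0 \<longleftrightarrow> k \<in> gale (int n) u" if "k \<in> {0..<int n}" for k
    unfolding q_def gale_def using gale_factor[OF n' that] by (auto intro: mult_nonneg_nonneg)
  have "degree q \<le> degree (gale_factor (int n) (fst u)) + degree (gale_factor (int n) (snd u))"
    unfolding q_def by (rule degree_mult_le)
  also have "\<dots> \<le> 2 + 2" by (intro add_mono degree_gale_factor)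
  finally have dq: "degree q \<le> 4" by simp
  have "\<exists>k\<in>{0..<int n}. k \<notin> gale (int n) u"
  proof (rule ccontr)
    assume "\<not> ?thesis"
    then have "card {0..<int n} \<le> card (gale (int n) u)" by (intro card_mono) (auto simp: gale_def)
    then show False using gale_card(1)[OF n' u] n by simp
  qed
  then obtain k where k: "k \<in> {0..<int n}" "k \<notin> gale (int n) u" by blast
  have pos: "moment_eval c q > 0" by (rule moment_eval_pos[OF c dq q(1) k(1)]) (use q k in blast)+
  obtain y where y: "moment_poly c y = smult (1 / moment_eval c q) q"
  proof (rule moment_poly_ex)
    show "degree (smult (1 / moment_eval c q) q) \<le> 4" using dq degree_smult_le order_trans by blast
    show "moment_eval c (smult (1 / moment_eval c q) q) = 1" using pos by (simp add: moment_eval_smult)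
  qed
  have yR: "y \<in> ?R" unfolding polar_cyclic_iff y using q(1) pos by simp
  have T: "tight_set n c y = gale (int n) u" unfolding tight_set_def y using q(2) pos sub by auto
  have "y \<notin> open_segment a b" if ab: "a \<in> ?R" "b \<in> ?R" for a b
  proof
    assume seg: "y \<in> open_segment a b"
    have "gale (int n) u \<subseteq> tight_set n c a" "gale (int n) u \<subseteq> tight_set n c b"
      using face_ofD[OF tight_face[of c n "gale (int n) u"] seg ab] yR T by auto
    then have "a = b" using tight_determines[of "gale (int n) u" n c a b] gale_card(1)[OF n' u] by simp
    then show False using seg by simp
  qed
  then have "y extreme_point_of ?R" unfolding extreme_point_of_def using yR by blast
  then show ?thesis using T by blast
qed

lemma card4_sorted:
  fixes T :: "int set"
  assumes "card T = 4"
  obtains a b d e where "T = {a, b, d, e}" "a < b" "b < d" "d < e"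
proof -
  have fin: "finite T" using assms card.infinite by fastforce
  define xs where "xs = sorted_list_of_set T"
  have "length xs = 4" unfolding xs_def using assms by simp
  then obtain a b d e where "xs = [a, b, d, e]"
    by (auto simp: numeral_eq_Suc length_Suc_conv)
  then have l: "sorted_list_of_set T = [a, b, d, e]" unfolding xs_def .
  have "sorted_wrt (<) [a, b, d, e]" using strict_sorted_list_of_set[of T] unfolding l .
  moreover have "T = {a, b, d, e}" using set_sorted_list_of_set[OF fin] unfolding l by simp
  ultimately show thesis using that by simp
qed

text \<open>The slack polynomial has constant sign on the nodes, so no node lies between two of its roots
  where it has the opposite sign.\<close>

lemma vertex_gale:
  assumes n: "n \<ge> 5" and y: "y extreme_point_of polar_at c (cyclic_polytope4 n)"
  shows "\<exists>u\<in>strip_points (int n). tight_set n c y = gale (int n) u"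
proof -
  obtain a b d e where T: "tight_set n c y = {a, b, d, e}" and o: "a < b" "b < d" "d < e"
    using card4_sorted[OF extreme_tight_card[OF y]] .
  have yR: "y \<in> polar_at c (cyclic_polytope4 n)" using y unfolding extreme_point_of_def by blast
  define q where "q = [:- real_of_int a, 1:] * [:- of_int b, 1:] * [:- of_int d, 1:] * [:- of_int e, 1:]"
  define l where "l = coeff (moment_poly c y) 4"
  have dq: "degree q \<le> 4"
    unfolding q_def by (simp add: degree_mult_eq del: mult_pCons_left mult_pCons_right)
  have cq: "coeff q 4 = 1" unfolding q_def by (simp add: coeff_pCons eval_nat_numeral)
  have pq: "moment_poly c y - smult l q = 0"
  proof (rule poly_eq_0_if_4_roots[of _ "tight_set n c y"])
    show "degree (moment_poly c y - smult l q) \<le> 4"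
      using degree_moment_poly dq by (intro degree_diff_le order_trans[OF degree_smult_le]) auto
    show "coeff (moment_poly c y - smult l q) 4 = 0" unfolding l_def using cq by simp
    show "4 \<le> card (tight_set n c y)" using extreme_tight_card[OF y] by simp
    fix k assume k: "k \<in> tight_set n c y"
    then have "poly (moment_poly c y) (of_int k) = 0" unfolding tight_set_def by simp
    moreover have "poly q (of_int k) = 0" using k unfolding T q_def poly_mult by auto
    ultimately show "poly (moment_poly c y - smult l q) (of_int k) = 0" by simp
  qed
  have l0: "l \<noteq> 0"
  proof
    assume "l = 0"
    then have "moment_poly c y = 0" using pq by simp
    then have "moment_eval c (moment_poly c y) = 0" by (simp add: moment_eval_def)
    then show False unfolding moment_eval_moment_poly by simp
  qed
  have sgn: "0 \<le> l * of_int ((t - a) * (t - b) * (t - d) * (t - e))" if "t \<in> {0..<int n}" for t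
  proof -
    have "poly (moment_poly c y) (of_int t) = l * poly q (of_int t)" using pq by (metis eq_iff_diff_eq_0 poly_smult)
    moreover have "0 \<le> poly (moment_poly c y) (of_int t)" using yR that unfolding polar_cyclic_iff by blast
    ultimately have "0 \<le> l * poly q (of_int t)" by simp
    moreover have "poly q (of_int t) = of_int ((t - a) * (t - b) * (t - d) * (t - e))"
      unfolding q_def poly_mult by simp
    ultimately show ?thesis by simp
  qed
  have rng: "0 \<le> a" "e < int n" using T unfolding tight_set_def by auto
  show ?thesis
  proof (cases "l > 0")
    \<comment> \<open>The slack is negative between \<open>a\<close> and \<open>b\<close> and
      between \<open>d\<close> and \<open>e\<close>, so each of these two pairs is
      consecutive.\<close>
    case True
    have nn: "0 \<le> (t - a) * (t - b) * (t - d) * (t - e)" if "t \<in> {0..<int n}" for t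
    proof -
      have "real_of_int ((t - a) * (t - b) * (t - d) * (t - e)) \<ge> 0"
        using sgn[OF that] True unfolding zero_le_mult_iff[of l] by linarith
      then show ?thesis by (simp only: of_int_0_le_iff)
    qed
    have b: "b = a + 1"
    proof (rule ccontr)
      assume "b \<noteq> a + 1"
      then have "(a + 1 - a) * (a + 1 - b) * (a + 1 - d) * (a + 1 - e) < 0"
        using o by (intro mult_pos_neg mult_neg_neg) auto
      then show False using nn[of "a + 1"] rng o by simp
    qed
    have e: "e = d + 1"
    proof (rule ccontr)
      assume "e \<noteq> d + 1"
      then have "(d + 1 - a) * (d + 1 - b) * (d + 1 - d) * (d + 1 - e) < 0"
        using o by (intro mult_pos_neg mult_pos_pos) auto
      then show False using nn[of "d + 1"] rng o by simp
    qed
    have "(a, d) \<in> strip_points (int n)" unfolding strip_points_def using o rng b e by simp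
    moreover have "gale (int n) (a, d) = {a, b, d, e}" unfolding gale_def b e using o rng b e by simp
    ultimately show ?thesis unfolding T by blast
  next
    \<comment> \<open>The slack is negative before \<open>a\<close>, between \<open>b\<close> and
      \<open>d\<close>, and after \<open>e\<close>, so the pairs are \<open>b\<close>,
      \<open>b + 1\<close> and the wrapping one \<open>n - 1\<close>, \<open>0\<close>.\<close>
    case False
    then have l: "l < 0" using l0 by simp
    have np: "(t - a) * (t - b) * (t - d) * (t - e) \<le> 0" if "t \<in> {0..<int n}" for t
    proof -
      have "real_of_int ((t - a) * (t - b) * (t - d) * (t - e)) \<le> 0"
        using sgn[OF that] l unfolding zero_le_mult_iff[of l] by linarith
      then show ?thesis by (simp only: of_int_le_0_iff)
    qed
    have a: "a = 0"
    proof (rule ccontr)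
      assume "a \<noteq> 0"
      then have "0 < (0 - a) * (0 - b) * (0 - d) * (0 - e)"
        using o rng by (intro mult_neg_neg mult_pos_neg) auto
      then show False using np[of 0] rng o by simp
    qed
    have e: "e = int n - 1"
    proof (rule ccontr)
      assume "e \<noteq> int n - 1"
      then have "0 < (int n - 1 - a) * (int n - 1 - b) * (int n - 1 - d) * (int n - 1 - e)"
        using o rng by (intro mult_pos_pos) auto
      then show False using np[of "int n - 1"] n by simp
    qed
    have d: "d = b + 1"
    proof (rule ccontr)
      assume "d \<noteq> b + 1"
      then have "0 < (b + 1 - a) * (b + 1 - b) * (b + 1 - d) * (b + 1 - e)"
        using o by (intro mult_neg_neg mult_pos_neg mult_pos_pos) auto
      then show False using np[of "b + 1"] rng o by simp
    qed
    have "(b, e) \<in> strip_points (int n)" unfolding strip_points_def using o a d e by simp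
    moreover have m: "(int n - 1) mod int n = int n - 1" "b mod int n = b" "(b + 1) mod int n = b + 1"
      by (rule mod_pos_pos_trivial; use n o a d e in linarith)+
    have "gale (int n) (b, e) = {a, b, d, e}" unfolding gale_def a d e fst_conv snd_conv m by auto
    ultimately show ?thesis unfolding T by blast
  qed
qed

section \<open>From the polar to a combinatorially equivalent polytope\<close>

lemma face_contains_vertex:
  fixes F S :: "'a::euclidean_space set"
  assumes "F face_of S" "F \<noteq> {}" "compact S" "convex S"
  shows "\<exists>v. v \<in> F \<and> v extreme_point_of S"
proof -
  have "compact F" "convex F" using assms face_of_imp_compact face_of_imp_convex by blast+
  then obtain v where "v extreme_point_of F" using extreme_point_exists_convex assms(2) by blast
  then show ?thesis using extreme_point_of_face[OF assms(1)] by blast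
qed

text \<open>Every nonempty face contains a vertex, so the vertices are the minimal nonempty faces
  and are preserved by an order isomorphism; a vertex lies in a face if and only if its singleton is
  a smaller face.\<close>

lemma face_vertices_transfer:
  fixes P :: "'a::euclidean_space set" and R :: "'b::euclidean_space set"
  assumes P: "compact P" "convex P" and R: "compact R" "convex R" and eqv: "combinatorially_equivalent P R"
  obtains \<psi> where "bij_betw \<psi> {w. w extreme_point_of R} {v. v extreme_point_of P}"
    "\<And>G. G face_of R \<Longrightarrow> \<exists>F. F face_of P \<and> (\<forall>w. w extreme_point_of R \<longrightarrow> (\<psi> w \<in> F \<longleftrightarrow> w \<in> G))"
    "\<And>F. F face_of P \<Longrightarrow> \<exists>G. G face_of R \<and> (\<forall>w. w extreme_point_of R \<longrightarrow> (\<psi> w \<in> F \<longleftrightarrow> w \<in> G))"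
proof -
  obtain \<phi> where bij: "bij_betw \<phi> {F. F face_of P} {G. G face_of R}"
    and ord: "\<And>F G. F face_of P \<Longrightarrow> G face_of P \<Longrightarrow> F \<subseteq> G \<longleftrightarrow> \<phi> F \<subseteq> \<phi> G"
    using eqv unfolding combinatorially_equivalent_def by blast
  have face: "\<phi> F face_of R" if "F face_of P" for F using bij that bij_betwE by blast
  have surj: "\<exists>F. F face_of P \<and> \<phi> F = G" if "G face_of R" for G
    using bij that unfolding bij_betw_def by (metis (mono_tags, lifting) imageE mem_Collect_eq)
  have inj: "F = F'" if "F face_of P" "F' face_of P" "\<phi> F = \<phi> F'" for F F'
    using bij that unfolding bij_betw_def inj_on_def by blast
  have empty: "\<phi> {} = {}"
  proof -
    obtain F where F: "F face_of P" "\<phi> F = {}" using surj[of "{}"] by auto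
    then show ?thesis using ord[of "{}" F] by simp
  qed
  have ne: "\<phi> F \<noteq> {}" if "F face_of P" "F \<noteq> {}" for F using inj[of F "{}"] that empty by auto
  have atom: "\<exists>v. v extreme_point_of P \<and> \<phi> {v} = {w}" if w: "w extreme_point_of R" for w
  proof -
    obtain F where F: "F face_of P" "\<phi> F = {w}" using surj[of "{w}"] w face_of_singleton by blast
    then obtain v where v: "v \<in> F" "v extreme_point_of P" using face_contains_vertex[OF F(1) _ P] empty by fastforce
    then have fv: "{v} face_of P" by (simp add: face_of_singleton)
    then have "\<phi> {v} \<subseteq> {w}" using ord[OF fv F(1)] v(1) F(2) by simp
    then show ?thesis using ne[OF fv] v(2) by blast
  qed
  have atom': "\<exists>w. w extreme_point_of R \<and> \<phi> {v} = {w}" if v: "v extreme_point_of P" for v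
  proof -
    have fv: "{v} face_of P" using v by (simp add: face_of_singleton)
    obtain w where w: "w \<in> \<phi> {v}" "w extreme_point_of R" using face_contains_vertex[OF face[OF fv] ne[OF fv] R] by blast
    obtain v' where v': "v' extreme_point_of P" "\<phi> {v'} = {w}" using atom[OF w(2)] by blast
    then have "{v'} \<subseteq> {v}" using ord[of "{v'}" "{v}"] fv w(1) by (simp add: face_of_singleton)
    then show ?thesis using v'(2) w(2) by auto
  qed
  define \<psi> where "\<psi> w = (SOME v. v extreme_point_of P \<and> \<phi> {v} = {w})" for w
  have \<psi>: "\<psi> w extreme_point_of P" "\<phi> {\<psi> w} = {w}" if "w extreme_point_of R" for w
    using someI_ex[OF atom[OF that]] unfolding \<psi>_def by blast+
  have mem: "\<psi> w \<in> F \<longleftrightarrow> w \<in> \<phi> F" if "w extreme_point_of R" "F face_of P" for w F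
    using ord[of "{\<psi> w}" F] \<psi>[OF that(1)] that(2) by (simp add: face_of_singleton)
  show thesis
  proof (rule that)
    show "bij_betw \<psi> {w. w extreme_point_of R} {v. v extreme_point_of P}"
      unfolding bij_betw_def
    proof (intro conjI subset_antisym subsetI)
      show "inj_on \<psi> {w. w extreme_point_of R}"
        by (rule inj_onI) (metis \<psi>(2) mem_Collect_eq singleton_inject)
      fix v
      show "v \<in> \<psi> ` {w. w extreme_point_of R} \<Longrightarrow> v \<in> {v. v extreme_point_of P}" using \<psi>(1) by auto
      assume "v \<in> {v. v extreme_point_of P}"
      then obtain w where w: "w extreme_point_of R" "\<phi> {v} = {w}" "v extreme_point_of P" using atom' by blast
      then have "{v} = {\<psi> w}" using inj[of "{v}" "{\<psi> w}"] \<psi>[OF w(1)] by (simp add: face_of_singleton)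
      then show "v \<in> \<psi> ` {w. w extreme_point_of R}" using w(1) by auto
    qed
    show "\<exists>F. F face_of P \<and> (\<forall>w. w extreme_point_of R \<longrightarrow> (\<psi> w \<in> F \<longleftrightarrow> w \<in> G))" if "G face_of R" for G
      using surj[OF that] mem by blast
    show "\<exists>G. G face_of R \<and> (\<forall>w. w extreme_point_of R \<longrightarrow> (\<psi> w \<in> F \<longleftrightarrow> w \<in> G))" if "F face_of P" for F
      using face[OF that] mem[OF _ that] by blast
  qed
qed

text \<open>What is kept of the face lattice: \<open>ex_face\<close> turns common facets into edges
  and 2-faces, \<open>face_closed\<close> shows that there are no further edges.\<close>

locale gale_polytope =
  fixes n :: int and P :: "'a::euclidean_space set" and vtx :: "int \<times> int \<Rightarrow> 'a"
  assumes n5: "n \<ge> 5" and polytope_P: "polytope P"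
    and vtx_extreme: "u \<in> strip_points n \<Longrightarrow> vtx u extreme_point_of P"
    and vtx_eq: "u \<in> strip_points n \<Longrightarrow> w \<in> strip_points n \<Longrightarrow> vtx u = vtx w \<longleftrightarrow> gale n u = gale n w"
    and extreme_vtx: "v extreme_point_of P \<Longrightarrow> \<exists>u\<in>strip_points n. v = vtx u"
    and ex_face: "\<exists>F. F face_of P \<and> (\<forall>u\<in>strip_points n. vtx u \<in> F \<longleftrightarrow> S \<subseteq> gale n u)"
    and face_closed: "F face_of P \<Longrightarrow> u \<in> strip_points n \<Longrightarrow> w \<in> strip_points n \<Longrightarrow> z \<in> strip_points n \<Longrightarrow>
      vtx u \<in> F \<Longrightarrow> vtx w \<in> F \<Longrightarrow> gale n u \<inter> gale n w \<subseteq> gale n z \<Longrightarrow> vtx z \<in> F"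

lemma gale_polytope_ex:
  assumes n: "n \<ge> 5" and P: "polytope P" and c: "c \<in> interior (cyclic_polytope4 n)"
    and eqv: "combinatorially_equivalent P (polar_at c (cyclic_polytope4 n))"
  shows "\<exists>vtx. gale_polytope (int n) P vtx"
proof (rule face_vertices_transfer[OF polytope_imp_compact[OF P] polytope_imp_convex[OF P] compact_convex_polar[OF c] eqv])
  let ?R = "polar_at c (cyclic_polytope4 n)" and ?L = "strip_points (int n)"
  fix \<psi>
  assume bij: "bij_betw \<psi> {w. w extreme_point_of ?R} {v. v extreme_point_of P}"
    and up: "\<And>G. G face_of ?R \<Longrightarrow> \<exists>F. F face_of P \<and> (\<forall>w. w extreme_point_of ?R \<longrightarrow> (\<psi> w \<in> F \<longleftrightarrow> w \<in> G))"
    and down: "\<And>F. F face_of P \<Longrightarrow> \<exists>G. G face_of ?R \<and> (\<forall>w. w extreme_point_of ?R \<longrightarrow> (\<psi> w \<in> F \<longleftrightarrow> w \<in> G))"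
  define y where "y u = (SOME y. y extreme_point_of ?R \<and> tight_set n c y = gale (int n) u)" for u
  have y: "y u extreme_point_of ?R" "tight_set n c (y u) = gale (int n) u" if "u \<in> ?L" for u
    using someI_ex[OF gale_vertex[OF n c that]] unfolding y_def by blast+
  have yR: "y u \<in> ?R" if "u \<in> ?L" for u using y(1)[OF that] unfolding extreme_point_of_def by blast
  have n': "int n \<ge> 5" using n by simp
  have y_eq: "z = y u" if u: "u \<in> ?L" "tight_set n c z = gale (int n) u" for u z
    using tight_determines[of "gale (int n) u" n c z "y u"] gale_card(1)[OF n' u(1)] y(2)[OF u(1)] u(2) by simp
  show ?thesis
  proof (intro exI[of _ "\<lambda>u. \<psi> (y u)"] gale_polytope.intro)
    show "int n \<ge> 5" "polytope P" by (rule n', rule P)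
    show "\<psi> (y u) extreme_point_of P" if "u \<in> ?L" for u using bij_betwE[OF bij] y(1)[OF that] by blast
    show "\<psi> (y u) = \<psi> (y w) \<longleftrightarrow> gale (int n) u = gale (int n) w" if "u \<in> ?L" "w \<in> ?L" for u w
    proof -
      have "\<psi> (y u) = \<psi> (y w) \<longleftrightarrow> y u = y w"
        using inj_on_eq_iff[OF bij_betw_imp_inj_on[OF bij]] y(1)[OF that(1)] y(1)[OF that(2)] by simp
      also have "\<dots> \<longleftrightarrow> gale (int n) u = gale (int n) w" 
      proof
        assume "y u = y w"
        then show "gale (int n) u = gale (int n) w" using y(2)[OF that(1)] y(2)[OF that(2)] by simp
      next
        assume "gale (int n) u = gale (int n) w"
        then show "y u = y w" using y_eq[OF that(2), of "y u"] y(2)[OF that(1)] by simp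
      qed
      finally show ?thesis .
    qed
    show "\<exists>u\<in>?L. v = \<psi> (y u)" if "v extreme_point_of P" for v
    proof -
      have "v \<in> \<psi> ` {w. w extreme_point_of ?R}" using bij that unfolding bij_betw_def by simp
      then obtain z where z: "z extreme_point_of ?R" "v = \<psi> z" by blast
      then obtain u where u: "u \<in> ?L" "tight_set n c z = gale (int n) u" using vertex_gale[OF n] by blast
      then show ?thesis using y_eq z(2) by blast
    qed
    show "\<exists>F. F face_of P \<and> (\<forall>u\<in>?L. \<psi> (y u) \<in> F \<longleftrightarrow> S \<subseteq> gale (int n) u)" for S
    proof -
      obtain F where F: "F face_of P" "\<And>w. w extreme_point_of ?R \<Longrightarrow> \<psi> w \<in> F \<longleftrightarrow> w \<in> {z \<in> ?R. S \<subseteq> tight_set n c z}"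
        using up[OF tight_face[of c n S]] by blast
      have "\<psi> (y u) \<in> F \<longleftrightarrow> S \<subseteq> gale (int n) u" if "u \<in> ?L" for u
        using F(2)[OF y(1)[OF that]] yR[OF that] y(2)[OF that] by simp
      then show ?thesis using F(1) by blast
    qed
    show "\<psi> (y z) \<in> F" if F0: "F face_of P" and L: "u \<in> ?L" "w \<in> ?L" "z \<in> ?L" and F: "\<psi> (y u) \<in> F" "\<psi> (y w) \<in> F"
      and sub: "gale (int n) u \<inter> gale (int n) w \<subseteq> gale (int n) z" for F u w z
    proof -
      obtain G where G: "G face_of ?R" "\<And>w. w extreme_point_of ?R \<Longrightarrow> \<psi> w \<in> F \<longleftrightarrow> w \<in> G"
        using down[OF F0] by blast
      have "y z \<in> G"
      proof (rule tight_minimal_face[OF G(1)])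
        show "y u \<in> G" "y w \<in> G" using G(2) y(1) L F by blast+
        show "y z \<in> ?R" by (rule yR[OF L(3)])
        show "tight_set n c (y u) \<inter> tight_set n c (y w) \<subseteq> tight_set n c (y z)" using y(2) L sub by simp
      qed
      then show ?thesis using G(2) y(1)[OF L(3)] by blast
    qed
  qed
qed

text \<open>The dual of neighborliness: any two facets have a common vertex, so their 2-face is
  nonempty and has a sink.\<close>

lemma gale_pair_ex:
  fixes n k l :: int
  assumes n: "n \<ge> 5" and kl: "k \<in> {0..<n}" "l \<in> {0..<n}" "k \<noteq> l"
  shows "\<exists>u\<in>strip_points n. {k, l} \<subseteq> gale n u"
proof -
  have less: "\<exists>u\<in>strip_points n. {k, l} \<subseteq> gale n u" if "0 \<le> k" "k < l" "l < n" for k l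
  proof -
    have m: "k mod n = k" "l mod n = l" using that by (auto simp: mod_pos_pos_trivial)
    show ?thesis
    proof (cases "l = k + 1 \<or> l = k + n - 1")
      case True
      then show ?thesis
      proof
        assume "l = k + 1"
        then show ?thesis using m n by (intro bexI[of _ "(k, k + 2)"]) (auto simp: gale_def strip_points_def)
      next
        assume l: "l = k + n - 1"
        then have kl: "k = (n - 1 + 1) mod n" "l = n - 1" using that by auto
        have "l = (n - 1) mod n" unfolding kl(2)[symmetric] using m(2) ..
        then have "{k, l} \<subseteq> gale n (n - 1, n + 1)" using kl(1) unfolding gale_def fst_conv snd_conv by blast
        then show ?thesis using n by (intro bexI[of _ "(n - 1, n + 1)"]) (auto simp: strip_points_def)
      qed
    next
      case False
      then have "(k, l) \<in> strip_points n" using that unfolding strip_points_def by auto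
      then show ?thesis using m by (intro bexI[of _ "(k, l)"]) (auto simp: gale_def)
    qed
  qed
  show ?thesis
  proof (cases "k < l")
    case True
    then show ?thesis using less[of k l] kl by simp
  next
    case False
    then show ?thesis using less[of l k] kl by (simp add: insert_commute)
  qed
qed

context gale_polytope
begin

lemma extreme_point_of_face_iff:
  assumes "F face_of P"
  shows "a extreme_point_of F \<longleftrightarrow> (\<exists>u\<in>strip_points n. a = vtx u \<and> vtx u \<in> F)"
proof
  assume "a extreme_point_of F"
  then have a: "a extreme_point_of P" "a \<in> F" using extreme_point_of_face[OF assms] by auto
  then show "\<exists>u\<in>strip_points n. a = vtx u \<and> vtx u \<in> F" using extreme_vtx[OF a(1)] by auto
next
  assume "\<exists>u\<in>strip_points n. a = vtx u \<and> vtx u \<in> F"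
  then show "a extreme_point_of F" using extreme_point_of_face[OF assms] vtx_extreme by auto
qed

text \<open>The face cut out by the three common facets has no other vertices, so by Krein-Milman it
  is the segment.\<close>

lemma adjacent_vtx_if:
  assumes u: "u \<in> strip_points n" and w: "w \<in> strip_points n" and card3: "card (gale n u \<inter> gale n w) = 3"
  shows "adjacent_vertices P (vtx u) (vtx w)"
proof -
  obtain v where v: "neighbor n u v" "gale n v = gale n w" using card3_neighbor[OF n5 u w card3] .
  have only: "gale n z = gale n u \<or> gale n z = gale n w" if "z \<in> strip_points n" "gale n u \<inter> gale n w \<subseteq> gale n z" for z
  proof -
    obtain c where "gale n u \<inter> gale n v = gale n u - {c}"
      "\<And>z. z \<in> strip_points n \<Longrightarrow> gale n u - {c} \<subseteq> gale n z \<Longrightarrow> gale n z = gale n u \<or> gale n z = gale n v"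
      using neighbor_drop[OF n5 v(1)] by metis
    then show ?thesis using that v(2) by metis
  qed
  obtain F where F: "F face_of P" "\<And>z. z \<in> strip_points n \<Longrightarrow> vtx z \<in> F \<longleftrightarrow> gale n u \<inter> gale n w \<subseteq> gale n z"
    using ex_face[of "gale n u \<inter> gale n w"] by blast
  have "{a. a extreme_point_of F} = {vtx u, vtx w}"
  proof (intro subset_antisym subsetI)
    fix a assume "a \<in> {a. a extreme_point_of F}"
    then obtain z where z: "z \<in> strip_points n" "a = vtx z" "vtx z \<in> F"
      unfolding extreme_point_of_face_iff[OF F(1)] by auto
    then show "a \<in> {vtx u, vtx w}" using only[OF z(1)] F(2)[OF z(1)] vtx_eq[OF z(1) u] vtx_eq[OF z(1) w] by simp
  next
    fix a assume "a \<in> {vtx u, vtx w}"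
    moreover have "vtx u \<in> F" "vtx w \<in> F" using F(2)[OF u] F(2)[OF w] by auto
    ultimately show "a \<in> {a. a extreme_point_of F}" unfolding extreme_point_of_face_iff[OF F(1)] using u w by auto
  qed
  moreover have "compact F" "convex F"
    using F(1) face_of_imp_compact face_of_imp_convex polytope_P polytope_imp_compact polytope_imp_convex by blast+
  ultimately have "F = convex hull {vtx u, vtx w}" using Krein_Milman_Minkowski by metis
  then have seg: "F = closed_segment (vtx u) (vtx w)" by (simp add: segment_convex_hull)
  have ne: "vtx u \<noteq> vtx w"
  proof
    assume "vtx u = vtx w"
    then have "gale n u \<inter> gale n w = gale n u" using vtx_eq[OF u w] by simp
    then show False using card3 gale_card(1)[OF n5 u] by simp
  qed
  then have "aff_dim F = 1" unfolding seg segment_convex_hull aff_dim_convex_hull by (simp add: aff_dim_2)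
  then show ?thesis unfolding adjacent_vertices_def edge_of_def using ne F(1) vtx_extreme[OF u] vtx_extreme[OF w] seg by simp
qed

text \<open>Leave \<open>u\<close> along the edge dropping a facet \<open>k\<close> that is not
  tight at \<open>w\<close>. The other end is tight wherever both \<open>u\<close> and
  \<open>w\<close> are, so it lies in the face spanned by \<open>a\<close> and \<open>b\<close> and
  must be \<open>b\<close>.\<close>

lemma adjacent_vtx:
  assumes adj: "adjacent_vertices P a b"
  shows "\<exists>u\<in>strip_points n. \<exists>w\<in>strip_points n. a = vtx u \<and> b = vtx w \<and> card (gale n u \<inter> gale n w) = 3"
proof -
  have ab: "a extreme_point_of P" "b extreme_point_of P" "a \<noteq> b" and F: "closed_segment a b face_of P"
    using adj unfolding adjacent_vertices_def edge_of_def by blast+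
  obtain u where u: "u \<in> strip_points n" "a = vtx u" using extreme_vtx[OF ab(1)] by (elim bexE)
  obtain w where w: "w \<in> strip_points n" "b = vtx w" using extreme_vtx[OF ab(2)] by (elim bexE)
  have "gale n u \<noteq> gale n w" using ab(3) vtx_eq[OF u(1) w(1)] u(2) w(2) by simp
  moreover have "finite (gale n w)" by (simp add: gale_def)
  ultimately have "\<not> gale n u \<subseteq> gale n w"
    using card_subset_eq[of "gale n w" "gale n u"] gale_card(1)[OF n5 u(1)] gale_card(1)[OF n5 w(1)] by linarith
  then obtain k where k: "k \<in> gale n u" "k \<notin> gale n w" by blast
  obtain v where v: "neighbor n u v" "gale n u \<inter> gale n v = gale n u - {k}"
    by (rule ex_neighbor_drop[OF n5 u(1) k(1)])
  have vL: "v \<in> strip_points n" using neighbor_strip(2)[OF n5 v(1)] .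
  have "gale n u \<inter> gale n w \<subseteq> gale n v" using k v(2) by blast
  then have "vtx v \<in> closed_segment a b" using face_closed[OF F u(1) w(1) vL] u(2) w(2) by simp
  then have "vtx v extreme_point_of closed_segment a b" unfolding extreme_point_of_face_iff[OF F] by (intro bexI[OF _ vL] conjI refl)
  then have "vtx v = a \<or> vtx v = b" by (simp add: extreme_point_of_segment)
  moreover have "vtx v \<noteq> a" using neighbor_gale_ne[OF n5 v(1)] vtx_eq[OF vL u(1)] u(2) by simp
  ultimately have "gale n v = gale n w" using vtx_eq[OF vL w(1)] w(2) by simp
  then show ?thesis using neighbor_gale_card[OF n5 v(1)] u w by (intro bexI[OF _ u(1)] bexI[OF _ w(1)] conjI) simp_all
qed

lemma cyclic_auso:
  assumes D: "AUSO P D"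
  shows "cyclic_auso n vtx D"
proof
  have gD: "graph_orientation P D" using D unfolding AUSO_def by blast
  show "n \<ge> 5" by (rule n5)
  show "u \<in> strip_points n \<Longrightarrow> w \<in> strip_points n \<Longrightarrow> vtx u = vtx w \<longleftrightarrow> gale n u = gale n w" for u w by (rule vtx_eq)
  show "\<exists>u\<in>strip_points n. \<exists>w\<in>strip_points n. a = vtx u \<and> b = vtx w \<and> card (gale n u \<inter> gale n w) = 3"
    if "(a, b) \<in> D" for a b
    by (rule adjacent_vtx) (use gD that in \<open>simp add: graph_orientation_def\<close>)
  show "((vtx u, vtx w) \<in> D) \<noteq> ((vtx w, vtx u) \<in> D)"
    if "u \<in> strip_points n" "w \<in> strip_points n" "card (gale n u \<inter> gale n w) = 3" for u w
    using adjacent_vtx_if[OF that] gD unfolding graph_orientation_def by simp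
  show "acyclic D" using D unfolding AUSO_def by blast
  fix k l assume kl: "k \<in> {0..<n}" "l \<in> {0..<n}" "k \<noteq> l"
  obtain F where F: "F face_of P" "\<And>z. z \<in> strip_points n \<Longrightarrow> vtx z \<in> F \<longleftrightarrow> {k, l} \<subseteq> gale n z"
    using ex_face[of "{k, l}"] by blast
  obtain u where u: "u \<in> strip_points n" "{k, l} \<subseteq> gale n u" using gale_pair_ex[OF n5 kl] by (elim bexE)
  have "F \<noteq> {}" using F(2)[OF u(1)] u(2) by auto
  then have "\<exists>!a. sink_of_face D F a" using D F(1) unfolding AUSO_def by blast
  moreover have "sink_of_face D F a \<longleftrightarrow> (\<exists>u\<in>strip_points n. a = vtx u \<and> k \<in> gale n u \<and> l \<in> gale n u \<and>
          (\<forall>w\<in>strip_points n. k \<in> gale n w \<longrightarrow> l \<in> gale n w \<longrightarrow> (vtx u, vtx w) \<notin> D))" for a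
  proof -
    have mem: "vtx z \<in> F \<longleftrightarrow> k \<in> gale n z \<and> l \<in> gale n z" if "z \<in> strip_points n" for z using F(2)[OF that] by simp
    have "(\<forall>w. (\<exists>u\<in>strip_points n. w = vtx u \<and> vtx u \<in> F) \<longrightarrow> (b, w) \<notin> D) \<longleftrightarrow>
      (\<forall>w\<in>strip_points n. k \<in> gale n w \<longrightarrow> l \<in> gale n w \<longrightarrow> (b, vtx w) \<notin> D)" for b
    proof -
      have "(\<forall>w. (\<exists>u\<in>strip_points n. w = vtx u \<and> vtx u \<in> F) \<longrightarrow> (b, w) \<notin> D) \<longleftrightarrow>
        (\<forall>w\<in>strip_points n. vtx w \<in> F \<longrightarrow> (b, vtx w) \<notin> D)" by blast
      also have "\<dots> \<longleftrightarrow> (\<forall>w\<in>strip_points n. k \<in> gale n w \<longrightarrow> l \<in> gale n w \<longrightarrow> (b, vtx w) \<notin> D)"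
        by (rule ball_cong[OF refl]) (simp add: mem imp_conjL)
      finally show ?thesis .
    qed
    note out = this
    show ?thesis unfolding sink_of_face_def extreme_point_of_face_iff[OF F(1)] out
    proof (intro iffI; elim conjE bexE)
      fix u assume u: "u \<in> strip_points n" "a = vtx u" "vtx u \<in> F"
        "\<forall>w\<in>strip_points n. k \<in> gale n w \<longrightarrow> l \<in> gale n w \<longrightarrow> (a, vtx w) \<notin> D"
      show "\<exists>u\<in>strip_points n. a = vtx u \<and> k \<in> gale n u \<and> l \<in> gale n u \<and>
          (\<forall>w\<in>strip_points n. k \<in> gale n w \<longrightarrow> l \<in> gale n w \<longrightarrow> (vtx u, vtx w) \<notin> D)"
        using u mem[OF u(1)] by (intro bexI[OF _ u(1)]) simp
    next
      fix u assume u: "u \<in> strip_points n" "a = vtx u" "k \<in> gale n u" "l \<in> gale n u"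
        "\<forall>w\<in>strip_points n. k \<in> gale n w \<longrightarrow> l \<in> gale n w \<longrightarrow> (vtx u, vtx w) \<notin> D"
      show "(\<exists>u\<in>strip_points n. a = vtx u \<and> vtx u \<in> F) \<and>
        (\<forall>w\<in>strip_points n. k \<in> gale n w \<longrightarrow> l \<in> gale n w \<longrightarrow> (a, vtx w) \<notin> D)"
        using u mem[OF u(1)] by (intro conjI bexI[OF _ u(1)]) simp_all
    qed
  qed
  ultimately show "\<exists>!a. \<exists>u\<in>strip_points n. a = vtx u \<and> k \<in> gale n u \<and> l \<in> gale n u \<and>
          (\<forall>w\<in>strip_points n. k \<in> gale n w \<longrightarrow> l \<in> gale n w \<longrightarrow> (vtx u, vtx w) \<notin> D)" by simp
qed

end

section \<open>The expected number of pivot steps\<close>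

definition steps_cost :: "nat option \<Rightarrow> ennreal" where
  "steps_cost r = (case r of None \<Rightarrow> \<infinity> | Some k \<Rightarrow> of_nat k)"

lemma expected_pivot_steps_cost:
  "expected_pivot_steps P D v = (\<integral>\<^sup>+ r. steps_cost r \<partial>measure_pmf (random_edge_steps (global_sink P D) D v))"
  unfolding expected_pivot_steps_def steps_cost_def ..

lemma expected_pivot_steps_sink: "v = global_sink P D \<Longrightarrow> expected_pivot_steps P D v = 0"
  unfolding expected_pivot_steps_cost by (subst random_edge_steps.simps) (simp add: steps_cost_def)

text \<open>The outcome \<open>None\<close> costs infinity before and after adding one step, so the
  recursion for the cost holds for it as well.\<close>

lemma expected_pivot_steps_step:
  assumes "v \<noteq> global_sink P D" "finite {w. (v, w) \<in> D}" "{w. (v, w) \<in> D} \<noteq> {}"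
  shows "expected_pivot_steps P D v =
    (\<Sum>w\<in>{w. (v, w) \<in> D}. 1 + expected_pivot_steps P D w) / of_nat (card {w. (v, w) \<in> D})"
proof -
  let ?A = "{w. (v, w) \<in> D}" and ?X = "random_edge_steps (global_sink P D) D"
  have inner: "(\<integral>\<^sup>+ r. steps_cost r \<partial>measure_pmf (map_spmf Suc (?X w))) = 1 + expected_pivot_steps P D w" for w
  proof -
    have "(\<integral>\<^sup>+ r. steps_cost r \<partial>measure_pmf (map_spmf Suc (?X w))) = (\<integral>\<^sup>+ r. 1 + steps_cost r \<partial>measure_pmf (?X w))"
      unfolding nn_integral_map_pmf by (intro nn_integral_cong) (simp add: steps_cost_def split: option.split)
    also have "\<dots> = 1 + expected_pivot_steps P D w"
      unfolding expected_pivot_steps_cost by (subst nn_integral_add) (simp_all add: measure_pmf.emeasure_space_1)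
    finally show ?thesis .
  qed
  have "?X v = bind_spmf (spmf_of_set ?A) (\<lambda>w. map_spmf Suc (?X w))"
    by (rule trans[OF random_edge_steps.simps]) (simp add: assms(1))
  then have "?X v = bind_pmf (pmf_of_set ?A) (\<lambda>w. map_spmf Suc (?X w))"
    unfolding spmf_of_pmf_pmf_of_set[OF assms(2,3), symmetric] bind_spmf_of_pmf .
  then have "expected_pivot_steps P D v = (\<integral>\<^sup>+ w. 1 + expected_pivot_steps P D w \<partial>measure_pmf (pmf_of_set ?A))"
    unfolding expected_pivot_steps_cost[of P D v] by (simp only: nn_integral_bind_pmf inner)
  then show ?thesis using nn_integral_pmf_of_set[OF assms(3,2)] by simp
qed

theorem theorem1p1:
  shows "\<exists>C::real. \<forall>n\<ge>5. \<forall>(P :: (real ^ 4) set) D v_st.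
     polytope P \<longrightarrow> aff_dim P = 4 \<longrightarrow> card {F. F facet_of P} = n \<longrightarrow>
     (\<exists>c \<in> interior (cyclic_polytope4 n).
        combinatorially_equivalent P (polar_at c (cyclic_polytope4 n))) \<longrightarrow>
     AUSO P D \<longrightarrow> v_st extreme_point_of P \<longrightarrow>
     expected_pivot_steps P D v_st \<le> ennreal (C * real n)"
\<comment> \<open>60 n + 34 is at most 67 n, since 34 is less than 7 n for
  \<open>n \<ge> 5\<close>.\<close>
proof (intro exI[of _ 67] allI impI, elim bexE)
  fix n :: nat and P :: "(real ^ 4) set" and D v c
  assume n: "n \<ge> 5" and P: "polytope P" and c: "c \<in> interior (cyclic_polytope4 n)"
    and eqv: "combinatorially_equivalent P (polar_at c (cyclic_polytope4 n))"
    and D: "AUSO P D" and v: "v extreme_point_of P"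
  obtain vtx where "gale_polytope (int n) P vtx" using gale_polytope_ex[OF n P c eqv] ..
  then interpret gale_polytope "int n" P vtx .
  interpret cyclic_auso "int n" vtx D by (rule cyclic_auso[OF D])
  obtain u where u: "u \<in> strip_points (int n)" "v = vtx u" using extreme_vtx[OF v] by blast
  have "P \<noteq> {}" using v unfolding extreme_point_of_def by blast
  moreover have "P face_of P" using face_of_refl polytope_imp_convex[OF P] by blast
  ultimately have uniq: "\<exists>!a. sink_of_face D P a" using D unfolding AUSO_def by blast
  have "expected_pivot_steps P D (vtx u) \<le> ennreal (of_int (60 * int n + 34))"
  proof (rule expected_steps_le[OF _ _ u(1)])
    fix a assume a: "a \<in> vtx ` strip_points (int n)"
    {
      assume "{b. (a, b) \<in> D} = {}"
      then have "sink_of_face D P a" unfolding sink_of_face_def using a vtx_extreme by blast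
      then have "a = global_sink P D" unfolding global_sink_def using the1_equality[OF uniq] by simp
      then show "expected_pivot_steps P D a = 0" by (rule expected_pivot_steps_sink)
    }
    assume ne: "{b. (a, b) \<in> D} \<noteq> {}"
    have "finite {b. (a, b) \<in> D}" by (rule finite_subset[OF _ finite_vtx]) (use D_sub in blast)
    then show "expected_pivot_steps P D a \<le>
        (\<Sum>b\<in>{b. (a, b) \<in> D}. 1 + expected_pivot_steps P D b) / of_nat (card {b. (a, b) \<in> D})"
      using expected_pivot_steps_step[of a P D] expected_pivot_steps_sink[of a P D] ne
      by (cases "a = global_sink P D") simp_all
  qed
  also have "\<dots> \<le> ennreal (67 * real n)" using n by (intro ennreal_leI) simp
  finally show "expected_pivot_steps P D v \<le> ennreal (67 * real n)" unfolding u(2) .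
qed

end
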